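(* Let $k,n,r$ be integers with $k\ge 1$, $0\le r\le k$ and $2k\le r+n$. The prime ideal $I_{k,n,r}$ of the spinor-helicity variety $\mathrm{SH}(k,n,r)$ is minimally generated by quadratic forms: there is a minimal generating set $\mathcal{G}$ of $I_{k,n,r}$ consisting of quadratic forms such that, for every linear extension of the poset $\mathcal{P}_{k,n,r}$, the set $\mathcal{G}$ is a Gröbner basis of $I_{k,n,r}$ with respect to the reverse lexicographic term order given by that linear extension. The initial ideal of $I_{k,n,r}$ with respect to any such term order is generated by the products of pairs of incomparable elements in $\mathcal{P}_{k,n,r}$.
   Context: $\mathrm{Gr}(k,n)\subset\mathbb{P}^{\binom nk-1}$ is the Grassmannian of $k$-dimensional subspaces of $\mathbb{C}^n$ in its Plücker embedding, and $\mathrm{SH}(k,n,r)=\{(V,W)\in\mathrm{Gr}(k,n)\times\mathrm{Gr}(k,n):\dim(V\cap W^\perp)\ge k-r\}\subset\mathbb{P}^{\binom nk-1}\times\mathbb{P}^{\binom nk-1}$, where $W^\perp$ is the orthogonal complement for the standard bilinear form on $\mathbb{C}^n$. $R=\mathbb{C}[\langle i_1\cdots i_k\rangle,[j_1\cdots j_k]]$ is the polynomial ring in $2\binom nk$ variables, where $1\le i_1<\dots<i_k\le n$ and $1\le j_1<\dots<j_k\le n$; the variables $\langle I\rangle$ are Plücker coordinates of $V$ and the variables $[J]$ are Plücker coordinates of $W$. $I_{k,n,r}\subset R$ is the bihomogeneous prime ideal of all polynomials vanishing on (the bi-affine cone over) $\mathrm{SH}(k,n,r)$. Poset $\mathcal{P}_{k,n,r}$: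 its elements are the $2\binom nk$ variables of $R$. The order is the transitive closure of the following relations. (1) $\langle i_1\cdots i_k\rangle\le\langle j_1\cdots j_k\rangle$ whenever $i_1\le j_1,\dots,i_k\le j_k$. (2) $[i_1\cdots i_k]\le[j_1\cdots j_k]$ whenever $i_1\ge j_1,\dots,i_k\ge j_k$. (3) $[1\,2\cdots r\,i_{r+1}\cdots i_k]\le\langle 1\,2\cdots r\,j_{r+1}\cdots j_k\rangle$ for each ordered set partition $\{r+1,\dots,2k-r\}=\{i_{r+1},\dots,i_k\}\sqcup\{j_{r+1},\dots,j_k\}$ into two blocks of size $k-r$ (each block written increasingly). A linear extension of $\mathcal{P}_{k,n,r}$ is a total order on the variables of $R$ refining the partial order; it defines the (degree) reverse lexicographic term order on $R$. *)

theory Defs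
  imports
    "HOL-Library.Poly_Mapping"
    "HOL-Algebra.Ideal"
    "Jordan_Normal_Form.Determinant"
    "Jordan_Normal_Form.VS_Connect"
begin

subsection \<open>The polynomial ring\<close>

definition plucker_indices :: "nat \<Rightarrow> nat \<Rightarrow> nat list set" where
  "plucker_indices k n = {I. length I = k \<and> sorted_wrt (<) I \<and> set I \<subseteq> {1..n}}"

text \<open>\<open>Angle I\<close> and \<open>Square J\<close> are the brackets written with angular and with square
  delimiters in the literature on spinor-helicity.\<close>

datatype bracket = Angle "nat list" | Square "nat list"

definition bracket_vars :: "nat \<Rightarrow> nat \<Rightarrow> bracket set" where
  "bracket_vars k n = Angle ` plucker_indices k n \<union> Square ` plucker_indices k n"

type_synonym monomial = "bracket \<Rightarrow>\<^sub>0 nat"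
type_synonym bracket_poly = "monomial \<Rightarrow>\<^sub>0 complex"

definition bracket_ring :: "nat \<Rightarrow> nat \<Rightarrow> bracket_poly ring" where
  "bracket_ring k n =
     \<lparr>carrier = {p. \<forall>m \<in> Poly_Mapping.keys p. Poly_Mapping.keys m \<subseteq> bracket_vars k n},
      mult = (*), one = 1, zero = 0, add = (+)\<rparr>"

definition poly_of_monomial :: "monomial \<Rightarrow> bracket_poly" where
  "poly_of_monomial m = Poly_Mapping.single m 1"

definition poly_of_var :: "bracket \<Rightarrow> bracket_poly" where
  "poly_of_var x = poly_of_monomial (Poly_Mapping.single x 1)"

definition eval_bracket_poly :: "(bracket \<Rightarrow> complex) \<Rightarrow> bracket_poly \<Rightarrow> complex" where
  "eval_bracket_poly f p =
     (\<Sum>m \<in> Poly_Mapping.keys p. Poly_Mapping.lookup p m *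
        (\<Prod>x \<in> Poly_Mapping.keys m. f x ^ Poly_Mapping.lookup m x))"

definition monomial_degree :: "monomial \<Rightarrow> nat" where
  "monomial_degree m = (\<Sum>x \<in> Poly_Mapping.keys m. Poly_Mapping.lookup m x)"

definition quadratic_form :: "nat \<Rightarrow> nat \<Rightarrow> bracket_poly \<Rightarrow> bool" where
  "quadratic_form k n p \<longleftrightarrow>
     p \<in> carrier (bracket_ring k n) \<and> (\<forall>m \<in> Poly_Mapping.keys p. monomial_degree m = 2)"

definition minimally_generates :: "('a, 'b) ring_scheme \<Rightarrow> 'a set \<Rightarrow> 'a set \<Rightarrow> bool" where
  "minimally_generates R G I \<longleftrightarrow>
     G \<subseteq> carrier R \<and> genideal R G = I \<and> (\<forall>H. H \<subset> G \<longrightarrow> genideal R H \<noteq> I)"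


subsection \<open>The spinor-helicity variety and its ideal\<close>

abbreviation complex_space :: "nat \<Rightarrow> (complex, complex vec) module" where
  "complex_space n \<equiv> module_vec TYPE(complex) n"

definition subspace_dim :: "nat \<Rightarrow> complex vec set \<Rightarrow> nat" where
  "subspace_dim n V = vectorspace.dim class_ring (complex_space n\<lparr>carrier := V\<rparr>)"

definition Grassmannian :: "nat \<Rightarrow> nat \<Rightarrow> complex vec set set" where
  "Grassmannian k n =
     {V. subspace class_ring V (complex_space n) \<and> subspace_dim n V = k}"

text \<open>The library's \<open>orthogonal_complement\<close> is taken with respect to the bilinear form
  \<open>v \<bullet> w\<close>, without complex conjugation.\<close>

definition spinor_helicity :: "nat \<Rightarrow> nat \<Rightarrow> nat \<Rightarrow> (complex vec set \<times> complex vec set) set" where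
  "spinor_helicity k n r =
     {(V, W) \<in> Grassmannian k n \<times> Grassmannian k n.
        k - r \<le> subspace_dim n (V \<inter> vec_module.orthogonal_complement n W)}"

text \<open>The maximal minor of \<open>A\<close> in the columns listed in \<open>I\<close>. Matrix entries are indexed
  from 0, Plucker indices from 1.\<close>

definition plucker_coord :: "nat \<Rightarrow> complex mat \<Rightarrow> nat list \<Rightarrow> complex" where
  "plucker_coord k A I = det (mat k k (\<lambda>(a, b). A $$ (a, I ! b - 1)))"

text \<open>All pairs of (possibly zero) multiples of Plucker vectors of \<open>V\<close> and \<open>W\<close>, for
  \<open>(V, W)\<close> in the variety. Since \<open>V\<close> has dimension \<open>k\<close>, a matrix with \<open>k\<close> rows and row space
  \<open>V\<close> is the same as a basis of \<open>V\<close>. The values outside \<open>bracket_vars k n\<close> are never used.\<close>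

definition spinor_helicity_cone :: "nat \<Rightarrow> nat \<Rightarrow> nat \<Rightarrow> (bracket \<Rightarrow> complex) set" where
  "spinor_helicity_cone k n r =
     {case_bracket (\<lambda>I. c * plucker_coord k A I) (\<lambda>J. d * plucker_coord k B J) | c d A B.
        A \<in> carrier_mat k n \<and> B \<in> carrier_mat k n \<and>
        (vec_space.row_space n A, vec_space.row_space n B) \<in> spinor_helicity k n r}"

definition spinor_helicity_ideal :: "nat \<Rightarrow> nat \<Rightarrow> nat \<Rightarrow> bracket_poly set" where
  "spinor_helicity_ideal k n r =
     {p \<in> carrier (bracket_ring k n). \<forall>f \<in> spinor_helicity_cone k n r. eval_bracket_poly f p = 0}"


subsection \<open>The poset of variables\<close>

definition angle_rel :: "nat \<Rightarrow> nat \<Rightarrow> bracket rel" where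
  "angle_rel k n = {(Angle I, Angle J) | I J.
     I \<in> plucker_indices k n \<and> J \<in> plucker_indices k n \<and> (\<forall>a<k. I ! a \<le> J ! a)}"

definition square_rel :: "nat \<Rightarrow> nat \<Rightarrow> bracket rel" where
  "square_rel k n = {(Square I, Square J) | I J.
     I \<in> plucker_indices k n \<and> J \<in> plucker_indices k n \<and> (\<forall>a<k. I ! a \<ge> J ! a)}"

definition mixed_rel :: "nat \<Rightarrow> nat \<Rightarrow> bracket rel" where
  "mixed_rel k r = {(Square ([1..<r+1] @ I), Angle ([1..<r+1] @ J)) | I J.
     length I = k - r \<and> sorted_wrt (<) I \<and> length J = k - r \<and> sorted_wrt (<) J \<and>
     set I \<inter> set J = {} \<and> set I \<union> set J = {r+1..2*k-r}}"

text \<open>A pair \<open>(x, y)\<close> stands for \<open>x \<le> y\<close>. The relation is reflexive on \<open>bracket_vars k n\<close>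
  because \<open>angle_rel\<close> and \<open>square_rel\<close> are.\<close>

definition bracket_poset :: "nat \<Rightarrow> nat \<Rightarrow> nat \<Rightarrow> bracket rel" where
  "bracket_poset k n r = (angle_rel k n \<union> square_rel k n \<union> mixed_rel k r)\<^sup>+"

definition linear_extension :: "nat \<Rightarrow> nat \<Rightarrow> nat \<Rightarrow> bracket rel \<Rightarrow> bool" where
  "linear_extension k n r L \<longleftrightarrow>
     linear_order_on (bracket_vars k n) L \<and> bracket_poset k n r \<subseteq> L"

definition incomparable_products :: "nat \<Rightarrow> nat \<Rightarrow> nat \<Rightarrow> bracket_poly set" where
  "incomparable_products k n r =
     {poly_of_var x * poly_of_var y | x y.
        x \<in> bracket_vars k n \<and> y \<in> bracket_vars k n \<and>
        (x, y) \<notin> bracket_poset k n r \<and> (y, x) \<notin> bracket_poset k n r}"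


subsection \<open>Reverse lexicographic initial ideals and Groebner bases\<close>

text \<open>\<open>L\<close>-smaller variables are smaller in the term order: for monomials \<open>a\<close> and \<open>b\<close> of the same
  degree, \<open>a\<close> is smaller than \<open>b\<close> if the \<open>L\<close>-least variable whose exponents differ has the
  larger exponent in \<open>a\<close>.\<close>

definition revlex_less :: "bracket rel \<Rightarrow> monomial \<Rightarrow> monomial \<Rightarrow> bool" where
  "revlex_less L a b \<longleftrightarrow>
     monomial_degree a < monomial_degree b \<or>
     monomial_degree a = monomial_degree b \<and>
     (\<exists>x \<in> Field L. Poly_Mapping.lookup b x < Poly_Mapping.lookup a x \<and>
        (\<forall>y. y \<noteq> x \<and> (y, x) \<in> L \<longrightarrow> Poly_Mapping.lookup a y = Poly_Mapping.lookup b y))"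

definition leading_monomial :: "bracket rel \<Rightarrow> bracket_poly \<Rightarrow> monomial" where
  "leading_monomial L p =
     (THE m. m \<in> Poly_Mapping.keys p \<and>
        (\<forall>m' \<in> Poly_Mapping.keys p. m' \<noteq> m \<longrightarrow> revlex_less L m' m))"

definition initial_ideal :: "nat \<Rightarrow> nat \<Rightarrow> bracket rel \<Rightarrow> bracket_poly set \<Rightarrow> bracket_poly set" where
  "initial_ideal k n L S =
     genideal (bracket_ring k n)
       {poly_of_monomial (leading_monomial L p) | p. p \<in> S \<and> p \<noteq> 0}"

definition groebner_basis ::
  "nat \<Rightarrow> nat \<Rightarrow> bracket rel \<Rightarrow> bracket_poly set \<Rightarrow> bracket_poly set \<Rightarrow> bool" where
  "groebner_basis k n L G I \<longleftrightarrow>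
     finite G \<and> G \<subseteq> I \<and> initial_ideal k n L G = initial_ideal k n L I"

end

theory Submission
  imports Defs "Jordan_Normal_Form.DL_Rank"
begin

text \<open>
Let \<open>N = n - k + r\<close>. A pair \<open>(V, W)\<close> lies in the variety iff \<open>V\<close> and the orthogonal complement
\<open>U\<close> of \<open>W\<close>, of dimensions \<open>k\<close> and \<open>n - k\<close>, have a common subspace of dimension \<open>k - r\<close>. Then a
single \<open>N \<times> n\<close> matrix describes the pair: its first \<open>k\<close> rows span \<open>V\<close>, its last \<open>n - k\<close> rows span
\<open>U\<close>, and the \<open>k - r\<close> rows in the overlap lie in both. The bracket \<open>Angle I\<close> becomes the
minor of the first \<open>k\<close> rows in the columns \<open>I\<close>, and \<open>Square J\<close> becomes, up to a common scalar and a
sign depending on \<open>J\<close>, the minor of the last \<open>n - k\<close> rows in the columns complementary to \<open>J\<close>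
(\<open>complementary_minors\<close>). So the ideal consists of the polynomials that vanish on the image of an
affine space of matrices and scalars (\<open>spinor_helicity_ideal_eq\<close>). It is prime because affine
spaces are irreducible, which is seen by restricting polynomials to lines.

A bracket is now a column of numbers, \<open>I\<close> in the rows \<open>0, ..., k - 1\<close> or the complement of \<open>J\<close> in
the rows \<open>r, ..., N - 1\<close>. The poset order says that the column \<open>x\<close> may stand to the left of \<open>y\<close> in
a tableau whose rows increase weakly (\<open>bracket_poset_iff\<close>), so a monomial supported on a chain is a
semistandard skew tableau. Call these monomials standard. The proof is the usual standard
monomial theory for such tableaux and rests on two facts.

First, a product of two brackets is a combination of standard products (\<open>straightening\<close>). If the
rows of the two-column tableau decrease somewhere, antisymmetrizing over the upper part of the
right column and the lower part of the left column gives zero, as there are more vectors than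
rows (\<open>garnir_relation\<close>), and all other terms have a smaller left column.

Second, standard monomials are linearly independent (\<open>standard_independent\<close>). For each bracket \<open>z\<close>
there is a linear space of parameters, a Schubert subset, on which all brackets that are not above
\<open>z\<close> vanish identically, while \<open>z\<close> itself does not. Restricting a relation to the Schubert subset of a maximal
element \<open>z\<close> among the least variables of its monomials leaves only monomials divisible by
\<open>z\<close>, and \<open>z\<close> can be cancelled.

The same restriction shows that in the straightening law \<open>x y = \<Sum> c z w\<close> of an incomparable pair every
\<open>z\<close> lies below \<open>x\<close> and \<open>y\<close> (\<open>quadratic_straightening\<close>). So \<open>x y\<close> is the leading monomial
for the reverse lexicographic order of every linear extension. By independence no
element of the ideal has a standard leading monomial, so the straightening laws form
a Groebner basis. They generate minimally since each of the monomials \<open>x y\<close> occurs in exactly one of them.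
\<close>

section \<open>Minors and the Garnir relation\<close>

text \<open>The rows are \<open>s, ..., e - 1\<close>. The list of columns may be unsorted or contain repetitions, because
exchanging entries between columns produces such lists.\<close>

definition minor :: "(nat \<Rightarrow> nat \<Rightarrow> 'a::comm_ring_1) \<Rightarrow> nat \<Rightarrow> nat \<Rightarrow> nat list \<Rightarrow> 'a" where
  "minor M s e l = det (mat (e - s) (e - s) (\<lambda>(i, j). M (s + i) (l ! j)))"

lemma minor_Leibniz:
  "minor M s e l = (\<Sum>p | p permutes {0..<e - s}. signof p * (\<Prod>j<e - s. M (s + p j) (l ! j)))"
proof -
  have "minor M s e l = (\<Sum>p | p permutes {0..<e - s}. signof p *
      (\<Prod>j<e - s. mat (e - s) (e - s) (\<lambda>(i, j). M (s + i) (l ! j)) $$ (p j, j)))"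
    unfolding minor_def by (rule det_col) simp
  also have "\<dots> = (\<Sum>p | p permutes {0..<e - s}. signof p * (\<Prod>j<e - s. M (s + p j) (l ! j)))"
  proof (intro sum.cong refl arg_cong2[where f = "(*)"] prod.cong)
    fix p j assume "p \<in> {p. p permutes {0..<e - s}}" and j: "j \<in> {..<e - s}"
    then have "p j < e - s" by (metis atLeast0LessThan lessThan_iff mem_Collect_eq permutes_in_image)
    with j show "mat (e - s) (e - s) (\<lambda>(i, j). M (s + i) (l ! j)) $$ (p j, j) = M (s + p j) (l ! j)"
      by simp
  qed
  finally show ?thesis .
qed

lemma minor_permute_columns:
  assumes p: "p permutes {0..<e - s}" and l: "\<And>j. j < e - s \<Longrightarrow> l' ! j = l ! p j"
  shows "minor M s e l' = signof p * minor M s e l"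
proof -
  let ?m = "e - s"
  let ?A = "mat ?m ?m (\<lambda>(i, j). M (s + j) (l ! i))"
  have pm: "p i < ?m" if "i < ?m" for i
    using p that by (metis atLeast0LessThan lessThan_iff permutes_in_image)
  have "minor M s e l' = det (transpose_mat (mat ?m ?m (\<lambda>(i, j). ?A $$ (p i, j))))"
    unfolding minor_def by (intro arg_cong[where f = det] eq_matI) (auto simp: l pm)
  also have "\<dots> = det (mat ?m ?m (\<lambda>(i, j). ?A $$ (p i, j)))"
    by (rule det_transpose[of _ ?m]) simp
  also have "\<dots> = signof p * det ?A" by (rule det_permute_rows[OF _ p]) simp
  also have "det ?A = det (transpose_mat ?A)" by (rule det_transpose[symmetric, of _ ?m]) simp
  also have "\<dots> = minor M s e l"
    unfolding minor_def by (intro arg_cong[where f = det] eq_matI) auto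
  finally show ?thesis .
qed

lemma minor_repeated_column:
  assumes "i < e - s" "j < e - s" "i \<noteq> j" "l ! i = l ! j"
  shows "minor M s e l = 0"
  unfolding minor_def
  by (rule det_identical_columns[OF _ \<open>i \<noteq> j\<close> \<open>i < e - s\<close> \<open>j < e - s\<close>])
    (use assms in \<open>auto intro!: eq_vecI\<close>)

lemma minor_not_distinct:
  assumes "length l = e - s" "\<not> distinct l"
  shows "minor M s e l = 0"
  using assms minor_repeated_column[of _ e s _ l M] by (metis distinct_conv_nth)

lemma minor_sort:
  assumes "length l = e - s"
  obtains c :: "'a::comm_ring_1" where "\<And>M. minor M s e l = c * minor M s e (sort l)"
proof -
  obtain p where p: "p permutes {..<length (sort l)}" "permute_list p (sort l) = l"
    using mset_eq_permutation[of l "sort l"] by auto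
  have "minor M s e l = of_int (sign p) * minor M s e (sort l)" for M :: "nat \<Rightarrow> nat \<Rightarrow> 'a"
  proof (rule minor_permute_columns)
    show "p permutes {0..<e - s}" using p(1) assms by (simp add: atLeast0LessThan)
    show "l ! j = sort l ! p j" if "j < e - s" for j
      using that assms p permute_list_nth[OF p(1), of j] by simp
  qed
  then show ?thesis by (rule that)
qed

text \<open>The numbers permuted in a Garnir relation, in one sequence: the first \<open>u\<close> entries of the right
column \<open>I\<close>, then the entries of the left column \<open>K\<close> from position \<open>v\<close> on.
After a permutation the first \<open>u\<close> of them go back to \<open>I\<close> and the others to
\<open>K\<close>.\<close>

definition shuffled :: "nat list \<Rightarrow> nat list \<Rightarrow> nat \<Rightarrow> nat \<Rightarrow> nat \<Rightarrow> nat" where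
  "shuffled I K u v i = (if i < u then I ! i else K ! (v + i - u))"

definition shuffle_right :: "nat list \<Rightarrow> nat list \<Rightarrow> nat \<Rightarrow> nat \<Rightarrow> (nat \<Rightarrow> nat) \<Rightarrow> nat list" where
  "shuffle_right I K u v \<sigma> = map (\<lambda>j. if j < u then shuffled I K u v (\<sigma> j) else I ! j) [0..<length I]"

definition shuffle_left :: "nat list \<Rightarrow> nat list \<Rightarrow> nat \<Rightarrow> nat \<Rightarrow> (nat \<Rightarrow> nat) \<Rightarrow> nat list" where
  "shuffle_left I K u v \<sigma> = map (\<lambda>j. if j < v then K ! j else shuffled I K u v (\<sigma> (u + j - v))) [0..<length K]"

lemma prod_split_lessThan:
  fixes f :: "nat \<Rightarrow> 'a::comm_monoid_mult"
  assumes "u \<le> m" shows "prod f {..<m} = prod f {..<u} * prod f {u..<m}"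
  using assms by (metis atLeast0LessThan prod.atLeastLessThan_concat zero_le)

text \<open>Expand both minors by the Leibniz formula. For fixed row permutations \<open>p\<close> and \<open>q\<close> the
sum over \<open>\<sigma>\<close> is a multiple of the determinant whose \<open>i\<close>-th row is the row of
\<open>M\<close> that the \<open>i\<close>-th permuted number meets. They lie among the \<open>e1 - s2\<close>
rows from \<open>s2\<close> on, which are fewer than the permuted numbers. So two of them coincide and the
determinant is zero.\<close>

lemma garnir_relation:
  fixes M :: "nat \<Rightarrow> nat \<Rightarrow> 'a::idom"
  assumes len: "length K = e1 - s1" "length I = e2 - s2"
    and bounds: "s2 \<le> s1" "e2 \<le> e1" "u \<le> e2 - s2" "v \<le> e1 - s1" "s2 \<le> e2" "s1 \<le> e1"
    and many: "e1 - s2 < u + (e1 - s1 - v)"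
  shows "(\<Sum>\<sigma> | \<sigma> permutes {0..<u + (e1 - s1 - v)}. signof \<sigma> *
      (minor M s1 e1 (shuffle_left I K u v \<sigma>) * minor M s2 e2 (shuffle_right I K u v \<sigma>))) = 0"
proof -
  let ?m1 = "e1 - s1" and ?m2 = "e2 - s2"
  define w where "w = u + (?m1 - v)"
  let ?c = "shuffled I K u v"
  define row where "row p q i = (if i < u then s2 + q i else s1 + p (v + i - u))"
    for p q :: "nat \<Rightarrow> nat" and i
  define C where "C p q = (\<Prod>j<v. M (s1 + p j) (K ! j)) * (\<Prod>j\<in>{u..<?m2}. M (s2 + q j) (I ! j))"
    for p q
  have left: "(\<Prod>j<?m1. M (s1 + p j) (shuffle_left I K u v \<sigma> ! j)) =
     (\<Prod>j<v. M (s1 + p j) (K ! j)) * (\<Prod>i\<in>{u..<w}. M (row p q i) (?c (\<sigma> i)))" for \<sigma> p q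
  proof -
    have "(\<Prod>j<?m1. M (s1 + p j) (shuffle_left I K u v \<sigma> ! j)) =
      (\<Prod>j<v. M (s1 + p j) (shuffle_left I K u v \<sigma> ! j)) *
      (\<Prod>j\<in>{v..<?m1}. M (s1 + p j) (shuffle_left I K u v \<sigma> ! j))"
      by (rule prod_split_lessThan) (use bounds in auto)
    also have "(\<Prod>j\<in>{v..<?m1}. M (s1 + p j) (shuffle_left I K u v \<sigma> ! j)) =
       (\<Prod>i\<in>{u..<w}. M (row p q i) (?c (\<sigma> i)))"
      by (rule prod.reindex_bij_witness[where i = "\<lambda>i. v + i - u" and j = "\<lambda>j. u + j - v"])
        (use bounds in \<open>auto simp: shuffle_left_def row_def w_def len\<close>)
    also have "(\<Prod>j<v. M (s1 + p j) (shuffle_left I K u v \<sigma> ! j)) = (\<Prod>j<v. M (s1 + p j) (K ! j))"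
      by (rule prod.cong) (use bounds in \<open>auto simp: shuffle_left_def len\<close>)
    finally show ?thesis .
  qed
  have right: "(\<Prod>j<?m2. M (s2 + q j) (shuffle_right I K u v \<sigma> ! j)) =
     (\<Prod>j\<in>{u..<?m2}. M (s2 + q j) (I ! j)) * (\<Prod>i<u. M (row p q i) (?c (\<sigma> i)))" for \<sigma> p q
  proof -
    have "(\<Prod>j<?m2. M (s2 + q j) (shuffle_right I K u v \<sigma> ! j)) =
      (\<Prod>j<u. M (s2 + q j) (shuffle_right I K u v \<sigma> ! j)) *
      (\<Prod>j\<in>{u..<?m2}. M (s2 + q j) (shuffle_right I K u v \<sigma> ! j))"
      by (rule prod_split_lessThan) (use bounds in auto)
    also have "(\<Prod>j<u. M (s2 + q j) (shuffle_right I K u v \<sigma> ! j)) =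
       (\<Prod>i<u. M (row p q i) (?c (\<sigma> i)))"
      by (rule prod.cong) (use bounds in \<open>auto simp: shuffle_right_def row_def len\<close>)
    also have "(\<Prod>j\<in>{u..<?m2}. M (s2 + q j) (shuffle_right I K u v \<sigma> ! j)) =
        (\<Prod>j\<in>{u..<?m2}. M (s2 + q j) (I ! j))"
      by (rule prod.cong) (use bounds in \<open>auto simp: shuffle_right_def len\<close>)
    finally show ?thesis by (simp add: mult.commute)
  qed
  have inner: "(\<Sum>\<sigma> | \<sigma> permutes {0..<w}. signof \<sigma> * (\<Prod>i = 0..<w. M (row p q i) (?c (\<sigma> i)))) = 0"
    if p: "p permutes {0..<?m1}" and q: "q permutes {0..<?m2}" for p q
  proof -
    let ?A = "mat w w (\<lambda>(i, j). M (row p q i) (?c j))"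
    have "row p q ` {0..<w} \<subseteq> {s2..<e1}"
    proof safe
      fix i assume i: "i \<in> {0..<w}"
      show "row p q i \<in> {s2..<e1}"
      proof (cases "i < u")
        case True
        then have "i \<in> {0..<?m2}" using bounds by auto
        then have "q i < ?m2" using q by (metis atLeastLessThan_iff permutes_in_image)
        then show ?thesis using True bounds by (auto simp: row_def)
      next
        case False
        then have "v + i - u \<in> {0..<?m1}" using bounds i by (auto simp: w_def)
        then have "p (v + i - u) < ?m1" using p by (metis atLeastLessThan_iff permutes_in_image)
        then show ?thesis using False bounds by (auto simp: row_def)
      qed
    qed
    moreover have "card {s2..<e1} < card {0..<w}" using many by (simp add: w_def)
    ultimately have "\<not> inj_on (row p q) {0..<w}"
      by (metis card_inj_on_le finite_atLeastLessThan leD)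
    then obtain i j where ij: "i < w" "j < w" "i \<noteq> j" "row p q i = row p q j"
      by (auto simp: inj_on_def)
    have "det ?A = 0"
      by (rule det_identical_rows[OF _ ij(3,1,2)]) (use ij in \<open>auto intro!: eq_vecI\<close>)
    moreover have "det ?A = (\<Sum>\<sigma> | \<sigma> permutes {0..<w}. signof \<sigma> * (\<Prod>i = 0..<w. ?A $$ (i, \<sigma> i)))"
      by (rule det_def') simp
    moreover have "\<dots> = (\<Sum>\<sigma> | \<sigma> permutes {0..<w}. signof \<sigma> * (\<Prod>i = 0..<w. M (row p q i) (?c (\<sigma> i))))"
    proof (intro sum.cong refl arg_cong2[where f = "(*)"] prod.cong)
      fix \<sigma> i assume "\<sigma> \<in> {\<sigma>. \<sigma> permutes {0..<w}}" and i: "i \<in> {0..<w}"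
      then have "\<sigma> i < w" by (metis atLeastLessThan_iff mem_Collect_eq permutes_in_image)
      with i show "?A $$ (i, \<sigma> i) = M (row p q i) (?c (\<sigma> i))" by simp
    qed
    ultimately show ?thesis by simp
  qed
  have term_eq: "minor M s1 e1 (shuffle_left I K u v \<sigma>) * minor M s2 e2 (shuffle_right I K u v \<sigma>) =
     (\<Sum>p | p permutes {0..<?m1}. \<Sum>q | q permutes {0..<?m2}. signof p * signof q * C p q *
        (\<Prod>i = 0..<w. M (row p q i) (?c (\<sigma> i))))" for \<sigma>
  proof -
    have spl: "(\<Prod>i = 0..<w. M (row p q i) (?c (\<sigma> i))) =
      (\<Prod>i<u. M (row p q i) (?c (\<sigma> i))) * (\<Prod>i\<in>{u..<w}. M (row p q i) (?c (\<sigma> i)))" for p q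
      using prod_split_lessThan[of u w "\<lambda>i. M (row p q i) (?c (\<sigma> i))"]
      by (simp add: atLeast0LessThan w_def)
    show ?thesis
      unfolding minor_Leibniz sum_product
    proof (intro sum.cong refl)
      fix p q
      show "signof p * (\<Prod>j<?m1. M (s1 + p j) (shuffle_left I K u v \<sigma> ! j)) *
         (signof q * (\<Prod>j<?m2. M (s2 + q j) (shuffle_right I K u v \<sigma> ! j))) =
         signof p * signof q * C p q * (\<Prod>i = 0..<w. M (row p q i) (?c (\<sigma> i)))"
        unfolding left[of p \<sigma> q] right[of q \<sigma> p] spl C_def by (simp add: mult_ac)
    qed
  qed
  have "(\<Sum>\<sigma> | \<sigma> permutes {0..<w}. signof \<sigma> *
      (minor M s1 e1 (shuffle_left I K u v \<sigma>) * minor M s2 e2 (shuffle_right I K u v \<sigma>))) =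
     (\<Sum>\<sigma> | \<sigma> permutes {0..<w}. \<Sum>p | p permutes {0..<?m1}. \<Sum>q | q permutes {0..<?m2}.
       signof p * signof q * C p q * (signof \<sigma> * (\<Prod>i = 0..<w. M (row p q i) (?c (\<sigma> i)))))"
    unfolding term_eq sum_distrib_left by (simp add: mult_ac)
  also have "\<dots> = (\<Sum>p | p permutes {0..<?m1}. \<Sum>\<sigma> | \<sigma> permutes {0..<w}. \<Sum>q | q permutes {0..<?m2}.
       signof p * signof q * C p q * (signof \<sigma> * (\<Prod>i = 0..<w. M (row p q i) (?c (\<sigma> i)))))"
    by (rule sum.swap)
  also have "\<dots> = (\<Sum>p | p permutes {0..<?m1}. \<Sum>q | q permutes {0..<?m2}. \<Sum>\<sigma> | \<sigma> permutes {0..<w}.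
       signof p * signof q * C p q * (signof \<sigma> * (\<Prod>i = 0..<w. M (row p q i) (?c (\<sigma> i)))))"
    by (intro sum.cong refl sum.swap)
  also have "\<dots> = 0"
    unfolding sum_distrib_left[symmetric] using inner by simp
  finally show ?thesis unfolding w_def .
qed

text \<open>A permutation that does not mix the two blocks permutes the columns of each minor separately, and its own sign
cancels the two signs. These terms of the Garnir relation therefore all equal the original product and cannot
cancel each other.\<close>

lemma shuffle_block_permutation:
  fixes M :: "nat \<Rightarrow> nat \<Rightarrow> 'a::comm_ring_1"
  assumes len: "length K = e1 - s1" "length I = e2 - s2"
    and bounds: "u \<le> e2 - s2" "v \<le> e1 - s1"
    and \<sigma>: "\<sigma> permutes {0..<u + (e1 - s1 - v)}" and pres: "\<sigma> ` {0..<u} = {0..<u}"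
  shows "signof \<sigma> * (minor M s1 e1 (shuffle_left I K u v \<sigma>) * minor M s2 e2 (shuffle_right I K u v \<sigma>)) =
     minor M s1 e1 K * minor M s2 e2 I"
proof -
  define w where "w = u + (e1 - s1 - v)"
  define \<alpha> where "\<alpha> = restrict_id \<sigma> {0..<u}"
  define \<beta> where "\<beta> = restrict_id \<sigma> {u..<w}"
  have inj: "inj \<sigma>" using \<sigma> by (rule permutes_inj)
  have "bij_betw \<sigma> {0..<u} {0..<u}" using pres inj by (auto simp: bij_betw_def intro: inj_on_subset)
  then have \<alpha>: "\<alpha> permutes {0..<u}" unfolding \<alpha>_def by (rule permutes_restrict_id)
  have "\<sigma> ` {0..<w} = {0..<w}" using \<sigma> by (simp add: permutes_image w_def)
  moreover have "{u..<w} = {0..<w} - {0..<u}" by (auto simp: w_def)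
  ultimately have "\<sigma> ` {u..<w} = {u..<w}" using pres image_set_diff[OF inj] by metis
  then have "bij_betw \<sigma> {u..<w} {u..<w}" using inj by (auto simp: bij_betw_def intro: inj_on_subset)
  then have \<beta>: "\<beta> permutes {u..<w}" unfolding \<beta>_def by (rule permutes_restrict_id)
  have \<sigma>eq: "\<sigma> = \<alpha> \<circ> \<beta>"
  proof
    fix i show "\<sigma> i = (\<alpha> \<circ> \<beta>) i"
    proof (cases "i \<in> {u..<w}")
      case True
      then have "\<sigma> i \<in> {u..<w}" using \<open>\<sigma> ` {u..<w} = {u..<w}\<close> by blast
      with True show ?thesis by (auto simp: \<alpha>_def \<beta>_def)
    next
      case False
      then show ?thesis using \<sigma> by (auto simp: \<alpha>_def \<beta>_def restrict_id_def permutes_not_in w_def)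
    qed
  qed
  let ?f = "\<lambda>i. v + i - u"
  define \<gamma> where "\<gamma> = map_permutation {u..<w} ?f \<beta>"
  have injf: "inj_on ?f {u..<w}" by (auto simp: inj_on_def)
  have imf: "bij_betw ?f {u..<w} {v..<e1 - s1}"
    by (rule bij_betwI[where g = "\<lambda>j. u + j - v"]) (use bounds in \<open>auto simp: w_def\<close>)
  have \<gamma>: "\<gamma> permutes {v..<e1 - s1}"
    unfolding \<gamma>_def by (rule map_permutation_permutes[OF imf \<beta>])
  have sgn: "sign \<sigma> = sign \<alpha> * sign \<gamma>"
    unfolding \<sigma>eq \<gamma>_def using \<alpha> \<beta> injf
    by (subst sign_compose) (auto intro: permutation_permutes[THEN iffD2] simp: sign_map_permutation)
  have L: "minor M s1 e1 (shuffle_left I K u v \<sigma>) = signof \<gamma> * minor M s1 e1 K"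
  proof (rule minor_permute_columns)
    show "\<gamma> permutes {0..<e1 - s1}" using \<gamma> by (rule permutes_subset) auto
    fix j assume j: "j < e1 - s1"
    show "shuffle_left I K u v \<sigma> ! j = K ! \<gamma> j"
    proof (cases "j < v")
      case True
      then have "\<gamma> j = j" using \<gamma> by (auto simp: permutes_not_in)
      then show ?thesis using True j by (simp add: shuffle_left_def len)
    next
      case False
      define i where "i = u + j - v"
      have i: "i \<in> {u..<w}" and ji: "j = ?f i" using False j by (auto simp: i_def w_def)
      have "\<beta> i = \<sigma> i" using i by (simp add: \<beta>_def)
      moreover have "\<sigma> i \<in> {u..<w}" using i \<open>\<sigma> ` {u..<w} = {u..<w}\<close> by blast
      moreover have "\<gamma> j = ?f (\<beta> i)"
        unfolding \<gamma>_def ji using injf i by (rule map_permutation_apply)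
      ultimately show ?thesis using False j
        by (auto simp: shuffle_left_def shuffled_def len i_def)
    qed
  qed
  have R: "minor M s2 e2 (shuffle_right I K u v \<sigma>) = signof \<alpha> * minor M s2 e2 I"
  proof (rule minor_permute_columns)
    show "\<alpha> permutes {0..<e2 - s2}" using \<alpha> by (rule permutes_subset) (use bounds in auto)
    fix j assume j: "j < e2 - s2"
    show "shuffle_right I K u v \<sigma> ! j = I ! \<alpha> j"
    proof (cases "j < u")
      case True
      then have "\<sigma> j < u" using pres by auto
      then show ?thesis using True j by (auto simp: shuffle_right_def shuffled_def len \<alpha>_def)
    next
      case False
      then show ?thesis using j by (simp add: shuffle_right_def len \<alpha>_def restrict_id_def)
    qed
  qed
  have "(of_int (sign \<alpha> * sign \<alpha>) :: 'a) = 1" "(of_int (sign \<gamma> * sign \<gamma>) :: 'a) = 1" by simp_all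
  then have "(signof \<alpha> * signof \<alpha> :: 'a) = 1" "(signof \<gamma> * signof \<gamma> :: 'a) = 1"
    by (simp_all only: of_int_mult)
  then show ?thesis unfolding L R sgn of_int_mult
    by (metis (no_types, opaque_lifting) mult.assoc mult.left_commute mult_1)
qed

section \<open>Straightening a product of two minors\<close>

lemma finite_plucker_indices [simp]: "finite (plucker_indices k n)"
  by (rule finite_subset[OF _ finite_lists_length_eq[of "{1..n}" k]])
    (auto simp: plucker_indices_def)

lemma sorted_distinct_plucker:
  assumes "distinct l" "length l = k" "set l \<subseteq> {1..n}"
  shows "sort l \<in> plucker_indices k n"
  using assms by (auto simp: plucker_indices_def strict_sorted_iff)

text \<open>The row condition for a column \<open>K\<close> that starts in row \<open>s1\<close> and stands to the left of a
column \<open>I\<close> in the rows \<open>s2, ..., e2 - 1\<close>. It is meant for \<open>s2 \<le>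
s1\<close>.\<close>

definition row_weak :: "nat \<Rightarrow> nat \<Rightarrow> nat \<Rightarrow> nat list \<Rightarrow> nat list \<Rightarrow> bool" where
  "row_weak s1 s2 e2 K I \<longleftrightarrow> (\<forall>b. s1 + b < e2 \<longrightarrow> K ! b \<le> I ! (s1 - s2 + b))"

definition standard_pairs :: "nat \<Rightarrow> nat \<Rightarrow> nat \<Rightarrow> nat \<Rightarrow> nat \<Rightarrow> (nat list \<times> nat list) set" where
  "standard_pairs n s1 e1 s2 e2 =
     {(K, I) \<in> plucker_indices (e1 - s1) n \<times> plucker_indices (e2 - s2) n. row_weak s1 s2 e2 K I}"

lemma finite_standard_pairs [simp]: "finite (standard_pairs n s1 e1 s2 e2)"
  by (rule finite_subset[of _ "plucker_indices (e1 - s1) n \<times> plucker_indices (e2 - s2) n"])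
    (auto simp: standard_pairs_def)

lemma plucker_nth_less:
  assumes "I \<in> plucker_indices k n" "i < j" "j < k"
  shows "I ! i < I ! j"
  using assms by (simp add: plucker_indices_def sorted_wrt_nth_less)

lemma plucker_nth_le:
  assumes "I \<in> plucker_indices k n" "i \<le> j" "j < k"
  shows "I ! i \<le> I ! j"
  using assms plucker_nth_less[OF assms(1), of i j] by (cases "i = j") auto

text \<open>If the rows decrease at entry \<open>u - 1\<close> of \<open>I\<close> and entry \<open>v\<close> of
\<open>K\<close>, then every permuted number from \<open>I\<close> is smaller than every permuted number from
\<open>K\<close>. Mixing the blocks brings some of the former into the left column.\<close>

lemma shuffle_left_sum_less:
  assumes K: "K \<in> plucker_indices m1 n" and I: "I \<in> plucker_indices m2 n"
    and u: "0 < u" "u \<le> m2" and v: "v < m1" and viol: "I ! (u - 1) < K ! v"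
    and \<sigma>: "\<sigma> permutes {0..<u + (m1 - v)}" and npres: "\<sigma> ` {0..<u} \<noteq> {0..<u}"
  shows "sum_list (shuffle_left I K u v \<sigma>) < sum_list K"
proof -
  define w where "w = u + (m1 - v)"
  let ?c = "shuffled I K u v"
  let ?B = "{u..<w}"
  have lenK: "length K = m1" using K by (simp add: plucker_indices_def)
  have s1: "sum_list (shuffle_left I K u v \<sigma>) = (\<Sum>j<v. K ! j) + (\<Sum>i\<in>?B. ?c (\<sigma> i))"
  proof -
    have "sum_list (shuffle_left I K u v \<sigma>) = (\<Sum>j\<in>{0..<v} \<union> {v..<m1}. if j < v then K ! j else ?c (\<sigma> (u + j - v)))"
      using v unfolding shuffle_left_def by (subst ivl_disj_un(17)) (auto simp: sum_list_sum_nth lenK intro!: sum.cong)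
    also have "\<dots> = (\<Sum>j\<in>{0..<v}. K ! j) + (\<Sum>j\<in>{v..<m1}. ?c (\<sigma> (u + j - v)))"
      by (subst sum.union_disjoint) auto
    also have "(\<Sum>j\<in>{v..<m1}. ?c (\<sigma> (u + j - v))) = (\<Sum>i\<in>?B. ?c (\<sigma> i))"
      by (rule sum.reindex_bij_witness[where i = "\<lambda>i. v + i - u" and j = "\<lambda>j. u + j - v"])
        (use v in \<open>auto simp: w_def\<close>)
    finally show ?thesis by (simp add: atLeast0LessThan)
  qed
  have s2: "sum_list K = (\<Sum>j<v. K ! j) + (\<Sum>i\<in>?B. ?c i)"
  proof -
    have "sum_list K = (\<Sum>j\<in>{0..<v} \<union> {v..<m1}. K ! j)"
      using v by (subst ivl_disj_un(17)) (auto simp: sum_list_sum_nth lenK)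
    also have "\<dots> = (\<Sum>j\<in>{0..<v}. K ! j) + (\<Sum>j\<in>{v..<m1}. K ! j)"
      by (subst sum.union_disjoint) auto
    also have "(\<Sum>j\<in>{v..<m1}. K ! j) = (\<Sum>i\<in>?B. ?c i)"
      by (rule sum.reindex_bij_witness[where i = "\<lambda>i. v + i - u" and j = "\<lambda>j. u + j - v"])
        (use v in \<open>auto simp: w_def shuffled_def\<close>)
    finally show ?thesis by (simp add: atLeast0LessThan)
  qed
  have low: "?c i \<le> I ! (u - 1)" if "i < u" for i
    using that u plucker_nth_le[OF I, of i "u - 1"] by (auto simp: shuffled_def)
  have high: "K ! v \<le> ?c i" if "i \<in> ?B" for i
    using that plucker_nth_le[OF K, of v "v + i - u"] v by (auto simp: shuffled_def w_def)
  have inj: "inj \<sigma>" using \<sigma> by (rule permutes_inj)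
  let ?B' = "\<sigma> ` ?B"
  have tot: "\<sigma> ` {0..<w} = {0..<w}" using \<sigma> by (simp add: permutes_image w_def)
  have B'sub: "?B' \<subseteq> {0..<w}" using tot by auto
  have cardB': "card ?B' = card ?B" using inj by (simp add: card_image inj_on_subset)
  have ne: "?B' \<noteq> ?B"
  proof
    assume eq: "?B' = ?B"
    have "{0..<u} = {0..<w} - ?B" by (auto simp: w_def)
    moreover have "\<sigma> ` ({0..<w} - ?B) = {0..<w} - ?B"
      unfolding image_set_diff[OF inj] tot eq by (rule refl)
    ultimately have "\<sigma> ` {0..<u} = {0..<u}" by simp
    with npres show False by simp
  qed
  have cardeq: "card (?B' - ?B) = card (?B - ?B')"
    using cardB' by (simp add: card_Diff_subset_Int Int_commute)
  have "?B' - ?B \<noteq> {}"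
  proof
    assume "?B' - ?B = {}"
    then have "?B' \<subseteq> ?B" by blast
    then have "?B' = ?B" using cardB' by (intro card_subset_eq) auto
    with ne show False by blast
  qed
  then have pos: "0 < card (?B' - ?B)" by (simp add: card_gt_0_iff)
  have "(\<Sum>i\<in>?B. ?c (\<sigma> i)) = (\<Sum>i\<in>?B'. ?c i)"
    using inj by (simp add: sum.reindex inj_on_subset)
  also have "\<dots> = (\<Sum>i\<in>?B' \<inter> ?B. ?c i) + (\<Sum>i\<in>?B' - ?B. ?c i)"
    by (rule sum.Int_Diff) simp
  also have "(\<Sum>i\<in>?B' - ?B. ?c i) \<le> (\<Sum>i\<in>?B' - ?B. I ! (u - 1))"
    by (intro sum_mono low) (use B'sub in auto)
  also have "\<dots> = card (?B - ?B') * I ! (u - 1)" using cardeq by simp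
  also have "\<dots> < card (?B - ?B') * K ! v" using pos cardeq viol by simp
  also have "\<dots> \<le> (\<Sum>i\<in>?B - ?B'. ?c i)"
    using sum_bounded_below[of "?B - ?B'" "K ! v" ?c] high unfolding of_nat_id by blast
  finally have "(\<Sum>i\<in>?B. ?c (\<sigma> i)) < (\<Sum>i\<in>?B' \<inter> ?B. ?c i) + (\<Sum>i\<in>?B - ?B'. ?c i)" by simp
  also have "\<dots> = (\<Sum>i\<in>?B. ?c i)"
    by (subst Int_commute, rule sum.Int_Diff[symmetric]) simp
  finally show ?thesis unfolding s1 s2 by (rule add_strict_left_mono)
qed

text \<open>The coefficients may not depend on the matrix.\<close>

definition spanned_by_standard_pairs ::
  "nat \<Rightarrow> nat \<Rightarrow> nat \<Rightarrow> nat \<Rightarrow> nat \<Rightarrow> ((nat \<Rightarrow> nat \<Rightarrow> 'a::field_char_0) \<Rightarrow> 'a) \<Rightarrow> bool" where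
  "spanned_by_standard_pairs n s1 e1 s2 e2 f \<longleftrightarrow>
     (\<exists>c. \<forall>M. f M = (\<Sum>(K, I)\<in>standard_pairs n s1 e1 s2 e2. c K I * (minor M s1 e1 K * minor M s2 e2 I)))"

lemma spanned_zero: "spanned_by_standard_pairs n s1 e1 s2 e2 (\<lambda>M. 0)"
  unfolding spanned_by_standard_pairs_def by (rule exI[of _ "\<lambda>_ _. 0"]) simp

lemma spanned_add:
  assumes "spanned_by_standard_pairs n s1 e1 s2 e2 f" "spanned_by_standard_pairs n s1 e1 s2 e2 g"
  shows "spanned_by_standard_pairs n s1 e1 s2 e2 (\<lambda>M. f M + g M)"
proof -
  obtain c d where
    "\<And>M. f M = (\<Sum>(K, I)\<in>standard_pairs n s1 e1 s2 e2. c K I * (minor M s1 e1 K * minor M s2 e2 I))"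
    "\<And>M. g M = (\<Sum>(K, I)\<in>standard_pairs n s1 e1 s2 e2. d K I * (minor M s1 e1 K * minor M s2 e2 I))"
    using assms unfolding spanned_by_standard_pairs_def by auto
  then show ?thesis
    unfolding spanned_by_standard_pairs_def
    by (intro exI[of _ "\<lambda>K I. c K I + d K I"]) (simp add: distrib_right case_prod_unfold sum.distrib)
qed

lemma spanned_scale:
  assumes "spanned_by_standard_pairs n s1 e1 s2 e2 f"
  shows "spanned_by_standard_pairs n s1 e1 s2 e2 (\<lambda>M. a * f M)"
proof -
  obtain c where
    "\<And>M. f M = (\<Sum>(K, I)\<in>standard_pairs n s1 e1 s2 e2. c K I * (minor M s1 e1 K * minor M s2 e2 I))"
    using assms unfolding spanned_by_standard_pairs_def by auto
  then show ?thesis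
    unfolding spanned_by_standard_pairs_def
    by (intro exI[of _ "\<lambda>K I. a * c K I"]) (simp add: sum_distrib_left case_prod_unfold mult.assoc)
qed

lemma spanned_sum:
  assumes "finite S" "\<And>x. x \<in> S \<Longrightarrow> spanned_by_standard_pairs n s1 e1 s2 e2 (f x)"
  shows "spanned_by_standard_pairs n s1 e1 s2 e2 (\<lambda>M. \<Sum>x\<in>S. f x M)"
  using assms
proof (induction S)
  case empty
  then show ?case by (simp add: spanned_zero)
next
  case (insert x S)
  then have "spanned_by_standard_pairs n s1 e1 s2 e2 (\<lambda>M. f x M + (\<Sum>x\<in>S. f x M))"
    by (intro spanned_add) simp_all
  with insert.hyps show ?case by simp
qed

text \<open>Induction on the sum of the left column. The Garnir relation at a row that decreases replaces the product by
products with a smaller left column. Sorting their columns changes at most the sign, and a product with a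
repeated column is zero.\<close>

theorem straightening:
  assumes bounds: "s2 \<le> s1" "e2 \<le> e1" "s2 \<le> e2" "s1 \<le> e1"
    and "K \<in> plucker_indices (e1 - s1) n" "I \<in> plucker_indices (e2 - s2) n"
  shows "spanned_by_standard_pairs n s1 e1 s2 e2
    (\<lambda>M. minor M s1 e1 K * minor M s2 e2 I :: 'a::field_char_0)"
  using assms(5,6)
proof (induction "sum_list K" arbitrary: K I rule: less_induct)
  case less
  note K = less.prems(1) and I = less.prems(2)
  have len: "length K = e1 - s1" "length I = e2 - s2" using K I unfolding plucker_indices_def by simp_all
  show ?case
  proof (cases "row_weak s1 s2 e2 K I")
    case True
    then have mem: "(K, I) \<in> standard_pairs n s1 e1 s2 e2" using K I by (simp add: standard_pairs_def)
    show ?thesis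
      unfolding spanned_by_standard_pairs_def
    proof (intro exI allI)
      fix M :: "nat \<Rightarrow> nat \<Rightarrow> 'a"
      have "(\<Sum>(K', I')\<in>standard_pairs n s1 e1 s2 e2.
          (if (K', I') = (K, I) then 1 else 0) * (minor M s1 e1 K' * minor M s2 e2 I')) =
        (\<Sum>p\<in>standard_pairs n s1 e1 s2 e2.
          if p = (K, I) then minor M s1 e1 K * minor M s2 e2 I else 0)"
        by (rule sum.cong) (auto split: if_splits)
      also have "\<dots> = minor M s1 e1 K * minor M s2 e2 I"
        using mem by (simp add: sum.delta)
      finally show "minor M s1 e1 K * minor M s2 e2 I = (\<Sum>(K', I')\<in>standard_pairs n s1 e1 s2 e2.
          (if (K', I') = (K, I) then 1 else 0) * (minor M s1 e1 K' * minor M s2 e2 I'))" ..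
    qed
  next
    case False
    then obtain b where b: "s1 + b < e2" "I ! (s1 - s2 + b) < K ! b"
      by (auto simp: row_weak_def not_le)
    \<comment> \<open>The violated row is \<open>s1 + b\<close>, where \<open>I\<close> has \<open>u\<close> entries down to and including that row.\<close>
    define u where "u = s1 - s2 + b + 1"
    define w where "w = u + (e1 - s1 - b)"
    define S where "S = {\<sigma>. \<sigma> permutes {0..<w}}"
    \<comment> \<open>\<open>S1\<close> are the terms of the Garnir relation that reproduce the original product.\<close>
    define S1 where "S1 = {\<sigma> \<in> S. \<sigma> ` {0..<u} = {0..<u}}"
    define F where "F \<sigma> M = minor M s1 e1 (shuffle_left I K u b \<sigma>) * minor M s2 e2 (shuffle_right I K u b \<sigma>)"
      for \<sigma> and M :: "nat \<Rightarrow> nat \<Rightarrow> 'a"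
    have fin: "finite S" unfolding S_def by (simp add: finite_permutations)
    have sub: "S1 \<subseteq> S" by (auto simp: S1_def)
    have "id \<in> S1" by (simp add: S1_def S_def permutes_id)
    then have card: "card S1 \<noteq> 0" using fin sub by (metis card_0_eq empty_iff finite_subset)
    have zero: "(\<Sum>\<sigma>\<in>S. signof \<sigma> * F \<sigma> M) = 0" for M
      unfolding S_def F_def w_def
      by (rule garnir_relation) (use bounds b len in \<open>auto simp: u_def\<close>)
    have pres: "signof \<sigma> * F \<sigma> M = minor M s1 e1 K * minor M s2 e2 I" if "\<sigma> \<in> S1" for \<sigma> M
      using that unfolding F_def S1_def S_def w_def
      by (intro shuffle_block_permutation) (use bounds b len in \<open>auto simp: u_def\<close>)
    have spF: "spanned_by_standard_pairs n s1 e1 s2 e2 (F \<sigma>)" if \<sigma>: "\<sigma> \<in> S - S1" for \<sigma>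
    proof -
      define K' where "K' = shuffle_left I K u b \<sigma>"
      define I' where "I' = shuffle_right I K u b \<sigma>"
      have len': "length K' = e1 - s1" "length I' = e2 - s2"
        by (simp_all add: K'_def I'_def shuffle_left_def shuffle_right_def len)
      show ?thesis
      proof (cases "distinct K' \<and> distinct I'")
        case False
        have "F \<sigma> = (\<lambda>M. 0)"
        proof
          fix M :: "nat \<Rightarrow> nat \<Rightarrow> 'a"
          have "minor M s1 e1 K' = 0 \<or> minor M s2 e2 I' = 0"
            using False minor_not_distinct[OF len'(1), of M] minor_not_distinct[OF len'(2), of M] by blast
          then show "F \<sigma> M = 0"
            unfolding F_def K'_def[symmetric] I'_def[symmetric] by auto
        qed
        then show ?thesis by (simp add: spanned_zero)
      next
        case True
        have \<sigma>perm: "\<sigma> permutes {0..<w}" using \<sigma> by (auto simp: S_def)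
        have range: "shuffled I K u b (\<sigma> i) \<in> {1..n}" if "i < w" for i
        proof -
          have "\<sigma> i < w" using that \<sigma>perm by (metis atLeast0LessThan lessThan_iff permutes_in_image)
          then have "shuffled I K u b (\<sigma> i) \<in> set I \<union> set K"
            using b bounds len by (auto simp: shuffled_def u_def w_def intro!: nth_mem)
          then show ?thesis using K I by (auto simp: plucker_indices_def)
        qed
        have setK: "set K \<subseteq> {1..n}" "set I \<subseteq> {1..n}" using K I by (auto simp: plucker_indices_def)
        have Kin: "K ! j \<in> {1..n}" if "j < e1 - s1" for j
          using that setK(1) len(1) nth_mem[of j K] by (simp add: subset_iff)
        have Iin: "I ! j \<in> {1..n}" if "j < e2 - s2" for j
          using that setK(2) len(2) nth_mem[of j I] by (simp add: subset_iff)
        have "set K' \<subseteq> {1..n}"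
        proof
          fix x assume "x \<in> set K'"
          then obtain j where "j < e1 - s1" "x = (if j < b then K ! j else shuffled I K u b (\<sigma> (u + j - b)))"
            by (auto simp: K'_def shuffle_left_def len)
          moreover have "u + j - b < w" if "j < e1 - s1" "\<not> j < b" using that by (auto simp: w_def u_def)
          ultimately show "x \<in> {1..n}"
            using range[of "u + j - b"] Kin[of j] by (auto split: if_splits)
        qed
        moreover have "set I' \<subseteq> {1..n}"
        proof
          fix x assume "x \<in> set I'"
          then obtain j where "j < e2 - s2" "x = (if j < u then shuffled I K u b (\<sigma> j) else I ! j)"
            by (auto simp: I'_def shuffle_right_def len)
          moreover have "j < w" if "j < u" using that by (auto simp: w_def)
          ultimately show "x \<in> {1..n}"
            using range[of j] Iin[of j] by (auto split: if_splits)
        qed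
        ultimately have mem: "sort K' \<in> plucker_indices (e1 - s1) n" "sort I' \<in> plucker_indices (e2 - s2) n"
          using True len' by (blast intro: sorted_distinct_plucker)+
        have "sum_list (sort K') = sum_list K'"
          by (metis mset_sort sum_mset_sum_list)
        also have "\<dots> < sum_list K"
          unfolding K'_def
          by (rule shuffle_left_sum_less[OF K I]) (use b bounds \<sigma> in \<open>auto simp: u_def S_def S1_def w_def\<close>)
        finally have sp: "spanned_by_standard_pairs n s1 e1 s2 e2
            (\<lambda>M. minor M s1 e1 (sort K') * minor M s2 e2 (sort I') :: 'a)"
          by (rule less.hyps) (use mem in auto)
        obtain c :: 'a where c: "\<And>M. minor M s1 e1 K' = c * minor M s1 e1 (sort K')"
          using minor_sort[OF len'(1)] by blast
        obtain d :: 'a where d: "\<And>M. minor M s2 e2 I' = d * minor M s2 e2 (sort I')"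
          using minor_sort[OF len'(2)] by blast
        have "F \<sigma> = (\<lambda>M. (c * d) * (minor M s1 e1 (sort K') * minor M s2 e2 (sort I')))"
          unfolding F_def K'_def[symmetric] I'_def[symmetric] c d by (simp add: mult_ac)
        then show ?thesis using spanned_scale[OF sp] by simp
      qed
    qed
    have "minor M s1 e1 K * minor M s2 e2 I =
        (- 1 / of_nat (card S1)) * (\<Sum>\<sigma>\<in>S - S1. signof \<sigma> * F \<sigma> M)" for M
    proof -
      have "0 = (\<Sum>\<sigma>\<in>S - S1. signof \<sigma> * F \<sigma> M) + (\<Sum>\<sigma>\<in>S1. signof \<sigma> * F \<sigma> M)"
        unfolding zero[of M, symmetric] using sub fin by (rule sum.subset_diff)
      also have "(\<Sum>\<sigma>\<in>S1. signof \<sigma> * F \<sigma> M) = of_nat (card S1) * (minor M s1 e1 K * minor M s2 e2 I)"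
        using pres by simp
      finally show ?thesis using card by (simp add: field_simps eq_neg_iff_add_eq_0)
    qed
    moreover have "spanned_by_standard_pairs n s1 e1 s2 e2
      (\<lambda>M. (- 1 / of_nat (card S1)) * (\<Sum>\<sigma>\<in>S - S1. signof \<sigma> * F \<sigma> M))"
      by (intro spanned_scale spanned_sum spF) (use fin in auto)
    ultimately show ?thesis by presburger
  qed
qed

section \<open>Monomials and the polynomial ring\<close>

abbreviation "keys \<equiv> Poly_Mapping.keys"
abbreviation "lookup \<equiv> Poly_Mapping.lookup"
abbreviation "single \<equiv> Poly_Mapping.single"

lemma poly_mapping_sum_singles:
  "(\<Sum>m\<in>keys p. single m (lookup p m)) = (p :: 'a \<Rightarrow>\<^sub>0 'b::comm_monoid_add)"
proof (rule poly_mapping_eqI)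
  fix m
  have "lookup (\<Sum>m\<in>keys p. single m (lookup p m)) m =
     (\<Sum>m'\<in>keys p. if m' = m then lookup p m else 0)"
    unfolding lookup_sum by (rule sum.cong) (auto simp: lookup_single when_def)
  also have "\<dots> = lookup p m"
    by (simp add: in_keys_iff)
  finally show "lookup (\<Sum>m\<in>keys p. single m (lookup p m)) m
    = lookup p m" .
qed

definition monomial_value :: "('b \<Rightarrow> 'a::comm_ring_1) \<Rightarrow> ('b \<Rightarrow>\<^sub>0 nat) \<Rightarrow> 'a" where
  "monomial_value f m = (\<Prod>x\<in>keys m. f x ^ lookup m x)"

lemma monomial_value_superset:
  assumes "finite A" "keys m \<subseteq> A"
  shows "monomial_value f m = (\<Prod>x\<in>A. f x ^ lookup m x)"
  unfolding monomial_value_def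
  by (rule prod.mono_neutral_left) (use assms in \<open>auto simp: in_keys_iff\<close>)

lemma monomial_value_zero [simp]: "monomial_value f 0 = 1"
  by (simp add: monomial_value_def)

lemma monomial_value_add: "monomial_value f (a + b) = monomial_value f a * monomial_value f b"
proof -
  let ?A = "keys a \<union> keys b"
  have "monomial_value f (a + b) = (\<Prod>x\<in>?A. f x ^ lookup (a + b) x)"
    by (rule monomial_value_superset) (use keys_add[of a b] in auto)
  also have "\<dots> = (\<Prod>x\<in>?A. f x ^ lookup a x) * (\<Prod>x\<in>?A. f x ^ lookup b x)"
    by (simp add: lookup_add power_add prod.distrib)
  finally show ?thesis
    using monomial_value_superset[of ?A a f] monomial_value_superset[of ?A b f] by simp
qed

lemma monomial_value_single [simp]: "monomial_value f (single x i) = f x ^ i"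
  by (cases "i = 0") (simp_all add: monomial_value_def)

lemma monomial_value_cong:
  assumes "\<And>x. x \<in> keys m \<Longrightarrow> f x = g x"
  shows "monomial_value f m = monomial_value g m"
  unfolding monomial_value_def using assms by (intro prod.cong) auto

lemma eval_bracket_poly_alt:
  "eval_bracket_poly f p = (\<Sum>m\<in>keys p. lookup p m * monomial_value f m)"
  by (simp add: eval_bracket_poly_def monomial_value_def)

lemma eval_bracket_poly_superset:
  assumes "finite A" "keys p \<subseteq> A"
  shows "eval_bracket_poly f p = (\<Sum>m\<in>A. lookup p m * monomial_value f m)"
  unfolding eval_bracket_poly_alt
  by (rule sum.mono_neutral_left) (use assms in \<open>auto simp: in_keys_iff\<close>)

lemma eval_zero [simp]: "eval_bracket_poly f 0 = 0"
  by (simp add: eval_bracket_poly_def)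

lemma eval_single [simp]: "eval_bracket_poly f (single m c) = c * monomial_value f m"
  by (cases "c = 0") (simp_all add: eval_bracket_poly_alt)

lemma eval_one [simp]: "eval_bracket_poly f 1 = 1"
  unfolding single_one[symmetric] eval_single by simp

lemma eval_add: "eval_bracket_poly f (p + q) = eval_bracket_poly f p + eval_bracket_poly f q"
proof -
  let ?A = "keys p \<union> keys q"
  have "eval_bracket_poly f (p + q) = (\<Sum>m\<in>?A. lookup (p + q) m * monomial_value f m)"
    by (rule eval_bracket_poly_superset) (use keys_add[of p q] in auto)
  also have "\<dots> = (\<Sum>m\<in>?A. lookup p m * monomial_value f m) +
      (\<Sum>m\<in>?A. lookup q m * monomial_value f m)"
    by (simp add: lookup_add distrib_right sum.distrib)
  finally show ?thesis
    using eval_bracket_poly_superset[of ?A p f] eval_bracket_poly_superset[of ?A q f] by simp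
qed

lemma eval_uminus: "eval_bracket_poly f (- p) = - eval_bracket_poly f p"
  by (metis add.right_inverse eval_add eval_zero minus_unique)

lemma eval_diff: "eval_bracket_poly f (p - q) = eval_bracket_poly f p - eval_bracket_poly f q"
  using eval_add[of f p "- q"] by (simp add: eval_uminus)

lemma eval_sum: "eval_bracket_poly f (sum g A) = (\<Sum>x\<in>A. eval_bracket_poly f (g x))"
  by (induction A rule: infinite_finite_induct) (simp_all add: eval_add)

lemma eval_mult: "eval_bracket_poly f (p * q) = eval_bracket_poly f p * eval_bracket_poly f q"
proof -
  let ?s = "\<lambda>r m. single m (lookup r m)"
  have "eval_bracket_poly f (p * q) =
      eval_bracket_poly f ((\<Sum>a\<in>keys p. ?s p a) * (\<Sum>b\<in>keys q. ?s q b))"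
    by (simp only: poly_mapping_sum_singles)
  also have "\<dots> = (\<Sum>a\<in>keys p. \<Sum>b\<in>keys q.
     (lookup p a * monomial_value f a) * (lookup q b * monomial_value f b))"
    by (simp add: sum_product eval_sum mult_single monomial_value_add mult_ac)
  also have "\<dots> = eval_bracket_poly f p * eval_bracket_poly f q"
    by (simp add: eval_bracket_poly_alt sum_product)
  finally show ?thesis .
qed

lemma bracket_ring_carrier_iff:
  "p \<in> carrier (bracket_ring k n) \<longleftrightarrow> (\<forall>m\<in>keys p. keys m \<subseteq> bracket_vars k n)"
  by (simp add: bracket_ring_def)

lemma bracket_ring_simps [simp]:
  "mult (bracket_ring k n) = (*)" "one (bracket_ring k n) = 1"
  "zero (bracket_ring k n) = 0" "add (bracket_ring k n) = (+)"
  by (simp_all add: bracket_ring_def)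

lemma bracket_ring_closed:
  shows "0 \<in> carrier (bracket_ring k n)" "1 \<in> carrier (bracket_ring k n)"
    and "p \<in> carrier (bracket_ring k n) \<Longrightarrow> q \<in> carrier (bracket_ring k n) \<Longrightarrow> p + q \<in> carrier (bracket_ring k n)"
    and "p \<in> carrier (bracket_ring k n) \<Longrightarrow> q \<in> carrier (bracket_ring k n) \<Longrightarrow> p * q \<in> carrier (bracket_ring k n)"
    and "p \<in> carrier (bracket_ring k n) \<Longrightarrow> - p \<in> carrier (bracket_ring k n)"
    and "p \<in> carrier (bracket_ring k n) \<Longrightarrow> q \<in> carrier (bracket_ring k n) \<Longrightarrow> p - q \<in> carrier (bracket_ring k n)"
proof -
  show "0 \<in> carrier (bracket_ring k n)" "1 \<in> carrier (bracket_ring k n)"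
    by (simp_all add: bracket_ring_carrier_iff)
  show add: "p + q \<in> carrier (bracket_ring k n)"
    if "p \<in> carrier (bracket_ring k n)" "q \<in> carrier (bracket_ring k n)" for p q
    using that keys_add[of p q] unfolding bracket_ring_carrier_iff by blast
  show "p * q \<in> carrier (bracket_ring k n)"
    if p: "p \<in> carrier (bracket_ring k n)" and q: "q \<in> carrier (bracket_ring k n)"
    unfolding bracket_ring_carrier_iff
  proof
    fix m assume "m \<in> keys (p * q)"
    then obtain a b where "m = a + b" "a \<in> keys p" "b \<in> keys q"
      using keys_mult[of p q] by auto
    then show "keys m \<subseteq> bracket_vars k n"
      using p q keys_add[of a b] unfolding bracket_ring_carrier_iff by blast
  qed
  show um: "- p \<in> carrier (bracket_ring k n)" if "p \<in> carrier (bracket_ring k n)" for p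
  proof -
    have "keys (- p) = keys p" by (auto simp: in_keys_iff)
    then show ?thesis using that by (simp add: bracket_ring_carrier_iff)
  qed
  show "p - q \<in> carrier (bracket_ring k n)"
    if "p \<in> carrier (bracket_ring k n)" "q \<in> carrier (bracket_ring k n)"
    using add[OF that(1) um[OF that(2)]] by simp
qed

lemma bracket_ring_cring: "cring (bracket_ring k n)"
proof (rule cringI)
  show "abelian_group (bracket_ring k n)"
  proof (rule abelian_groupI)
    show "\<exists>q\<in>carrier (bracket_ring k n). q \<oplus>\<^bsub>bracket_ring k n\<^esub> p = \<zero>\<^bsub>bracket_ring k n\<^esub>"
      if "p \<in> carrier (bracket_ring k n)" for p
      using that by (intro bexI[of _ "- p"]) (auto intro: bracket_ring_closed)
  qed (auto intro: bracket_ring_closed simp: add_ac)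
  show "comm_monoid (bracket_ring k n)"
    by (rule comm_monoidI) (auto intro: bracket_ring_closed simp: mult_ac)
qed (simp add: distrib_right)

lemma bracket_ring_sum_closed:
  "(\<And>x. x \<in> A \<Longrightarrow> g x \<in> carrier (bracket_ring k n)) \<Longrightarrow> sum g A \<in> carrier (bracket_ring k n)"
  by (induction A rule: infinite_finite_induct) (auto intro: bracket_ring_closed)

lemma single_in_carrier:
  "keys m \<subseteq> bracket_vars k n \<Longrightarrow> single m c \<in> carrier (bracket_ring k n)"
  by (simp add: bracket_ring_carrier_iff)

lemma bracket_ideal_closed:
  assumes I: "ideal I (bracket_ring k n)"
  shows "0 \<in> I" "p \<in> I \<Longrightarrow> q \<in> I \<Longrightarrow> p + q \<in> I" "p \<in> I \<Longrightarrow> q \<in> carrier (bracket_ring k n) \<Longrightarrow> p * q \<in> I"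
    "p \<in> I \<Longrightarrow> - p \<in> I" "p \<in> I \<Longrightarrow> q \<in> I \<Longrightarrow> p - q \<in> I" "I \<subseteq> carrier (bracket_ring k n)"
proof -
  interpret ideal I "bracket_ring k n" by (rule I)
  show "0 \<in> I" using additive_subgroup.zero_closed[OF additive_subgroup_axioms] by simp
  show add: "p + q \<in> I" if "p \<in> I" "q \<in> I" for p q using additive_subgroup.a_closed[OF additive_subgroup_axioms that] by simp
  show mult: "p * q \<in> I" if "p \<in> I" "q \<in> carrier (bracket_ring k n)" for p q
    using I_r_closed[OF that] by simp
  show um: "- p \<in> I" if "p \<in> I" for p
    using mult[OF that, of "- 1"] by (simp add: bracket_ring_closed)
  show "p - q \<in> I" if "p \<in> I" "q \<in> I" using add[OF that(1) um[OF that(2)]] by simp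
  show "I \<subseteq> carrier (bracket_ring k n)" by (rule a_subset)
qed

lemma bracket_ideal_sum_closed:
  assumes "ideal I (bracket_ring k n)" "\<And>x. x \<in> A \<Longrightarrow> g x \<in> I"
  shows "sum g A \<in> I"
  using assms(2) by (induction A rule: infinite_finite_induct) (auto intro: bracket_ideal_closed[OF assms(1)])

lemma bracket_idealI:
  assumes "I \<subseteq> carrier (bracket_ring k n)" "0 \<in> I"
    and add: "\<And>p q. p \<in> I \<Longrightarrow> q \<in> I \<Longrightarrow> p + q \<in> I"
    and mult: "\<And>p q. p \<in> I \<Longrightarrow> q \<in> carrier (bracket_ring k n) \<Longrightarrow> p * q \<in> I"
  shows "ideal I (bracket_ring k n)"
proof -
  interpret cring "bracket_ring k n" by (rule bracket_ring_cring)
  show ?thesis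
  proof (rule idealI)
    show "ring (bracket_ring k n)" by (rule ring_axioms)
    show "subgroup I (add_monoid (bracket_ring k n))"
    proof
      show "inv\<^bsub>add_monoid (bracket_ring k n)\<^esub> p \<in> I" if "p \<in> I" for p
      proof -
        have p: "p \<in> carrier (bracket_ring k n)" using that assms(1) by auto
        have "- p \<in> I" using mult[OF that, of "- 1"] by (simp add: bracket_ring_closed)
        moreover have "\<ominus>\<^bsub>bracket_ring k n\<^esub> p = - p"
          by (rule minus_equality) (use p in \<open>auto intro: bracket_ring_closed\<close>)
        ultimately show ?thesis by (simp add: a_inv_def)
      qed
    qed (use assms in auto)
  qed (use mult in \<open>auto simp: mult.commute\<close>)
qed

lemma bracket_genideal:
  assumes "S \<subseteq> carrier (bracket_ring k n)"
  shows "ideal (genideal (bracket_ring k n) S) (bracket_ring k n)"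
    "S \<subseteq> genideal (bracket_ring k n) S"
    "ideal I (bracket_ring k n) \<Longrightarrow> S \<subseteq> I \<Longrightarrow> genideal (bracket_ring k n) S \<subseteq> I"
proof -
  interpret cring "bracket_ring k n" by (rule bracket_ring_cring)
  show "ideal (genideal (bracket_ring k n) S) (bracket_ring k n)" using assms by (rule genideal_ideal)
  show "S \<subseteq> genideal (bracket_ring k n) S" using assms by (rule genideal_self)
  show "genideal (bracket_ring k n) S \<subseteq> I" if "ideal I (bracket_ring k n)" "S \<subseteq> I"
    using that by (rule genideal_minimal)
qed

lemma keys_scalar_mult:
  "keys (single 0 c * p) \<subseteq> keys (p :: bracket_poly)"
  using keys_mult[of "single 0 c" p] by (auto split: if_splits)

lemma keys_sum_subset: "keys (sum f A) \<subseteq> (\<Union>x\<in>A. keys (f x :: bracket_poly))"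
proof (induction A rule: infinite_finite_induct)
  case (insert x A)
  then show ?case using keys_add[of "f x" "sum f A"] by fastforce
qed simp_all

lemma keys_add_nat: "keys (a + b) = keys a \<union> keys (b :: 'a \<Rightarrow>\<^sub>0 nat)"
  by (auto simp: in_keys_iff lookup_add)

lemma monomial_degree_superset:
  assumes "finite A" "keys m \<subseteq> A"
  shows "monomial_degree m = (\<Sum>x\<in>A. lookup m x)"
  unfolding monomial_degree_def
  by (rule sum.mono_neutral_left) (use assms in \<open>auto simp: in_keys_iff\<close>)

lemma monomial_degree_add: "monomial_degree (a + b) = monomial_degree a + monomial_degree b"
proof -
  let ?A = "keys a \<union> keys b"
  have "monomial_degree (a + b) = (\<Sum>x\<in>?A. lookup (a + b) x)"
    by (rule monomial_degree_superset) (auto simp: keys_add_nat)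
  then show ?thesis
    using monomial_degree_superset[of ?A a] monomial_degree_superset[of ?A b]
    by (simp add: lookup_add sum.distrib)
qed

lemma monomial_degree_single [simp]: "monomial_degree (single x i) = i"
  by (cases "i = 0") (simp_all add: monomial_degree_def)

lemma monomial_degree_zero [simp]: "monomial_degree 0 = 0"
  by (simp add: monomial_degree_def)

lemma monomial_degree_eq_0_iff: "monomial_degree m = 0 \<longleftrightarrow> m = 0"
proof
  assume "monomial_degree m = 0"
  then show "m = 0"
    by (intro poly_mapping_eqI) (auto simp: monomial_degree_def in_keys_iff)
qed simp

lemma monomial_split_var:
  assumes "x \<in> keys (m :: 'a \<Rightarrow>\<^sub>0 nat)"
  shows "single x 1 + (m - single x 1) = m"
  using assms by (intro poly_mapping_eqI) (auto simp: lookup_add lookup_minus lookup_single when_def in_keys_iff)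

definition var_pair :: "'a \<Rightarrow> 'a \<Rightarrow> 'a \<Rightarrow>\<^sub>0 nat" where
  "var_pair x y = single x 1 + single y 1"

lemma keys_var_pair [simp]: "keys (var_pair x y) = {x, y}"
  by (simp add: var_pair_def keys_add_nat insert_commute)

lemma monomial_value_var_pair [simp]: "monomial_value f (var_pair x y) = f x * f y"
  by (simp add: var_pair_def monomial_value_add)

lemma monomial_degree_var_pair [simp]: "monomial_degree (var_pair x y) = 2"
  by (simp add: var_pair_def monomial_degree_add)

section \<open>The affine parametrization and its Schubert subsets\<close>

definition complement_list :: "nat \<Rightarrow> nat list \<Rightarrow> nat list" where
  "complement_list n J = sorted_list_of_set ({1..n} - set J)"

lemma set_complement_list [simp]: "set (complement_list n J) = {1..n} - set J"
  by (simp add: complement_list_def)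

lemma complement_list_in_plucker:
  assumes "J \<in> plucker_indices k n"
  shows "complement_list n J \<in> plucker_indices (n - k) n"
proof -
  have "card (set J) = k" "set J \<subseteq> {1..n}" using assms
    by (auto simp: plucker_indices_def strict_sorted_iff distinct_card)
  then show ?thesis
    by (auto simp: plucker_indices_def complement_list_def card_Diff_subset)
qed

lemma plucker_eq_sorted_list_of_set:
  "J \<in> plucker_indices k n \<Longrightarrow> sorted_list_of_set (set J) = J"
  by (auto simp: plucker_indices_def strict_sorted_iff sorted_list_of_set.idem_if_sorted_distinct)

lemma complement_list_involutive:
  assumes "J \<in> plucker_indices k n"
  shows "complement_list n (complement_list n J) = J"
proof -
  have "{1..n} - ({1..n} - set J) = set J" using assms by (auto simp: plucker_indices_def)
  then show ?thesis
    unfolding complement_list_def[of n "complement_list n J"]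
    using plucker_eq_sorted_list_of_set[OF assms] by simp
qed

text \<open>The permutation matrix that lists the complement of \<open>J\<close> before \<open>J\<close>. Its determinant is
the sign that relates a maximal minor of a subspace to the complementary minor of its orthogonal
complement.\<close>

definition complement_matrix :: "nat \<Rightarrow> nat list \<Rightarrow> complex mat" where
  "complement_matrix n J = mat n n (\<lambda>(i, j). if Suc i = (complement_list n J @ J) ! j then 1 else 0)"

definition complement_sign :: "nat \<Rightarrow> nat list \<Rightarrow> complex" where
  "complement_sign n J = det (complement_matrix n J)"

lemma complement_append:
  assumes "J \<in> plucker_indices k n" "k \<le> n"
  shows "distinct (complement_list n J @ J)" "length (complement_list n J @ J) = n"
    "set (complement_list n J @ J) = {1..n}"
proof -
  note c = complement_list_in_plucker[OF assms(1)]
  show "distinct (complement_list n J @ J)" using assms(1) c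
    by (auto simp: plucker_indices_def strict_sorted_iff)
  show "length (complement_list n J @ J) = n" using assms c by (auto simp: plucker_indices_def)
  show "set (complement_list n J @ J) = {1..n}" using assms(1) by (auto simp: plucker_indices_def)
qed

lemma complement_matrix_orthogonal:
  assumes J: "J \<in> plucker_indices k n" "k \<le> n"
  shows "transpose_mat (complement_matrix n J) * complement_matrix n J = 1\<^sub>m n"
proof (rule eq_matI)
  fix i j assume ij: "i < dim_row (1\<^sub>m n)" "j < dim_col (1\<^sub>m n)"
  let ?l = "complement_list n J @ J"
  note sl = complement_append[OF J]
  have "(transpose_mat (complement_matrix n J) * complement_matrix n J) $$ (i, j) =
     (\<Sum>a\<in>{0..<n}. (if Suc a = ?l ! i then 1 else 0) * (if Suc a = ?l ! j then 1 else 0))"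
    using ij by (simp add: complement_matrix_def scalar_prod_def)
  also have "\<dots> = (\<Sum>a\<in>{0..<n}. if a = ?l ! i - 1 then (if i = j then 1 else 0) else 0)"
  proof (rule sum.cong[OF refl])
    fix a assume "a \<in> {0..<n}"
    have "?l ! i \<in> {1..n}" using ij sl nth_mem[of i ?l] by simp
    moreover have "?l ! i = ?l ! j \<longleftrightarrow> i = j" using ij sl by (simp add: nth_eq_iff_index_eq)
    ultimately show "(if Suc a = ?l ! i then 1 else 0) * (if Suc a = ?l ! j then 1 else 0) =
       (if a = ?l ! i - 1 then (if i = j then 1 else 0) else (0::complex))"
      by auto
  qed
  also have "\<dots> = (if i = j then 1 else 0)"
  proof -
    have "?l ! i \<in> {1..n}" using ij sl nth_mem[of i ?l] by simp
    then have "?l ! i - 1 \<in> {0..<n}" by auto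
    then show ?thesis by (subst sum.delta) simp_all
  qed
  finally show "(transpose_mat (complement_matrix n J) * complement_matrix n J) $$ (i, j) = 1\<^sub>m n $$ (i, j)"
    using ij by simp
qed (auto simp: complement_matrix_def)

lemma complement_sign_square:
  assumes "J \<in> plucker_indices k n" "k \<le> n"
  shows "complement_sign n J * complement_sign n J = 1"
proof -
  have c: "complement_matrix n J \<in> carrier_mat n n" by (simp add: complement_matrix_def)
  have "det (transpose_mat (complement_matrix n J) * complement_matrix n J) = 1"
    unfolding complement_matrix_orthogonal[OF assms] by simp
  then show ?thesis
    using c by (simp add: det_mult[of _ n] det_transpose complement_sign_def)
qed

lemma complement_sign_nonzero:
  "J \<in> plucker_indices k n \<Longrightarrow> k \<le> n \<Longrightarrow> complement_sign n J \<noteq> 0"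
  using complement_sign_square by fastforce

lemma poly_minor:
  "poly (minor A s e l) t = minor (\<lambda>i j. poly (A i j) t) s e l"
  by (simp add: minor_Leibniz poly_sum poly_prod)

lemma row_weak_absolute:
  assumes "s2 \<le> s1"
  shows "row_weak s1 s2 e2 K I \<longleftrightarrow> (\<forall>a. s1 \<le> a \<longrightarrow> a < e2 \<longrightarrow> K ! (a - s1) \<le> I ! (a - s2))"
proof
  assume rw: "row_weak s1 s2 e2 K I"
  show "\<forall>a. s1 \<le> a \<longrightarrow> a < e2 \<longrightarrow> K ! (a - s1) \<le> I ! (a - s2)"
  proof (intro allI impI)
    fix a assume a: "s1 \<le> a" "a < e2"
    then have "s1 - s2 + (a - s1) = a - s2" "s1 + (a - s1) = a" using assms by simp_all
    with a rw show "K ! (a - s1) \<le> I ! (a - s2)" unfolding row_weak_def by metis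
  qed
next
  assume h: "\<forall>a. s1 \<le> a \<longrightarrow> a < e2 \<longrightarrow> K ! (a - s1) \<le> I ! (a - s2)"
  show "row_weak s1 s2 e2 K I"
    unfolding row_weak_def
  proof (intro allI impI)
    fix b assume b: "s1 + b < e2"
    have "s1 + b - s2 = s1 - s2 + b" using assms by simp
    with h[rule_format, of "s1 + b"] b show "K ! b \<le> I ! (s1 - s2 + b)" by simp
  qed
qed

text \<open>If the rows decrease at entry \<open>b\<close> of \<open>K\<close>, the first \<open>s1 - s2 + b + 1\<close>
columns of \<open>I\<close> are too small to have a nonzero entry in the rows from \<open>s1 + b\<close> on, and
fewer than that many rows lie above. So each term of the Leibniz expansion has a zero factor.\<close>

lemma minor_vanishes:
  fixes M :: "nat \<Rightarrow> nat \<Rightarrow> 'a::comm_ring_1"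
  assumes s: "s2 \<le> s1" "e2 \<le> e1" and I: "I \<in> plucker_indices (e2 - s2) n" and K: "K \<in> plucker_indices (e1 - s1) n"
    and viol: "\<not> row_weak s1 s2 e2 K I"
    and M: "\<And>a j. s1 \<le> a \<Longrightarrow> a < e2 \<Longrightarrow> j < K ! (a - s1) \<Longrightarrow> M a j = 0"
  shows "minor M s2 e2 I = 0"
proof -
  obtain b where b: "s1 + b < e2" "I ! (s1 - s2 + b) < K ! b"
    using viol by (auto simp: row_weak_def not_le)
  define h where "h = s1 - s2 + b"
  have zero: "(\<Prod>j<e2 - s2. M (s2 + p j) (I ! j)) = 0" if p: "p permutes {0..<e2 - s2}" for p
  proof -
    \<comment> \<open>The first \<open>h + 1\<close> columns cannot all take their entries from the \<open>h\<close> rows above row \<open>s1 + b\<close>.\<close>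
    have "\<not> p ` {0..h} \<subseteq> {0..<h}"
    proof
      assume "p ` {0..h} \<subseteq> {0..<h}"
      moreover have "inj_on p {0..h}" using permutes_inj[OF p] by (rule inj_on_subset) simp
      ultimately have "card {0..h} \<le> card {0..<h}" by (intro card_inj_on_le) auto
      then show False by simp
    qed
    then obtain j where j: "j \<le> h" "h \<le> p j"
      by (metis atLeastAtMost_iff atLeastLessThan_iff image_subsetI not_le zero_le)
    have jm: "j < e2 - s2" using j b s by (auto simp: h_def)
    then have pj: "p j < e2 - s2" using p by (metis atLeast0LessThan lessThan_iff permutes_in_image)
    have "I ! j \<le> I ! h" using plucker_nth_le[OF I j(1)] b s by (auto simp: h_def)
    also have "I ! h < K ! b" using b by (simp add: h_def)
    also have "K ! b \<le> K ! (s2 + p j - s1)"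
      by (rule plucker_nth_le[OF K]) (use j pj b s in \<open>auto simp: h_def\<close>)
    finally have "M (s2 + p j) (I ! j) = 0"
      by (intro M) (use j pj b s in \<open>auto simp: h_def\<close>)
    then show ?thesis using jm by (intro prod_zero) auto
  qed
  show ?thesis unfolding minor_Leibniz by (intro sum.neutral) (use zero in auto)
qed

lemma minor_diagonal:
  assumes "s \<le> e" and I: "I \<in> plucker_indices (e - s) n"
    and M: "\<And>a j. s \<le> a \<Longrightarrow> a < e \<Longrightarrow> M a j = (if j = I ! (a - s) then 1 else 0)"
  shows "minor M s e I = 1"
proof -
  have "distinct I" "length I = e - s" using I by (auto simp: plucker_indices_def strict_sorted_iff)
  then have "mat (e - s) (e - s) (\<lambda>(i, j). M (s + i) (I ! j)) = 1\<^sub>m (e - s)"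
    by (intro eq_matI) (auto simp: M nth_eq_iff_index_eq)
  then show ?thesis by (simp add: minor_def)
qed

locale spinor_helicity_parameters =
  fixes k n r :: nat
  assumes r_le_k: "r \<le> k" and dim_bound: "2 * k \<le> r + n"
begin

text \<open>The number of rows of a parameter matrix. Its first \<open>k\<close> rows stand for a basis of \<open>V\<close>,
the last \<open>n - k\<close> rows for a basis of the orthogonal complement of \<open>W\<close>, and the rows
\<open>r, ..., k - 1\<close> belong to both.\<close>

definition N :: nat where "N = n - k + r"

lemma bounds: "k \<le> n" "k \<le> N" "r \<le> N" "N \<le> n" "N - r = n - k"
  using r_le_k dim_bound by (auto simp: N_def)

fun is_angle :: "bracket \<Rightarrow> bool" where
  "is_angle (Angle I) = True"
| "is_angle (Square J) = False"

fun columns :: "bracket \<Rightarrow> nat list" where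
  "columns (Angle I) = I"
| "columns (Square J) = complement_list n J"

definition top_row :: "bracket \<Rightarrow> nat" where "top_row x = (if is_angle x then 0 else r)"
definition end_row :: "bracket \<Rightarrow> nat" where "end_row x = (if is_angle x then k else N)"

abbreviation vars :: "bracket set" where "vars \<equiv> bracket_vars k n"

lemma columns_in_plucker:
  "x \<in> vars \<Longrightarrow> columns x \<in> plucker_indices (end_row x - top_row x) n"
  using bounds by (auto simp: bracket_vars_def top_row_def end_row_def intro: complement_list_in_plucker)

lemma bracket_eqI:
  assumes "x \<in> vars" "y \<in> vars" "is_angle x = is_angle y" "columns x = columns y"
  shows "x = y"
proof (cases x)
  case (Square J)
  then obtain J' where J': "y = Square J'" using assms(3) by (cases y) auto
  have "J \<in> plucker_indices k n" "J' \<in> plucker_indices k n"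
    using assms(1,2) Square J' by (auto simp: bracket_vars_def)
  then have "J = J'" using assms(4) Square J' complement_list_involutive by (metis columns.simps(2))
  then show ?thesis using Square J' by simp
next
  case (Angle I)
  then show ?thesis using assms by (cases y) auto
qed

lemma finite_vars: "finite vars"
  by (simp add: bracket_vars_def)

text \<open>The bracket \<open>x\<close> may stand to the left of \<open>y\<close> in a skew tableau with weakly increasing
rows. The columns of square brackets start and end lower, so they come first.\<close>

definition bracket_le :: "bracket \<Rightarrow> bracket \<Rightarrow> bool" where
  "bracket_le x y \<longleftrightarrow> (is_angle x \<longrightarrow> is_angle y) \<and>
     row_weak (top_row x) (top_row y) (end_row y) (columns x) (columns y)"

lemma rows_mono:
  assumes "is_angle x \<longrightarrow> is_angle y"
  shows "top_row y \<le> top_row x" "end_row y \<le> end_row x"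
  using assms bounds by (auto simp: top_row_def end_row_def)

lemma top_le_end: "top_row x \<le> end_row x"
  using bounds by (auto simp: top_row_def end_row_def)

lemma bracket_le_refl: "bracket_le x x"
  by (simp add: bracket_le_def row_weak_def)

lemma bracket_le_iff:
  "bracket_le x y \<longleftrightarrow> (is_angle x \<longrightarrow> is_angle y) \<and>
     (\<forall>a. top_row x \<le> a \<longrightarrow> a < end_row y \<longrightarrow> columns x ! (a - top_row x) \<le> columns y ! (a - top_row y))"
  unfolding bracket_le_def using row_weak_absolute rows_mono(1) by blast

lemma bracket_le_trans:
  assumes "bracket_le x y" "bracket_le y z"
  shows "bracket_le x z"
  unfolding bracket_le_iff
proof (intro conjI impI allI)
  show "is_angle x \<Longrightarrow> is_angle z" using assms by (auto simp: bracket_le_def)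
  have xy: "top_row y \<le> top_row x" and yz: "top_row z \<le> top_row y" "end_row z \<le> end_row y"
    using assms rows_mono unfolding bracket_le_def by blast+
  fix a assume a: "top_row x \<le> a" "a < end_row z"
  have "columns x ! (a - top_row x) \<le> columns y ! (a - top_row y)"
    using assms(1) a yz unfolding bracket_le_iff by simp
  also have "\<dots> \<le> columns z ! (a - top_row z)"
    using assms(2) a xy unfolding bracket_le_iff by simp
  finally show "columns x ! (a - top_row x) \<le> columns z ! (a - top_row z)" .
qed

lemma bracket_le_antisym:
  assumes xy: "bracket_le x y" "bracket_le y x" and "x \<in> vars" "y \<in> vars"
  shows "x = y"
proof (rule bracket_eqI[OF assms(3,4)])
  show t: "is_angle x = is_angle y" using xy by (auto simp: bracket_le_def)
  then have rows: "top_row x = top_row y" "end_row x = end_row y" by (simp_all add: top_row_def end_row_def)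
  have "length (columns x) = end_row x - top_row x" "length (columns y) = end_row x - top_row x"
    using columns_in_plucker[OF assms(3)] columns_in_plucker[OF assms(4)] rows
    by (auto simp: plucker_indices_def)
  then show "columns x = columns y"
    using xy rows by (intro nth_equalityI) (auto simp: bracket_le_def row_weak_def intro!: le_antisym)
qed

text \<open>A parameter matrix together with the scalars \<open>c\<close> and \<open>d\<close> of the two Plucker vectors.
The scalars separate the two families of brackets also for \<open>r = 0\<close> and \<open>n = 2 k\<close>,
where both are minors of the same rows.\<close>

type_synonym cone_point = "(nat \<Rightarrow> nat \<Rightarrow> complex) \<times> complex \<times> complex"

definition bracket_value :: "(nat \<Rightarrow> nat \<Rightarrow> 'a::comm_ring_1) \<Rightarrow> bracket \<Rightarrow> 'a" where
  "bracket_value M x = minor M (top_row x) (end_row x) (columns x)"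

fun scale_of :: "complex \<times> complex \<Rightarrow> bracket \<Rightarrow> complex" where
  "scale_of (c, d) (Angle I) = c"
| "scale_of (c, d) (Square J) = d * complement_sign n J"

fun coords :: "cone_point \<Rightarrow> bracket \<Rightarrow> complex" where
  "coords (M, c, d) x = scale_of (c, d) x * bracket_value M x"

text \<open>The entries of the parameter matrix that may be nonzero on the Schubert subset of \<open>z\<close>: in a row
that \<open>z\<close> meets, those whose column number is at least the entry of \<open>z\<close>. The rows that
a square bracket does not meet are free, whereas for an angle bracket the rows from \<open>k\<close> on are
zero. This makes the Schubert subsets decrease when \<open>z\<close> grows.\<close>

definition in_mask :: "bracket \<Rightarrow> nat \<Rightarrow> nat \<Rightarrow> bool" where
  "in_mask z a j \<longleftrightarrow> (top_row z \<le> a \<and> a < end_row z \<longrightarrow> columns z ! (a - top_row z) \<le> j) \<and>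
     (is_angle z \<longrightarrow> a < k)"

definition schubert :: "bracket \<Rightarrow> cone_point set" where
  "schubert z = {(M, c, d). (\<forall>a j. \<not> in_mask z a j \<longrightarrow> M a j = 0) \<and> (is_angle z \<longrightarrow> d = 0)}"

lemma schubert_vanishes:
  assumes z: "z \<in> vars" and x: "x \<in> vars" and nle: "\<not> bracket_le z x" and P: "P \<in> schubert z"
  shows "coords P x = 0"
proof -
  obtain M c d where P': "P = (M, c, d)" by (cases P)
  show ?thesis
  proof (cases "is_angle z \<and> \<not> is_angle x")
    case True
    then show ?thesis using P P' by (cases x) (auto simp: schubert_def)
  next
    case False
    then have zx: "is_angle z \<longrightarrow> is_angle x" by blast
    then have "\<not> row_weak (top_row z) (top_row x) (end_row x) (columns z) (columns x)"
      using nle by (auto simp: bracket_le_def)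
    moreover have "M a j = 0" if "top_row z \<le> a" "a < end_row x" "j < columns z ! (a - top_row z)" for a j
    proof -
      have "a < end_row z" using that rows_mono(2)[OF zx] by simp
      then have "\<not> in_mask z a j" using that by (simp add: in_mask_def)
      then show ?thesis using P P' by (simp add: schubert_def)
    qed
    ultimately have "bracket_value M x = 0"
      unfolding bracket_value_def
      by (intro minor_vanishes[OF rows_mono[OF zx] columns_in_plucker[OF x] columns_in_plucker[OF z]])
    then show ?thesis using P' by simp
  qed
qed

lemma schubert_mono:
  assumes "bracket_le z z'"
  shows "schubert z' \<subseteq> schubert z"
proof -
  have zz: "is_angle z \<longrightarrow> is_angle z'" using assms by (simp add: bracket_le_def)
  have "in_mask z a j" if m: "in_mask z' a j" for a j
    unfolding in_mask_def
  proof (intro conjI impI)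
    show "is_angle z \<Longrightarrow> a < k" using m zz by (simp add: in_mask_def)
    assume a: "top_row z \<le> a \<and> a < end_row z"
    have ae: "a < end_row z'"
      using m a zz by (cases "is_angle z'") (auto simp: in_mask_def end_row_def)
    have ta: "top_row z' \<le> a" using a rows_mono(1)[OF zz] by simp
    have "columns z ! (a - top_row z) \<le> columns z' ! (a - top_row z')"
      using assms a ae unfolding bracket_le_iff by blast
    also have "columns z' ! (a - top_row z') \<le> j"
      using m ae ta by (simp add: in_mask_def)
    finally show "columns z ! (a - top_row z) \<le> j" .
  qed
  then show ?thesis using zz by (auto simp: schubert_def)
qed

lemma schubert_nonzero:
  assumes z: "z \<in> vars"
  obtains P where "P \<in> schubert z" "coords P z \<noteq> 0"
proof -
  define M :: "nat \<Rightarrow> nat \<Rightarrow> complex" where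
    "M a j = (if top_row z \<le> a \<and> a < end_row z \<and> j = columns z ! (a - top_row z) then 1 else 0)" for a j
  let ?P = "(M, 1 :: complex, if is_angle z then 0 else 1 :: complex)"
  have "?P \<in> schubert z"
    by (auto simp: schubert_def M_def in_mask_def end_row_def split: if_splits)
  moreover have "bracket_value M z = 1"
    unfolding bracket_value_def
    by (rule minor_diagonal[OF top_le_end columns_in_plucker[OF z]]) (simp add: M_def)
  then have "coords ?P z \<noteq> 0"
    using z bounds by (cases z) (auto simp: bracket_vars_def complement_sign_nonzero)
  ultimately show ?thesis by (rule that)
qed

fun line_point :: "cone_point \<Rightarrow> cone_point \<Rightarrow> complex \<Rightarrow> cone_point" where
  "line_point (M, c, d) (M', c', d') t =
     (\<lambda>a j. M a j + t * (M' a j - M a j), c + t * (c' - c), d + t * (d' - d))"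

lemma line_point_endpoints [simp]: "line_point P Q 0 = P" "line_point P Q 1 = Q"
  by (cases P; cases Q; simp)+

lemma schubert_line: "P \<in> schubert z \<Longrightarrow> Q \<in> schubert z \<Longrightarrow> line_point P Q t \<in> schubert z"
  by (cases P; cases Q) (auto simp: schubert_def)

lemma coords_polynomial_on_line:
  obtains F where "\<And>x t. poly (F x) t = coords (line_point P Q t) x"
proof -
  obtain M c d M' c' d' where P: "P = (M, c, d)" "Q = (M', c', d')" by (cases P; cases Q)
  define F where "F x = (case x of Angle I \<Rightarrow> [:c, c' - c:] | Square J \<Rightarrow> Polynomial.smult (complement_sign n J) [:d, d' - d:]) *
    minor (\<lambda>a j. [:M a j, M' a j - M a j:]) (top_row x) (end_row x) (columns x)" for x
  have "poly (F x) t = coords (line_point P Q t) x" for x t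
    by (cases x) (simp_all add: P F_def poly_minor bracket_value_def algebra_simps)
  then show ?thesis by (rule that)
qed

lemma eval_polynomial_on_line:
  obtains f where "\<And>t. poly f t = eval_bracket_poly (coords (line_point P Q t)) p"
proof -
  obtain F where F: "\<And>x t. poly (F x) t = coords (line_point P Q t) x"
    using coords_polynomial_on_line by blast
  have "poly (\<Sum>m\<in>keys p. [:lookup p m:] * monomial_value F m) t =
     eval_bracket_poly (coords (line_point P Q t)) p" for t
    by (simp add: eval_bracket_poly_alt poly_sum monomial_value_def poly_prod F[symmetric])
  then show ?thesis by (rule that)
qed

text \<open>On the line from \<open>P\<close> to \<open>Q\<close> both polynomials become polynomials in one complex
variable. Their product is zero and the first is not, so the second is zero.\<close>

lemma product_vanishes_on_linear_set:
  assumes S: "\<And>P Q t. P \<in> S \<Longrightarrow> Q \<in> S \<Longrightarrow> line_point P Q t \<in> S"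
    and zero: "\<And>P. P \<in> S \<Longrightarrow> eval_bracket_poly (coords P) p * eval_bracket_poly (coords P) q = 0"
    and P: "P \<in> S" "eval_bracket_poly (coords P) p \<noteq> 0" and Q: "Q \<in> S"
  shows "eval_bracket_poly (coords Q) q = 0"
proof -
  obtain f where f: "\<And>t. poly f t = eval_bracket_poly (coords (line_point P Q t)) p"
    using eval_polynomial_on_line by blast
  obtain g where g: "\<And>t. poly g t = eval_bracket_poly (coords (line_point P Q t)) q"
    using eval_polynomial_on_line by blast
  have "poly (f * g) t = 0" for t using zero[OF S[OF P(1) Q]] by (simp add: f g)
  then have "f * g = 0" using poly_all_0_iff_0 by blast
  moreover have "f \<noteq> 0" using f[of 0] P(2) by auto
  ultimately have "g = 0" by simp
  then show ?thesis using g[of 1] by simp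
qed

end

section \<open>Standard monomials are linearly independent\<close>

context spinor_helicity_parameters
begin

definition standard :: "monomial \<Rightarrow> bool" where
  "standard m \<longleftrightarrow> keys m \<subseteq> vars \<and>
     (\<forall>x\<in>keys m. \<forall>y\<in>keys m. bracket_le x y \<or> bracket_le y x)"

lemma chain_least:
  assumes "finite A" "A \<noteq> {}" "\<And>x y. x \<in> A \<Longrightarrow> y \<in> A \<Longrightarrow> bracket_le x y \<or> bracket_le y x"
  shows "\<exists>x\<in>A. \<forall>y\<in>A. bracket_le x y"
  using assms
proof (induction A rule: finite_ne_induct)
  case (singleton x)
  then show ?case by (simp add: bracket_le_refl)
next
  case (insert a F)
  then obtain x where x: "x \<in> F" "\<forall>y\<in>F. bracket_le x y" by blast
  show ?case
  proof (cases "bracket_le a x")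
    case True
    then show ?thesis using x bracket_le_trans[of a x] bracket_le_refl by blast
  next
    case False
    then have "bracket_le x a" using insert.prems[of a x] x(1) by auto
    then show ?thesis using x by blast
  qed
qed

lemma exists_maximal:
  assumes "finite A" "A \<noteq> {}" "A \<subseteq> vars"
  shows "\<exists>m\<in>A. \<forall>x\<in>A. bracket_le m x \<longrightarrow> x = m"
  using assms
proof (induction A rule: finite_ne_induct)
  case (singleton x)
  then show ?case by simp
next
  case (insert a F)
  then obtain m where m: "m \<in> F" "\<forall>x\<in>F. bracket_le m x \<longrightarrow> x = m" by blast
  show ?case
  proof (cases "bracket_le m a")
    case True
    have "x = a" if "x \<in> F" "bracket_le a x" for x
    proof -
      have "x = m" using m that True bracket_le_trans by blast
      then show ?thesis using that True insert.prems m(1) bracket_le_antisym by blast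
    qed
    then show ?thesis by blast
  next
    case False
    then show ?thesis using m by blast
  qed
qed

text \<open>Induction on the degree. Among the least variables of the monomials with nonzero coefficient let
\<open>z\<close> be maximal and restrict the relation to the Schubert subset of \<open>z\<close>. A monomial
survives only if all its variables lie above \<open>z\<close>. Its least variable then lies above
\<open>z\<close>, hence equals \<open>z\<close>. So \<open>z\<close> divides what is left and can be cancelled
by irreducibility, which lowers the degree. The set \<open>X\<close> is kept general so that the statement
applies to the restricted relation and to all parameters.\<close>

lemma standard_independent:
  assumes "finite S" "\<And>m. m \<in> S \<Longrightarrow> standard m"
    and "\<And>m x. m \<in> S \<Longrightarrow> x \<in> keys m \<Longrightarrow> schubert x \<subseteq> X"
    and "(\<lambda>a j. 0, 0, 0) \<in> X"
    and "\<And>P. P \<in> X \<Longrightarrow> (\<Sum>m\<in>S. c m * monomial_value (coords P) m) = 0"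
  shows "\<forall>m\<in>S. c m = 0"
proof -
  have "\<forall>m\<in>S. c m = 0"
    if "\<And>m. m \<in> S \<Longrightarrow> monomial_degree m \<le> D" for D
    using assms that
  proof (induction D arbitrary: S c X)
    case (0 S c X)
    let ?O = "(\<lambda>a j. 0, 0, 0)"
    show ?case
    proof
      fix m assume m: "m \<in> S"
      then have "m = 0" using 0(6)[of m] monomial_degree_eq_0_iff by auto
      moreover have "S = {0}" using m 0(6) monomial_degree_eq_0_iff by fastforce
      ultimately show "c m = 0" using 0(5)[OF 0(4)] by simp
    qed
  next
    case (Suc D S c X)
    let ?O = "(\<lambda>a j. 0 :: complex, 0 :: complex, 0 :: complex)"
    define S0 where "S0 = {m \<in> S. c m \<noteq> 0}"
    have fin0: "finite S0" and sub0: "S0 \<subseteq> S" using Suc.prems(1) by (auto simp: S0_def)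
    have sum0: "(\<Sum>m\<in>S0. c m * monomial_value (coords P) m) = 0" if "P \<in> X" for P
      unfolding Suc.prems(5)[OF that, symmetric]
      by (rule sum.mono_neutral_left) (use Suc.prems(1) in \<open>auto simp: S0_def\<close>)
    show ?case
    proof (rule ccontr)
      assume "\<not> ?case"
      then have ne: "S0 \<noteq> {}" by (auto simp: S0_def)
      have O0: "coords ?O x = 0" for x by (cases x) simp_all
      have valO: "monomial_value (coords ?O) m = (if m = 0 then 1 else 0)" for m
      proof (cases "m = 0")
        case False
        then obtain x where "x \<in> keys m" by (metis all_not_in_conv keys_eq_empty)
        then show ?thesis using False O0 unfolding monomial_value_def
          by (auto intro!: prod_zero bexI[of _ x] simp: in_keys_iff)
      qed simp
      \<comment> \<open>At the zero parameter all brackets vanish, which isolates the constant term.\<close>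
      have no0: "0 \<notin> S0"
      proof
        assume z: "0 \<in> S0"
        have "(\<Sum>m\<in>S0. c m * monomial_value (coords ?O) m) = c 0"
          unfolding valO using fin0 z by (simp add: if_distrib[of "\<lambda>x. _ * x"] cong: if_cong)
        with sum0[OF Suc.prems(4)] z show False by (simp add: S0_def)
      qed
      have "\<exists>x\<in>keys m. \<forall>y\<in>keys m. bracket_le x y" if "m \<in> S0" for m
        by (rule chain_least)
          (use that no0 sub0 Suc.prems(2)[of m] in \<open>auto simp: standard_def\<close>)
      then have "\<forall>m\<in>S0. \<exists>x. x \<in> keys m \<and> (\<forall>y\<in>keys m. bracket_le x y)"
        by blast
      from bchoice[OF this] obtain least where l:
        "\<forall>m\<in>S0. least m \<in> keys m \<and> (\<forall>y\<in>keys m. bracket_le (least m) y)"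
        by blast
      have least: "m \<in> S0 \<Longrightarrow> least m \<in> keys m"
        "m \<in> S0 \<Longrightarrow> y \<in> keys m \<Longrightarrow> bracket_le (least m) y" for m y
        using l by blast+
      have std: "standard m" if "m \<in> S0" for m using that sub0 Suc.prems(2) by blast
      have lv: "least ` S0 \<subseteq> vars" using least(1) std by (auto simp: standard_def)
      obtain z where z: "z \<in> least ` S0" "\<And>x. x \<in> least ` S0 \<Longrightarrow> bracket_le z x \<Longrightarrow> x = z"
        using exists_maximal[of "least ` S0"] fin0 ne lv by blast
      then obtain m0 where m0: "m0 \<in> S0" "z = least m0" by blast
      have zv: "z \<in> vars" using z(1) lv by blast
      define S1 where "S1 = {m \<in> S0. \<forall>x\<in>keys m. bracket_le z x}"
      have fin1: "finite S1" using fin0 by (simp add: S1_def)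
      have m01: "m0 \<in> S1" using m0 least(2)[OF m0(1)] by (auto simp: S1_def)
      have zkey: "z \<in> keys m" if "m \<in> S1" for m
      proof -
        have "m \<in> S0" "bracket_le z (least m)" using that least(1) by (auto simp: S1_def)
        then have "least m = z" using z(2) by blast
        then show ?thesis using least(1)[OF \<open>m \<in> S0\<close>] by simp
      qed
      have schX: "schubert z \<subseteq> X"
        using Suc.prems(3)[of m0 z] m0 sub0 least(1)[OF m0(1)] by blast
      let ?e = "single z (1::nat)"
      define S' where "S' = (\<lambda>m. m - ?e) ` S1"
      define q :: bracket_poly where "q = (\<Sum>m\<in>S'. single m (c (?e + m)))"
      have inj: "inj_on (\<lambda>m. m - ?e) S1"
        by (rule inj_on_inverseI[where g = "\<lambda>m. ?e + m"], rule monomial_split_var, rule zkey)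
      have evq: "eval_bracket_poly (coords P) q = (\<Sum>m\<in>S'. c (?e + m) * monomial_value (coords P) m)" for P
        by (simp add: q_def eval_sum)
      have prod0: "eval_bracket_poly (coords P) (poly_of_var z) * eval_bracket_poly (coords P) q = 0"
        if P: "P \<in> schubert z" for P
      proof -
        have "(\<Sum>m\<in>S'. c (?e + m) * monomial_value (coords P) m) =
            (\<Sum>m\<in>S1. c m * monomial_value (coords P) (m - ?e))"
          unfolding S'_def by (subst sum.reindex[OF inj]) (simp add: monomial_split_var zkey del: One_nat_def)
        then have "eval_bracket_poly (coords P) (poly_of_var z) * eval_bracket_poly (coords P) q =
            (\<Sum>m\<in>S1. c m * (monomial_value (coords P) ?e * monomial_value (coords P) (m - ?e)))"
          by (simp add: evq poly_of_var_def poly_of_monomial_def sum_distrib_left mult_ac)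
        also have "\<dots> = (\<Sum>m\<in>S1. c m * monomial_value (coords P) m)"
          by (intro sum.cong refl) (metis monomial_split_var monomial_value_add zkey)
        also have "\<dots> = (\<Sum>m\<in>S0. c m * monomial_value (coords P) m)"
        proof (rule sum.mono_neutral_left[OF fin0])
          show "\<forall>m\<in>S0 - S1. c m * monomial_value (coords P) m = 0"
          proof
            fix m assume m: "m \<in> S0 - S1"
            then obtain x where x: "x \<in> keys m" "\<not> bracket_le z x" by (auto simp: S1_def)
            then have "x \<in> vars" using std[of m] m by (auto simp: standard_def)
            then have "coords P x = 0" using schubert_vanishes[OF zv _ x(2) P] by blast
            then have "monomial_value (coords P) m = 0" unfolding monomial_value_def
              using x(1) by (auto intro!: prod_zero bexI[of _ x] simp: in_keys_iff)
            then show "c m * monomial_value (coords P) m = 0" by simp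
          qed
        qed (auto simp: S1_def)
        also have "\<dots> = 0" using sum0 P schX by blast
        finally show ?thesis .
      qed
      obtain P0 where P0: "P0 \<in> schubert z" "coords P0 z \<noteq> 0" using schubert_nonzero[OF zv] by blast
      have q0: "(\<Sum>m\<in>S'. c (?e + m) * monomial_value (coords P) m) = 0" if "P \<in> schubert z" for P
        unfolding evq[symmetric]
        by (rule product_vanishes_on_linear_set[OF schubert_line prod0 P0(1) _ that])
          (use P0(2) in \<open>simp_all add: poly_of_var_def poly_of_monomial_def\<close>)
      have keysS': "keys m' \<subseteq> keys (?e + m')" for m'
        by (auto simp: keys_add_nat)
      have S'mem: "?e + m' \<in> S1" if "m' \<in> S'" for m'
        using that monomial_split_var[OF zkey] by (auto simp: S'_def)
      have "\<forall>m\<in>S'. c (?e + m) = 0"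
      proof (rule Suc.IH)
        show "finite S'" using fin1 by (simp add: S'_def)
        show "standard m'" if "m' \<in> S'" for m'
          using std[of "?e + m'"] S'mem[OF that] keysS'[of m'] unfolding standard_def S1_def by blast
        show "schubert x \<subseteq> schubert z" if "m' \<in> S'" "x \<in> keys m'" for m' x
          using S'mem[OF that(1)] keysS'[of m'] that(2) by (intro schubert_mono) (auto simp: S1_def)
        show "(\<lambda>a j. 0, 0, 0) \<in> schubert z" by (simp add: schubert_def)
        show "(\<Sum>m\<in>S'. c (?e + m) * monomial_value (coords P) m) = 0" if "P \<in> schubert z" for P
          using q0[OF that] .
        show "monomial_degree m' \<le> D" if "m' \<in> S'" for m'
          using Suc.prems(6)[of "?e + m'"] S'mem[OF that] sub0
          by (auto simp: S1_def monomial_degree_add)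
      qed
      moreover have "m0 - ?e \<in> S'" using m01 by (auto simp: S'_def)
      ultimately have "c m0 = 0" using monomial_split_var[OF zkey[OF m01]] by metis
      then show False using m0(1) by (simp add: S0_def)
    qed
  qed
  from this[of "\<Sum>m\<in>S. monomial_degree m"] show ?thesis
    using assms(1) by (meson member_le_sum zero_le)
qed

corollary standard_poly_eq_0:
  assumes "\<And>m. m \<in> keys p \<Longrightarrow> standard m"
    and "\<And>P. eval_bracket_poly (coords P) p = 0"
  shows "p = 0"
proof -
  have "\<forall>m\<in>keys p. lookup p m = 0"
    by (rule standard_independent[where X = UNIV]) (use assms in \<open>auto simp: eval_bracket_poly_alt\<close>)
  then show ?thesis by (intro poly_mapping_eqI) (auto simp: in_keys_iff)
qed

definition comparable_pairs :: "(bracket \<times> bracket) set" where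
  "comparable_pairs = {(z, w) \<in> vars \<times> vars. bracket_le z w}"

lemma finite_comparable_pairs [simp]: "finite comparable_pairs"
  by (rule finite_subset[of _ "vars \<times> vars"]) (auto simp: comparable_pairs_def finite_vars)

lemma inj_var_pair: "inj_on (\<lambda>(z, w). var_pair z w) comparable_pairs"
proof (rule inj_onI, clarify)
  fix z w z' w'
  assume 1: "(z, w) \<in> comparable_pairs" "(z', w') \<in> comparable_pairs"
    and eq: "var_pair z w = var_pair z' w'"
  have "{z, w} = {z', w'}" using eq by (metis keys_var_pair)
  then show "z = z' \<and> w = w'"
    using 1 bracket_le_antisym by (auto simp: comparable_pairs_def doubleton_eq_iff)
qed

text \<open>The sign contained in \<open>coords\<close>, separated from the scalars \<open>c\<close> and \<open>d\<close>
because straightening coefficients have to be divided by it.\<close>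

fun orientation :: "bracket \<Rightarrow> complex" where
  "orientation (Angle I) = 1"
| "orientation (Square J) = complement_sign n J"

lemma orientation_nonzero: "x \<in> vars \<Longrightarrow> orientation x \<noteq> 0"
  using bounds by (auto simp: bracket_vars_def complement_sign_nonzero)

lemma coords_alt:
  "coords (M, c, d) x = (if is_angle x then c else d) * orientation x *
     minor M (top_row x) (end_row x) (columns x)"
  by (cases x) (simp_all add: bracket_value_def)

text \<open>Inverse to \<open>columns\<close> for a given kind of bracket.\<close>

definition bracket_of :: "bool \<Rightarrow> nat list \<Rightarrow> bracket" where
  "bracket_of a K = (if a then Angle K else Square (complement_list n K))"

lemma bracket_of:
  assumes "K \<in> plucker_indices ((if a then k else N) - (if a then 0 else r)) n"
  shows "bracket_of a K \<in> vars" "is_angle (bracket_of a K) = a" "columns (bracket_of a K) = K"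
proof -
  have "complement_list n K \<in> plucker_indices (n - (n - k)) n" if "\<not> a"
    using assms that bounds by (intro complement_list_in_plucker) simp
  then show "bracket_of a K \<in> vars" using assms bounds by (auto simp: bracket_of_def bracket_vars_def)
  show "is_angle (bracket_of a K) = a" by (simp add: bracket_of_def)
  show "columns (bracket_of a K) = K"
    using assms bounds complement_list_involutive[of K "n - k" n] by (auto simp: bracket_of_def)
qed

text \<open>Straightening of two minors does not change the row ranges, so all terms carry the same scalars \<open>c\<close>
and \<open>d\<close>, and the signs can be absorbed into the coefficients.\<close>

lemma product_spanned:
  assumes x: "x \<in> vars" and y: "y \<in> vars" and xy: "is_angle x \<longrightarrow> is_angle y"
  shows "\<exists>c. \<forall>P. coords P x * coords P y =
    (\<Sum>(z, w)\<in>comparable_pairs. c z w * (coords P z * coords P w))"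
proof -
  let ?s1 = "top_row x" and ?e1 = "end_row x" and ?s2 = "top_row y" and ?e2 = "end_row y"
  have "spanned_by_standard_pairs n ?s1 ?e1 ?s2 ?e2
      (\<lambda>M. minor M ?s1 ?e1 (columns x) * minor M ?s2 ?e2 (columns y) :: complex)"
    by (intro straightening rows_mono[OF xy] top_le_end columns_in_plucker x y)
  then obtain c :: "nat list \<Rightarrow> nat list \<Rightarrow> complex" where c: "\<And>M.
      minor M ?s1 ?e1 (columns x) * minor M ?s2 ?e2 (columns y) =
      (\<Sum>(K, I)\<in>standard_pairs n ?s1 ?e1 ?s2 ?e2. c K I * (minor M ?s1 ?e1 K * minor M ?s2 ?e2 I))"
    unfolding spanned_by_standard_pairs_def by blast
  define g where "g = (\<lambda>(K, I). (bracket_of (is_angle x) K, bracket_of (is_angle y) I))"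
  let ?SP = "standard_pairs n ?s1 ?e1 ?s2 ?e2"
  have gSP: "z \<in> vars" "w \<in> vars" "is_angle z = is_angle x" "is_angle w = is_angle y"
    "columns z = K" "columns w = I" "bracket_le z w"
    if "(K, I) \<in> ?SP" "(z, w) = g (K, I)" for K I z w
  proof -
    have z: "z \<in> vars" "is_angle z = is_angle x" "columns z = K"
      using that bracket_of[of K "is_angle x"] by (auto simp: g_def standard_pairs_def top_row_def end_row_def)
    have w: "w \<in> vars" "is_angle w = is_angle y" "columns w = I"
      using that bracket_of[of I "is_angle y"] by (auto simp: g_def standard_pairs_def top_row_def end_row_def)
    show "z \<in> vars" "w \<in> vars" "is_angle z = is_angle x" "is_angle w = is_angle y" "columns z = K" "columns w = I"
      by (fact z w)+
    show "bracket_le z w"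
      using that(1) xy z w by (simp add: bracket_le_def standard_pairs_def top_row_def end_row_def)
  qed
  have inj: "inj_on g ?SP"
  proof (rule inj_on_inverseI[where g = "\<lambda>(z, w). (columns z, columns w)"], clarify)
    fix K I assume KI: "(K, I) \<in> ?SP"
    obtain z w where zw: "(z, w) = g (K, I)" by (metis surj_pair)
    show "(case g (K, I) of (z, w) \<Rightarrow> (columns z, columns w)) = (K, I)"
      unfolding zw[symmetric] using gSP(5,6)[OF KI zw] by simp
  qed
  define c' where "c' z w = (if (z, w) \<in> g ` ?SP then c (columns z) (columns w) *
      orientation x * orientation y / (orientation z * orientation w) else 0)" for z w
  have "coords P x * coords P y = (\<Sum>(z, w)\<in>comparable_pairs. c' z w * (coords P z * coords P w))" for P
  proof -
    obtain M a d where P: "P = (M, a, d)" by (cases P)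
    let ?s = "(if is_angle x then a else d) * (if is_angle y then a else d)"
    have "coords P x * coords P y = ?s * orientation x * orientation y *
       (minor M ?s1 ?e1 (columns x) * minor M ?s2 ?e2 (columns y))"
      by (simp only: P coords_alt mult_ac)
    also have "\<dots> = (\<Sum>(K, I)\<in>?SP. ?s * orientation x * orientation y *
        (c K I * (minor M ?s1 ?e1 K * minor M ?s2 ?e2 I)))"
      by (simp only: c sum_distrib_left case_prod_unfold)
    also have "\<dots> = (\<Sum>p\<in>?SP. (\<lambda>(z, w). c' z w * (coords P z * coords P w)) (g p))"
    proof (rule sum.cong[OF refl], clarify)
      fix K I assume KI: "(K, I) \<in> ?SP"
      obtain z w where zw: "(z, w) = g (K, I)" by (metis surj_pair)
      note h = gSP[OF KI zw]
      have "top_row z = ?s1" "end_row z = ?e1" "top_row w = ?s2" "end_row w = ?e2"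
        using h(3,4) by (simp_all add: top_row_def end_row_def)
      moreover have "(z, w) \<in> g ` ?SP" using KI zw by simp
      ultimately show "?s * orientation x * orientation y * (c K I * (minor M ?s1 ?e1 K * minor M ?s2 ?e2 I)) =
          (\<lambda>(z, w). c' z w * (coords P z * coords P w)) (g (K, I))"
        unfolding zw[symmetric] P coords_alt c'_def
        using h orientation_nonzero[OF h(1)] orientation_nonzero[OF h(2)] by (simp add: field_simps)
    qed
    also have "\<dots> = (\<Sum>(z, w)\<in>g ` ?SP. c' z w * (coords P z * coords P w))"
      by (simp only: sum.reindex[OF inj] o_def)
    also have "\<dots> = (\<Sum>(z, w)\<in>comparable_pairs. c' z w * (coords P z * coords P w))"
    proof (rule sum.mono_neutral_left)
      show "g ` ?SP \<subseteq> comparable_pairs"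
      proof clarify
        fix z w K I assume KI: "(K, I) \<in> ?SP" and zw: "(z, w) = g (K, I)"
        show "(z, w) \<in> comparable_pairs" using gSP(1,2,7)[OF KI zw] by (simp add: comparable_pairs_def)
      qed
    qed (auto simp: c'_def)
    finally show ?thesis .
  qed
  then show ?thesis by blast
qed

text \<open>If some \<open>z\<close> in a straightening law were not below both \<open>x\<close> and \<open>y\<close>, then
the left hand side would vanish on the Schubert subset of \<open>z\<close>. The terms \<open>z' w'\<close> with
\<open>z \<le> z'\<close> are the only ones that remain there, among them the term of \<open>z\<close> itself,
which contradicts the independence of standard monomials.\<close>

theorem quadratic_straightening:
  assumes x: "x \<in> vars" and y: "y \<in> vars" and inc: "\<not> bracket_le x y" "\<not> bracket_le y x"
  obtains c where
    "\<And>P. coords P x * coords P y = (\<Sum>(z, w)\<in>comparable_pairs. c z w * (coords P z * coords P w))"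
    "\<And>z w. (z, w) \<in> comparable_pairs \<Longrightarrow> c z w \<noteq> 0 \<Longrightarrow> bracket_le z x \<and> bracket_le z y"
proof -
  have "\<exists>c. \<forall>P. coords P x * coords P y =
    (\<Sum>(z, w)\<in>comparable_pairs. c z w * (coords P z * coords P w))"
  proof (cases "is_angle x \<longrightarrow> is_angle y")
    case True
    then show ?thesis using product_spanned x y by blast
  next
    case False
    then obtain c where "\<forall>P. coords P y * coords P x =
      (\<Sum>(z, w)\<in>comparable_pairs. c z w * (coords P z * coords P w))"
      using product_spanned[OF y x] by blast
    then show ?thesis by (intro exI[of _ c]) (simp add: mult.commute)
  qed
  then obtain c where c: "\<And>P. coords P x * coords P y =
      (\<Sum>(z, w)\<in>comparable_pairs. c z w * (coords P z * coords P w))" by blast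
  have "bracket_le z x \<and> bracket_le z y" if zw: "(z, w) \<in> comparable_pairs" "c z w \<noteq> 0" for z w
  proof (rule ccontr)
    assume nle: "\<not> (bracket_le z x \<and> bracket_le z y)"
    have zv: "z \<in> vars" using zw by (simp add: comparable_pairs_def)
    define B where "B = {p \<in> comparable_pairs. bracket_le z (fst p)}"
    have finB: "finite B" by (simp add: B_def)
    define mon where "mon = (\<lambda>(z, w). var_pair z w :: monomial)"
    have injB: "inj_on mon B" unfolding mon_def
      using inj_var_pair by (rule inj_on_subset) (auto simp: B_def)
    define g where "g m = case_prod c (the_inv_into B mon m)" for m
    have g: "g (mon p) = case_prod c p" if "p \<in> B" for p
      by (simp add: g_def the_inv_into_f_f[OF injB that])
    have "\<forall>m\<in>mon ` B. g m = 0"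
    proof (rule standard_independent[where X = "schubert z"])
      show "finite (mon ` B)" using finB by simp
      show "standard m" if m: "m \<in> mon ` B" for m
        using m by (auto simp: B_def comparable_pairs_def mon_def standard_def bracket_le_refl)
      show "schubert v \<subseteq> schubert z" if "m \<in> mon ` B" "v \<in> keys m" for m v
      proof (rule schubert_mono)
        show "bracket_le z v" using that
          by (auto simp: B_def comparable_pairs_def mon_def intro: bracket_le_trans)
      qed
      show "(\<lambda>a j. 0, 0, 0) \<in> schubert z" by (simp add: schubert_def)
      fix P assume P: "P \<in> schubert z"
      have "(\<Sum>m\<in>mon ` B. g m * monomial_value (coords P) m) =
          (\<Sum>p\<in>B. case_prod c p * (coords P (fst p) * coords P (snd p)))"
      proof (subst sum.reindex[OF injB], rule sum.cong[OF refl])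
        fix p assume p: "p \<in> B"
        show "((\<lambda>m. g m * monomial_value (coords P) m) \<circ> mon) p =
            case_prod c p * (coords P (fst p) * coords P (snd p))"
          unfolding o_def g[OF p] by (simp add: mon_def case_prod_unfold)
      qed
      also have "\<dots> = (\<Sum>p\<in>comparable_pairs. case_prod c p * (coords P (fst p) * coords P (snd p)))"
      proof (rule sum.mono_neutral_left)
        show "\<forall>p\<in>comparable_pairs - B. case_prod c p * (coords P (fst p) * coords P (snd p)) = 0"
        proof
          fix p assume "p \<in> comparable_pairs - B"
          then have "fst p \<in> vars" "\<not> bracket_le z (fst p)" by (auto simp: B_def comparable_pairs_def)
          then have "coords P (fst p) = 0" using schubert_vanishes[OF zv _ _ P] by blast
          then show "case_prod c p * (coords P (fst p) * coords P (snd p)) = 0" by simp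
        qed
      qed (auto simp: B_def)
      also have "\<dots> = coords P x * coords P y" by (simp add: c case_prod_unfold)
      also have "\<dots> = 0" using nle schubert_vanishes[OF zv x _ P] schubert_vanishes[OF zv y _ P] by auto
      finally show "(\<Sum>m\<in>mon ` B. g m * monomial_value (coords P) m) = 0" .
    qed
    moreover have "(z, w) \<in> B" using zw by (simp add: B_def bracket_le_refl)
    ultimately have "c z w = 0" using g[of "(z, w)"] by auto
    with zw show False by simp
  qed
  with c show ?thesis using that by blast
qed

end

section \<open>The poset of brackets as a skew tableau order\<close>

lemma plucker_nth_gap:
  assumes "I \<in> plucker_indices m n" "i + d < m"
  shows "I ! i + d \<le> I ! (i + d)"
  using assms(2)
proof (induction d)
  case (Suc d)
  then show ?case using plucker_nth_less[OF assms(1), of "i + d" "i + Suc d"] by simp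
qed simp

lemma plucker_nth_bounds:
  assumes "I \<in> plucker_indices m n" "a < m"
  shows "a + 1 \<le> I ! a" "I ! a + m \<le> n + a + 1"
proof -
  have rng: "I ! j \<in> {1..n}" if "j < m" for j
    using assms(1) that nth_mem[of j I] unfolding plucker_indices_def by blast
  show "a + 1 \<le> I ! a" using plucker_nth_gap[OF assms(1), of 0 a] rng[of 0] assms(2) by simp
  show "I ! a + m \<le> n + a + 1"
  proof -
    have "a + (m - 1 - a) = m - 1" using assms(2) by simp
    then have "I ! a + (m - 1 - a) \<le> I ! (m - 1)"
      using plucker_nth_gap[OF assms(1), of a "m - 1 - a"] assms(2) by simp
    moreover have "I ! (m - 1) \<le> n" using rng[of "m - 1"] assms(2) by simp
    ultimately show ?thesis using assms(2) by arith
  qed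
qed

lemma card_below:
  assumes "I \<in> plucker_indices m n"
  shows "card {x \<in> set I. x \<le> t} = card {a. a < m \<and> I ! a \<le> t}"
proof -
  have "distinct I" "length I = m" using assms by (auto simp: plucker_indices_def strict_sorted_iff)
  then have "bij_betw ((!) I) {a. a < m \<and> I ! a \<le> t} {x \<in> set I. x \<le> t}"
    by (auto simp: bij_betw_def inj_on_def nth_eq_iff_index_eq in_set_conv_nth)
  then show ?thesis by (metis bij_betw_same_card)
qed

text \<open>Comparing sorted lists entry by entry amounts to counting how many entries lie below each threshold. In this
form the comparison can be transferred to complements.\<close>

lemma componentwise_le_iff_counting:
  assumes I: "I \<in> plucker_indices m n" and I': "I' \<in> plucker_indices m n"
  shows "(\<forall>a<m. I ! a \<le> I' ! a) \<longleftrightarrow> (\<forall>t. card {x \<in> set I'. x \<le> t} \<le> card {x \<in> set I. x \<le> t})"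
  unfolding card_below[OF I] card_below[OF I']
proof
  assume "\<forall>a<m. I ! a \<le> I' ! a"
  then show "\<forall>t. card {a. a < m \<and> I' ! a \<le> t} \<le> card {a. a < m \<and> I ! a \<le> t}"
    by (intro allI card_mono) (auto intro: order_trans)
next
  assume c: "\<forall>t. card {a. a < m \<and> I' ! a \<le> t} \<le> card {a. a < m \<and> I ! a \<le> t}"
  show "\<forall>a<m. I ! a \<le> I' ! a"
  proof (intro allI impI, rule ccontr)
    fix a assume a: "a < m" "\<not> I ! a \<le> I' ! a"
    have "card {0..a} \<le> card {b. b < m \<and> I' ! b \<le> I' ! a}"
      using a(1) plucker_nth_le[OF I'] by (intro card_mono) auto
    also have "\<dots> \<le> card {b. b < m \<and> I ! b \<le> I' ! a}" using c by blast
    also have "\<dots> \<le> card {0..<a}"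
    proof (intro card_mono subsetI)
      fix b assume b: "b \<in> {b. b < m \<and> I ! b \<le> I' ! a}"
      show "b \<in> {0..<a}"
      proof (rule ccontr)
        assume "b \<notin> {0..<a}"
        then have "I ! a \<le> I ! b" using b by (intro plucker_nth_le[OF I]) auto
        then show False using a(2) b by simp
      qed
    qed simp
    finally show False by simp
  qed
qed

lemma complement_reverses:
  assumes J: "J \<in> plucker_indices k n" and J': "J' \<in> plucker_indices k n"
  shows "(\<forall>a<n - k. complement_list n J ! a \<le> complement_list n J' ! a) \<longleftrightarrow> (\<forall>a<k. J' ! a \<le> J ! a)"
proof -
  have split: "card {x \<in> set (complement_list n J). x \<le> t} + card {x \<in> set J. x \<le> t} = card {x \<in> {1..n}. x \<le> t}"
    if "J \<in> plucker_indices k n" for J t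
  proof -
    have "{x \<in> {1..n}. x \<le> t} = {x \<in> set (complement_list n J). x \<le> t} \<union> {x \<in> set J. x \<le> t}"
      using that by (auto simp: plucker_indices_def)
    then show ?thesis by (simp add: card_Un_disjoint[symmetric] disjoint_iff)
  qed
  have "card {x \<in> set (complement_list n J'). x \<le> t} \<le> card {x \<in> set (complement_list n J). x \<le> t} \<longleftrightarrow>
      card {x \<in> set J. x \<le> t} \<le> card {x \<in> set J'. x \<le> t}" for t
    using split[OF J, of t] split[OF J', of t] by linarith
  then show ?thesis
    unfolding componentwise_le_iff_counting[OF complement_list_in_plucker[OF J] complement_list_in_plucker[OF J']]
      componentwise_le_iff_counting[OF J' J] by blast
qed

context spinor_helicity_parameters
begin

lemma bracket_le_Angle: "bracket_le (Angle I) (Angle I') \<longleftrightarrow> (\<forall>a<k. I ! a \<le> I' ! a)"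
  by (simp add: bracket_le_def row_weak_def top_row_def end_row_def)

lemma bracket_le_Square:
  "bracket_le (Square J) (Square J') \<longleftrightarrow> (\<forall>a<n - k. complement_list n J ! a \<le> complement_list n J' ! a)"
proof -
  have "r + b < N \<longleftrightarrow> b < n - k" for b using bounds by auto
  then show ?thesis by (simp add: bracket_le_def row_weak_def top_row_def end_row_def)
qed

lemma bracket_le_mixed:
  "bracket_le (Square J) (Angle I) \<longleftrightarrow> (\<forall>b<k - r. complement_list n J ! b \<le> I ! (r + b))"
proof -
  have "r + b < k \<longleftrightarrow> b < k - r" for b by auto
  then show ?thesis by (simp add: bracket_le_def row_weak_def top_row_def end_row_def)
qed

lemma angle_rel_iff: "(x, y) \<in> angle_rel k n \<longleftrightarrow>
    x \<in> vars \<and> y \<in> vars \<and> is_angle x \<and> is_angle y \<and> bracket_le x y"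
  by (cases x; cases y) (auto simp: angle_rel_def bracket_vars_def bracket_le_Angle)

lemma square_rel_iff: "(x, y) \<in> square_rel k n \<longleftrightarrow>
    x \<in> vars \<and> y \<in> vars \<and> \<not> is_angle x \<and> \<not> is_angle y \<and> bracket_le x y"
proof (cases "\<exists>J J'. x = Square J \<and> y = Square J'")
  case True
  then obtain J J' where xy: "x = Square J" "y = Square J'" by blast
  have "(x, y) \<in> square_rel k n \<longleftrightarrow>
      J \<in> plucker_indices k n \<and> J' \<in> plucker_indices k n \<and> (\<forall>a<k. J' ! a \<le> J ! a)"
    unfolding xy square_rel_def by blast
  also have "\<dots> \<longleftrightarrow> J \<in> plucker_indices k n \<and> J' \<in> plucker_indices k n \<and> bracket_le x y"
    unfolding xy bracket_le_Square using complement_reverses by blast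
  finally show ?thesis unfolding xy bracket_vars_def by auto
next
  case False
  then show ?thesis by (cases x; cases y) (auto simp: square_rel_def)
qed

text \<open>The two sides of a mixed relation agree as far as they share rows: the complement of \<open>1, ..., r, I\<close>
begins with \<open>J\<close>.\<close>

lemma mixed_relD:
  assumes "length I = k - r" "sorted_wrt (<) I" "length J = k - r" "sorted_wrt (<) J"
    "set I \<inter> set J = {}" "set I \<union> set J = {r+1..2*k-r}"
  shows "[1..<r+1] @ I \<in> plucker_indices k n" "[1..<r+1] @ J \<in> plucker_indices k n"
    "complement_list n ([1..<r+1] @ I) = J @ [2*k-r+1..<n+1]"
proof -
  have sub: "set I \<subseteq> {r+1..2*k-r}" "set J \<subseteq> {r+1..2*k-r}" using assms(6) by auto
  have kn: "2 * k - r \<le> n" using dim_bound by simp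
  have "[1..<r+1] @ X \<in> plucker_indices k n"
    if X: "length X = k - r" "sorted_wrt (<) X" "set X \<subseteq> {r+1..2*k-r}" for X
    unfolding plucker_indices_def mem_Collect_eq sorted_wrt_append
  proof (intro conjI ballI)
    show "length ([1..<r+1] @ X) = k" using X(1) r_le_k by (simp del: upt_Suc)
    show "sorted_wrt (<) [1..<r+1]" by (rule sorted_wrt_upt)
    show "x < y" if "x \<in> set [1..<r+1]" "y \<in> set X" for x y
    proof -
      have "x < r + 1" using that(1) by (simp del: upt_Suc)
      moreover have "r + 1 \<le> y" using that(2) X(3) by auto
      ultimately show ?thesis by simp
    qed
    have "set X \<subseteq> {1..n}" using X(3) kn by fastforce
    then show "set ([1..<r+1] @ X) \<subseteq> {1..n}" using r_le_k bounds(1) by (auto simp del: upt_Suc)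
  qed (rule X(2))
  then show "[1..<r+1] @ I \<in> plucker_indices k n" "[1..<r+1] @ J \<in> plucker_indices k n"
    using assms(1-4) sub by blast+
  let ?C = "J @ [2*k-r+1..<n+1]"
  have sorted: "sorted_wrt (<) ?C"
    unfolding sorted_wrt_append
  proof (intro conjI ballI)
    show "x < y" if "x \<in> set J" "y \<in> set [2*k-r+1..<n+1]" for x y
    proof -
      have "x \<le> 2 * k - r" using that(1) sub(2) by auto
      moreover have "2 * k - r + 1 \<le> y" using that(2) by (simp del: upt_Suc)
      ultimately show ?thesis by simp
    qed
  qed (use assms(4) in \<open>simp_all add: sorted_wrt_upt del: upt_Suc\<close>)
  have setC: "set ?C = set J \<union> {2*k-r+1..n}" by (auto simp del: upt_Suc)
  have setI: "set ([1..<r+1] @ I) = {1..r} \<union> set I" by (auto simp del: upt_Suc)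
  have "x \<in> {1..n} - ({1..r} \<union> set I) \<longleftrightarrow> x \<in> set J \<union> {2*k-r+1..n}" for x
  proof -
    have "x \<in> {r+1..2*k-r} \<longleftrightarrow> x \<in> set I \<or> x \<in> set J" using assms(6) by blast
    moreover have "x \<in> set I \<Longrightarrow> x \<notin> set J" using assms(5) by blast
    ultimately show ?thesis using kn r_le_k by auto
  qed
  then have eq: "{1..n} - set ([1..<r+1] @ I) = set ?C" unfolding setC setI by blast
  have "sorted ?C" "distinct ?C" using sorted unfolding strict_sorted_iff by blast+
  then show "complement_list n ([1..<r+1] @ I) = ?C"
    unfolding complement_list_def eq by (rule sorted_list_of_set.idem_if_sorted_distinct)
qed

lemma mixed_rel_sound:
  assumes "(x, y) \<in> mixed_rel k r"
  shows "x \<in> vars \<and> y \<in> vars \<and> bracket_le x y"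
proof -
  obtain I J where xy: "x = Square ([1..<r+1] @ I)" "y = Angle ([1..<r+1] @ J)"
    and IJ: "length I = k - r" "sorted_wrt (<) I" "length J = k - r" "sorted_wrt (<) J"
    "set I \<inter> set J = {}" "set I \<union> set J = {r+1..2*k-r}"
    using assms unfolding mixed_rel_def by blast
  note m = mixed_relD[OF IJ]
  have "bracket_le x y"
    unfolding xy bracket_le_mixed m(3) using IJ(3) by (simp add: nth_append del: upt_Suc)
  then show ?thesis using m by (simp add: xy bracket_vars_def)
qed

text \<open>The mixed relation inserted between the two brackets uses the column with entries \<open>max (K ! b) (r + 1 +
b)\<close>, where \<open>K\<close> is the complement of \<open>J0\<close>. This is the least column above
\<open>K\<close> that can follow \<open>1, ..., r\<close>, and it stays within \<open>r + 1, ..., 2 k -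
r\<close> because \<open>K ! b \<le> k + b + 1\<close>.\<close>

lemma bracket_le_mixed_through:
  assumes x: "Square J0 \<in> vars" and y: "Angle I0 \<in> vars" and le: "bracket_le (Square J0) (Angle I0)"
  obtains z w where "(Square J0, z) \<in> square_rel k n" "(z, w) \<in> mixed_rel k r" "(w, Angle I0) \<in> angle_rel k n"
proof -
  \<comment> \<open>\<open>J\<close> and \<open>I\<close> are the two blocks of the ordered set partition in the mixed relation.\<close>
  define K where "K = complement_list n J0"
  have J0: "J0 \<in> plucker_indices k n" and I0: "I0 \<in> plucker_indices k n" using x y by (auto simp: bracket_vars_def)
  have K: "K \<in> plucker_indices (n - k) n" unfolding K_def using J0 by (rule complement_list_in_plucker)
  have Kup: "K ! b \<le> k + b + 1" if "b < n - k" for b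
    using plucker_nth_bounds(2)[OF K that] that bounds by simp
  have kr: "k - r \<le> n - k" using dim_bound r_le_k by simp
  define J where "J = map (\<lambda>b. max (K ! b) (r + 1 + b)) [0..<k - r]"
  have J: "length J = k - r" "sorted_wrt (<) J" "set J \<subseteq> {r+1..2*k-r}"
  proof -
    show "length J = k - r" by (simp add: J_def)
    have "K ! a < K ! b" if "a < b" "b < k - r" for a b
      using plucker_nth_less[OF K that(1)] that kr by simp
    then show "sorted_wrt (<) J"
      unfolding sorted_wrt_iff_nth_less J_def by (fastforce simp: max_def)
    show "set J \<subseteq> {r+1..2*k-r}"
    proof
      fix j assume "j \<in> set J"
      then obtain b where b: "b < k - r" "j = max (K ! b) (r + 1 + b)" by (auto simp: J_def)
      then show "j \<in> {r+1..2*k-r}" using Kup[of b] kr r_le_k by auto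
    qed
  qed
  define I where "I = sorted_list_of_set ({r+1..2*k-r} - set J)"
  have "card (set J) = k - r" using J by (simp add: strict_sorted_iff distinct_card)
  then have "length I = k - r" using J(3) r_le_k by (simp add: I_def card_Diff_subset)
  moreover have "sorted_wrt (<) I" by (simp add: I_def)
  moreover have "set I \<inter> set J = {}" "set I \<union> set J = {r+1..2*k-r}" using J(3) by (auto simp: I_def)
  ultimately have IJ: "length I = k - r" "sorted_wrt (<) I" "length J = k - r" "sorted_wrt (<) J"
    "set I \<inter> set J = {}" "set I \<union> set J = {r+1..2*k-r}" using J by auto
  note m = mixed_relD[OF IJ]
  let ?z = "Square ([1..<r+1] @ I)" and ?w = "Angle ([1..<r+1] @ J)"
  have "(?z, ?w) \<in> mixed_rel k r" using IJ unfolding mixed_rel_def by blast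
  moreover have "bracket_le (Square J0) ?z"
    unfolding bracket_le_Square m(3) K_def[symmetric]
  proof (intro allI impI)
    fix a assume a: "a < n - k"
    show "K ! a \<le> (J @ [2 * k - r + 1..<n + 1]) ! a"
    proof (cases "a < k - r")
      case True
      then show ?thesis by (simp add: nth_append J_def)
    next
      case False
      then have "(J @ [2 * k - r + 1..<n + 1]) ! a = k + a + 1"
        using a r_le_k dim_bound by (simp add: nth_append J(1) del: upt_Suc)
      then show ?thesis using Kup[OF a] by simp
    qed
  qed
  then have "(Square J0, ?z) \<in> square_rel k n" using x m(1) by (simp add: square_rel_iff bracket_vars_def)
  moreover have "bracket_le ?w (Angle I0)"
    unfolding bracket_le_Angle
  proof (intro allI impI)
    fix a assume a: "a < k"
    have low: "a + 1 \<le> I0 ! a" by (rule plucker_nth_bounds(1)[OF I0 a])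
    show "([1..<r+1] @ J) ! a \<le> I0 ! a"
    proof (cases "a < r")
      case True
      then show ?thesis using low by (simp add: nth_append del: upt_Suc)
    next
      case False
      then have "K ! (a - r) \<le> I0 ! a"
        using le[unfolded bracket_le_mixed, rule_format, of "a - r"] a by (simp add: K_def)
      moreover have "a - r < k - r" using False a by simp
      ultimately show ?thesis using False a low by (simp add: nth_append J_def del: upt_Suc)
    qed
  qed
  then have "(?w, Angle I0) \<in> angle_rel k n" using y m(2) by (simp add: angle_rel_iff bracket_vars_def)
  ultimately show ?thesis using that by blast
qed

text \<open>The tableau order contains the three defining relations and is transitive. Conversely, a pair of brackets of the
same kind is one step, and a square bracket below an angle bracket is three steps.\<close>

theorem bracket_poset_iff: "(x, y) \<in> bracket_poset k n r \<longleftrightarrow> x \<in> vars \<and> y \<in> vars \<and> bracket_le x y"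
proof
  assume "(x, y) \<in> bracket_poset k n r"
  then show "x \<in> vars \<and> y \<in> vars \<and> bracket_le x y"
    unfolding bracket_poset_def
  proof (induction rule: trancl_induct)
    case (base y)
    then show ?case using angle_rel_iff square_rel_iff mixed_rel_sound by blast
  next
    case (step y z)
    then show ?case using angle_rel_iff square_rel_iff mixed_rel_sound bracket_le_trans by blast
  qed
next
  assume a: "x \<in> vars \<and> y \<in> vars \<and> bracket_le x y"
  let ?R = "angle_rel k n \<union> square_rel k n \<union> mixed_rel k r"
  have "is_angle x \<longrightarrow> is_angle y" using a by (simp add: bracket_le_def)
  then consider "is_angle x" "is_angle y" | "\<not> is_angle x" "\<not> is_angle y" | "\<not> is_angle x" "is_angle y" by blast
  then show "(x, y) \<in> bracket_poset k n r"
  proof cases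
    case 1
    then have "(x, y) \<in> ?R" using a angle_rel_iff by blast
    then show ?thesis unfolding bracket_poset_def by (rule r_into_trancl)
  next
    case 2
    then have "(x, y) \<in> ?R" using a square_rel_iff by blast
    then show ?thesis unfolding bracket_poset_def by (rule r_into_trancl)
  next
    case 3
    obtain J I where "x = Square J" "y = Angle I" using 3 by (cases x; cases y) auto
    then obtain z w where "(x, z) \<in> ?R" "(z, w) \<in> ?R" "(w, y) \<in> ?R"
      using bracket_le_mixed_through[of J I] a by blast
    then show ?thesis unfolding bracket_poset_def by (meson trancl.intros)
  qed
qed

end

section \<open>Reverse lexicographic term orders\<close>

lemma revlex_less_irrefl: "\<not> revlex_less L a a"
  by (auto simp: revlex_less_def)

lemma revlex_less_add: "revlex_less L a b \<Longrightarrow> revlex_less L (a + c) (b + c)"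
  by (auto simp: revlex_less_def monomial_degree_add lookup_add)

lemma revlex_less_degree: "revlex_less L a b \<Longrightarrow> monomial_degree a \<le> monomial_degree b"
  by (auto simp: revlex_less_def)

lemma linear_orderD:
  assumes "linear_order_on V L"
  shows "Field L = V" "trans L" "antisym L" "x \<in> V \<Longrightarrow> y \<in> V \<Longrightarrow> (x, y) \<in> L \<or> (y, x) \<in> L"
proof -
  have L: "L \<subseteq> V \<times> V" "refl_on V L" "total_on V L" and tr: "trans L" "antisym L"
    using assms by (simp_all add: linear_order_on_def partial_order_on_def preorder_on_def)
  show "trans L" "antisym L" by fact+
  show "Field L = V" using L(1,2) by (auto simp: Field_def refl_on_def)
  show "(x, y) \<in> L \<or> (y, x) \<in> L" if "x \<in> V" "y \<in> V"
  proof (cases "x = y")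
    case True
    then show ?thesis using refl_onD[OF L(2)] that by blast
  next
    case False
    then show ?thesis using L(3) that by (simp add: total_on_def)
  qed
qed

lemma revlex_less_trans:
  assumes L: "linear_order_on V L" and ab: "revlex_less L a b" and bc: "revlex_less L b c"
  shows "revlex_less L a c"
proof (cases "monomial_degree a = monomial_degree b \<and> monomial_degree b = monomial_degree c")
  case False
  then show ?thesis using ab bc by (auto simp: revlex_less_def)
next
  case True
  note Ld = linear_orderD[OF L]
  obtain x where x: "x \<in> Field L" "lookup b x < lookup a x"
    and xl: "\<And>v. v \<noteq> x \<Longrightarrow> (v, x) \<in> L \<Longrightarrow> lookup a v = lookup b v"
    using ab True unfolding revlex_less_def by auto
  obtain y where y: "y \<in> Field L" "lookup c y < lookup b y"
    and yl: "\<And>v. v \<noteq> y \<Longrightarrow> (v, y) \<in> L \<Longrightarrow> lookup b v = lookup c v"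
    using bc True unfolding revlex_less_def by auto
  have "\<exists>z\<in>Field L. lookup c z < lookup a z \<and>
      (\<forall>v. v \<noteq> z \<and> (v, z) \<in> L \<longrightarrow> lookup a v = lookup c v)"
  proof (cases "x = y")
    case True
    then show ?thesis using x y xl yl by (intro bexI[of _ x]) auto
  next
    case ne: False
    show ?thesis
    proof (cases "(x, y) \<in> L")
      case True
      have "lookup a v = lookup c v" if "v \<noteq> x" "(v, x) \<in> L" for v
      proof -
        have "(v, y) \<in> L" using that True Ld(2) by (meson transD)
        moreover have "v \<noteq> y" using that True ne Ld(3) by (meson antisymD)
        ultimately show ?thesis using xl[OF that] yl by simp
      qed
      then show ?thesis using x yl[OF ne True] by (intro bexI[of _ x]) auto
    next
      case False
      then have yx: "(y, x) \<in> L" using Ld(4)[of x y] Ld(1) x y by blast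
      have "lookup a v = lookup c v" if "v \<noteq> y" "(v, y) \<in> L" for v
      proof -
        have "(v, x) \<in> L" using that yx Ld(2) by (meson transD)
        moreover have "v \<noteq> x" using that yx ne Ld(3) by (meson antisymD)
        ultimately show ?thesis using yl[OF that] xl by simp
      qed
      then show ?thesis using y xl[OF ne[symmetric] yx] by (intro bexI[of _ y]) auto
    qed
  qed
  then show ?thesis using True by (simp add: revlex_less_def)
qed

lemma linear_order_least:
  assumes L: "linear_order_on V L" and "finite A" "A \<noteq> {}" "A \<subseteq> V"
  shows "\<exists>x\<in>A. \<forall>y\<in>A. (x, y) \<in> L"
  using assms(2-4)
proof (induction A rule: finite_ne_induct)
  case (singleton x)
  then show ?case using linear_orderD(4)[OF L, of x x] by blast
next
  case (insert a F)
  then obtain x where x: "x \<in> F" "\<forall>y\<in>F. (x, y) \<in> L" by blast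
  have aa: "(a, a) \<in> L" using linear_orderD(4)[OF L, of a a] insert.prems by blast
  show ?case
  proof (cases "(a, x) \<in> L")
    case True
    then have "\<forall>y\<in>F. (a, y) \<in> L" using x linear_orderD(2)[OF L] by (meson transD)
    then show ?thesis using aa by blast
  next
    case False
    then have "(x, a) \<in> L" using linear_orderD(4)[OF L, of a x] insert.prems x by blast
    then show ?thesis using x by blast
  qed
qed

lemma revlex_less_total:
  assumes L: "linear_order_on V L" and V: "finite V"
    and a: "keys a \<subseteq> V" and b: "keys b \<subseteq> V" and "a \<noteq> b"
  shows "revlex_less L a b \<or> revlex_less L b a"
proof (cases "monomial_degree a = monomial_degree b")
  case False
  then show ?thesis by (auto simp: revlex_less_def)
next
  case True
  define D where "D = {v \<in> V. lookup a v \<noteq> lookup b v}"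
  obtain v where "lookup a v \<noteq> lookup b v"
    using \<open>a \<noteq> b\<close> poly_mapping_eqI by metis
  then have out: "v \<in> keys a \<union> keys b" by (auto simp: in_keys_iff)
  with \<open>lookup a v \<noteq> lookup b v\<close> a b have "v \<in> D" by (auto simp: D_def)
  then obtain x where x: "x \<in> D" "\<forall>y\<in>D. (x, y) \<in> L"
    using linear_order_least[OF L, of D] V by (auto simp: D_def)
  have same: "lookup a w = lookup b w" if w: "w \<noteq> x" "(w, x) \<in> L" for w
  proof (rule ccontr)
    assume "\<not> ?thesis"
    moreover have "w \<in> V" using w(2) linear_orderD(1)[OF L] by (auto simp: Field_def)
    ultimately have "(x, w) \<in> L" using x(2) by (simp add: D_def)
    then show False using w linear_orderD(3)[OF L] by (meson antisymD)
  qed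
  have xF: "x \<in> Field L" using x(1) linear_orderD(1)[OF L] by (simp add: D_def)
  have "lookup a x < lookup b x \<or> lookup b x < lookup a x"
    using x(1) by (auto simp: D_def)
  then show ?thesis
  proof
    assume "lookup a x < lookup b x"
    then have "revlex_less L b a" using True xF same unfolding revlex_less_def by auto
    then show ?thesis ..
  next
    assume "lookup b x < lookup a x"
    then have "revlex_less L a b" using True xF same unfolding revlex_less_def by auto
    then show ?thesis ..
  qed
qed

lemma finite_monomials:
  assumes "finite V"
  shows "finite {m :: monomial. keys m \<subseteq> V \<and> monomial_degree m \<le> d}" (is "finite ?M")
proof -
  let ?f = "\<lambda>m. restrict (lookup m) V"
  have "inj_on ?f ?M"
  proof (rule inj_onI)
    fix a b assume ab: "a \<in> ?M" "b \<in> ?M" "?f a = ?f b"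
    show "a = b"
    proof (rule poly_mapping_eqI)
      fix v show "lookup a v = lookup b v"
      proof (cases "v \<in> V")
        case True
        then show ?thesis using fun_cong[OF ab(3), of v] by simp
      next
        case False
        then have "v \<notin> keys a" "v \<notin> keys b" using ab by auto
        then show ?thesis by (simp add: in_keys_iff)
      qed
    qed
  qed
  moreover have "?f ` ?M \<subseteq> V \<rightarrow>\<^sub>E {..d}"
  proof (rule image_subsetI)
    fix m assume m: "m \<in> ?M"
    have "lookup m v \<le> d" if "v \<in> V" for v
    proof -
      have "lookup m v \<le> (\<Sum>x\<in>V. lookup m x)"
        using assms that by (intro member_le_sum) auto
      then show ?thesis using m monomial_degree_superset[OF assms, of m] by auto
    qed
    then show "?f m \<in> V \<rightarrow>\<^sub>E {..d}" by auto
  qed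
  moreover have "finite (V \<rightarrow>\<^sub>E {..d})" using assms by (intro finite_PiE) auto
  ultimately show ?thesis by (meson finite_imageD finite_subset)
qed

lemma leading_monomial_eqI:
  assumes L: "linear_order_on V L" and "m \<in> keys p"
    "\<And>m'. m' \<in> keys p \<Longrightarrow> m' \<noteq> m \<Longrightarrow> revlex_less L m' m"
  shows "leading_monomial L p = m"
  unfolding leading_monomial_def
proof (rule the_equality)
  fix m'
  assume m': "m' \<in> keys p \<and> (\<forall>m''\<in>keys p. m'' \<noteq> m' \<longrightarrow> revlex_less L m'' m')"
  show "m' = m"
  proof (rule ccontr)
    assume "m' \<noteq> m"
    then have "revlex_less L m' m" "revlex_less L m m'" using assms(2,3) m' by metis+
    then show False using revlex_less_trans[OF L] revlex_less_irrefl by blast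
  qed
qed (use assms in auto)

lemma leading_monomial_props:
  assumes L: "linear_order_on V L" and V: "finite V" and "p \<noteq> 0"
    and p: "\<And>m. m \<in> keys p \<Longrightarrow> keys m \<subseteq> V"
  shows "leading_monomial L p \<in> keys p"
    "m \<in> keys p \<Longrightarrow> m \<noteq> leading_monomial L p \<Longrightarrow> revlex_less L m (leading_monomial L p)"
proof -
  have "\<exists>m\<in>A. \<forall>m'\<in>A. m' \<noteq> m \<longrightarrow> revlex_less L m' m"
    if "finite A" "A \<noteq> {}" "\<And>m. m \<in> A \<Longrightarrow> keys m \<subseteq> V" for A
    using that
  proof (induction A rule: finite_ne_induct)
    case (insert a F)
    then obtain m where m: "m \<in> F" "\<forall>m'\<in>F. m' \<noteq> m \<longrightarrow> revlex_less L m' m" by blast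
    have "a \<noteq> m" using m(1) insert.hyps by blast
    then have "revlex_less L a m \<or> revlex_less L m a"
      using revlex_less_total[OF L V] insert.prems m(1) by blast
    then show ?case
    proof
      assume "revlex_less L a m"
      then show ?thesis using m by blast
    next
      assume ma: "revlex_less L m a"
      have "revlex_less L m' a" if "m' \<in> F" for m'
        using m(2) that ma revlex_less_trans[OF L] by (cases "m' = m") blast+
      then show ?thesis by blast
    qed
  qed simp
  then have "\<exists>m\<in>keys p. \<forall>m'\<in>keys p. m' \<noteq> m \<longrightarrow> revlex_less L m' m"
    using p \<open>p \<noteq> 0\<close> by simp
  then obtain m where m: "m \<in> keys p" "\<forall>m'\<in>keys p. m' \<noteq> m \<longrightarrow> revlex_less L m' m"
    by blast
  then have "leading_monomial L p = m" using leading_monomial_eqI[OF L] by blast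
  then show "leading_monomial L p \<in> keys p"
    "m' \<in> keys p \<Longrightarrow> m' \<noteq> leading_monomial L p \<Longrightarrow> revlex_less L m' (leading_monomial L p)" for m'
    using m by auto
qed

section \<open>The Groebner basis of straightening laws\<close>

context spinor_helicity_parameters
begin

abbreviation R where "R \<equiv> bracket_ring k n"

definition vanishing_ideal :: "bracket_poly set" where
  "vanishing_ideal = {p \<in> carrier R. \<forall>P. eval_bracket_poly (coords P) p = 0}"

lemma vanishing_ideal: "ideal vanishing_ideal R"
  by (rule bracket_idealI)
    (auto simp: vanishing_ideal_def eval_add eval_mult intro: bracket_ring_closed)

text \<open>All parameters together form a linear set, so a product cannot vanish on it without one of its factors doing
so.\<close>

lemma vanishing_ideal_prime: "primeideal vanishing_ideal R"
proof (rule primeidealI)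
  show "ideal vanishing_ideal R" by (rule vanishing_ideal)
  show "cring R" by (rule bracket_ring_cring)
  have "1 \<notin> vanishing_ideal" by (simp add: vanishing_ideal_def)
  then show "carrier R \<noteq> vanishing_ideal" using bracket_ring_closed(2) by blast
  fix p q assume p: "p \<in> carrier R" and q: "q \<in> carrier R" and pq: "p \<otimes>\<^bsub>R\<^esub> q \<in> vanishing_ideal"
  show "p \<in> vanishing_ideal \<or> q \<in> vanishing_ideal"
  proof (rule ccontr)
    assume "\<not> ?thesis"
    then obtain P Q where P: "eval_bracket_poly (coords P) p \<noteq> 0" and Q: "eval_bracket_poly (coords Q) q \<noteq> 0"
      using p q by (auto simp: vanishing_ideal_def)
    have "eval_bracket_poly (coords Q) q = 0"
      by (rule product_vanishes_on_linear_set[of UNIV p q P])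
        (use pq P in \<open>auto simp: vanishing_ideal_def eval_mult\<close>)
    with Q show False by simp
  qed
qed

text \<open>The products of incomparable pairs, which will turn out to generate the initial ideal.\<close>

definition obstructions :: "monomial set" where
  "obstructions = {var_pair x y | x y. x \<in> vars \<and> y \<in> vars \<and> \<not> bracket_le x y \<and> \<not> bracket_le y x}"

lemma finite_obstructions: "finite obstructions"
  by (rule finite_subset[of _ "(\<lambda>(x, y). var_pair x y) ` (vars \<times> vars)"])
    (auto simp: obstructions_def finite_vars)

lemma poly_of_monomial_add: "poly_of_monomial (a + b) = poly_of_monomial a * poly_of_monomial b"
  by (simp add: poly_of_monomial_def mult_single)

lemma incomparable_products_eq: "incomparable_products k n r = poly_of_monomial ` obstructions"
proof -
  have "poly_of_var x * poly_of_var y = poly_of_monomial (var_pair x y)" for x y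
    by (simp add: poly_of_var_def var_pair_def poly_of_monomial_add)
  moreover have "x \<in> vars \<and> y \<in> vars \<and> (x, y) \<notin> bracket_poset k n r \<and> (y, x) \<notin> bracket_poset k n r \<longleftrightarrow>
      x \<in> vars \<and> y \<in> vars \<and> \<not> bracket_le x y \<and> \<not> bracket_le y x" for x y
    using bracket_poset_iff by blast
  ultimately show ?thesis
    unfolding incomparable_products_def obstructions_def by (auto simp: image_iff; metis)
qed

lemma obstruction_keys: "\<mu> \<in> obstructions \<Longrightarrow> keys \<mu> \<subseteq> vars"
  by (auto simp: obstructions_def)

lemma obstruction_degree: "\<mu> \<in> obstructions \<Longrightarrow> monomial_degree \<mu> = 2"
  by (auto simp: obstructions_def)

lemma obstruction_not_standard: "\<mu> \<in> obstructions \<Longrightarrow> \<not> standard \<mu>"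
  by (auto simp: obstructions_def standard_def)

lemma nonstandard_obtain:
  assumes "keys m \<subseteq> vars" "\<not> standard m"
  obtains \<mu> m' where "\<mu> \<in> obstructions" "m = \<mu> + m'" "keys m' \<subseteq> vars"
proof -
  obtain x y where xy: "x \<in> keys m" "y \<in> keys m" "\<not> bracket_le x y" "\<not> bracket_le y x"
    using assms by (auto simp: standard_def)
  then have ne: "y \<noteq> x" using bracket_le_refl by blast
  let ?m1 = "m - single x 1"
  let ?m2 = "?m1 - single y 1"
  have "y \<in> keys ?m1"
    using xy(2) ne by (simp add: in_keys_iff lookup_minus lookup_single when_def)
  then have "m = var_pair x y + ?m2"
    unfolding var_pair_def add.assoc monomial_split_var[OF \<open>y \<in> keys ?m1\<close>]
    by (simp only: monomial_split_var[OF xy(1)])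
  moreover have "keys ?m2 \<subseteq> keys m"
    by (auto simp: in_keys_iff lookup_minus)
  moreover have "var_pair x y \<in> obstructions"
    using xy assms(1) by (auto simp: obstructions_def)
  ultimately show ?thesis using that assms(1) by blast
qed

text \<open>The smaller factor \<open>z\<close> of every other term lies below all variables of \<open>\<mu>\<close>. This
is what makes \<open>\<mu>\<close> the leading monomial for all linear extensions at once.\<close>

definition is_straightening_of :: "monomial \<Rightarrow> bracket_poly \<Rightarrow> bool" where
  "is_straightening_of \<mu> q \<longleftrightarrow> q \<in> vanishing_ideal \<and> lookup q \<mu> = 1 \<and>
     (\<forall>m\<in>keys q - {\<mu>}. \<exists>z w. m = var_pair z w \<and> (z, w) \<in> comparable_pairs \<and>
        (\<forall>v\<in>keys \<mu>. bracket_le z v))"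

lemma straightening_exists:
  assumes "\<mu> \<in> obstructions"
  shows "\<exists>q. is_straightening_of \<mu> q"
proof -
  obtain x y where xy: "\<mu> = var_pair x y" "x \<in> vars" "y \<in> vars" "\<not> bracket_le x y" "\<not> bracket_le y x"
    using assms by (auto simp: obstructions_def)
  obtain c where c: "\<And>P. coords P x * coords P y = (\<Sum>(z, w)\<in>comparable_pairs. c z w * (coords P z * coords P w))"
    and le: "\<And>z w. (z, w) \<in> comparable_pairs \<Longrightarrow> c z w \<noteq> 0 \<Longrightarrow> bracket_le z x \<and> bracket_le z y"
    using quadratic_straightening[OF xy(2-5)] by blast
  define s :: bracket_poly where
    "s = (\<Sum>p\<in>comparable_pairs. single (var_pair (fst p) (snd p)) (c (fst p) (snd p)))"
  define q where "q = single \<mu> 1 - s"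
  have keys_s: "\<exists>z w. m = var_pair z w \<and> (z, w) \<in> comparable_pairs \<and> c z w \<noteq> 0" if m: "m \<in> keys s" for m
  proof -
    obtain p where p: "p \<in> comparable_pairs"
      "m \<in> keys (single (var_pair (fst p) (snd p)) (c (fst p) (snd p)))"
      using m keys_sum_subset unfolding s_def by blast
    then show ?thesis
      by (intro exI[of _ "fst p"] exI[of _ "snd p"]) (auto split: if_splits)
  qed
  have \<mu>s: "\<mu> \<notin> keys s"
  proof
    assume "\<mu> \<in> keys s"
    then obtain z w where "\<mu> = var_pair z w" "(z, w) \<in> comparable_pairs" using keys_s by blast
    then have "standard \<mu>" by (auto simp: comparable_pairs_def standard_def bracket_le_refl)
    then show False using obstruction_not_standard[OF assms] by blast
  qed
  have "is_straightening_of \<mu> q"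
    unfolding is_straightening_of_def
  proof (intro conjI ballI)
    have "s \<in> carrier R" unfolding s_def
      by (intro bracket_ring_sum_closed single_in_carrier) (auto simp: comparable_pairs_def)
    then have "q \<in> carrier R" unfolding q_def
      using obstruction_keys[OF assms] by (intro bracket_ring_closed(6) single_in_carrier)
    moreover have "eval_bracket_poly (coords P) q = 0" for P
      by (simp add: q_def s_def eval_diff eval_sum xy(1) c case_prod_unfold)
    ultimately show "q \<in> vanishing_ideal" by (simp add: vanishing_ideal_def)
    show "lookup q \<mu> = 1" using \<mu>s by (simp add: q_def lookup_minus in_keys_iff)
    fix m assume m: "m \<in> keys q - {\<mu>}"
    then have "m \<in> keys s" by (auto simp: q_def in_keys_iff lookup_minus lookup_single when_def)
    then obtain z w where zw: "m = var_pair z w" "(z, w) \<in> comparable_pairs" "c z w \<noteq> 0" using keys_s by blast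
    then show "\<exists>z w. m = var_pair z w \<and> (z, w) \<in> comparable_pairs \<and> (\<forall>v\<in>keys \<mu>. bracket_le z v)"
      using le[OF zw(2,3)] xy(1) by auto
  qed
  then show ?thesis by blast
qed

text \<open>Indexed by the monomial and not by the pair of variables, so that \<open>(x, y)\<close> and \<open>(y,
x)\<close> give the same law. Otherwise the laws might fail to be a minimal generating set.\<close>

definition straightening_law :: "monomial \<Rightarrow> bracket_poly" where
  "straightening_law \<mu> = (SOME q. is_straightening_of \<mu> q)"

lemma straightening_law: "\<mu> \<in> obstructions \<Longrightarrow> is_straightening_of \<mu> (straightening_law \<mu>)"
  unfolding straightening_law_def using straightening_exists by (rule someI_ex)

definition straightening_laws :: "bracket_poly set" where
  "straightening_laws = straightening_law ` obstructions"

lemma straightening_law_tail: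
  assumes "\<mu> \<in> obstructions" "m \<in> keys (straightening_law \<mu>)" "m \<noteq> \<mu>"
  obtains z w where "m = var_pair z w" "(z, w) \<in> comparable_pairs" "\<And>v. v \<in> keys \<mu> \<Longrightarrow> bracket_le z v"
  using straightening_law[OF assms(1)] assms(2,3) unfolding is_straightening_of_def by blast

lemma straightening_law_tail_standard:
  assumes "\<mu> \<in> obstructions" "m \<in> keys (straightening_law \<mu>)" "m \<noteq> \<mu>"
  shows "standard m"
proof -
  obtain z w where "m = var_pair z w" "(z, w) \<in> comparable_pairs" using straightening_law_tail[OF assms] by blast
  then show ?thesis by (auto simp: comparable_pairs_def standard_def bracket_le_refl)
qed

lemma straightening_law_degree:
  assumes "\<mu> \<in> obstructions" "m \<in> keys (straightening_law \<mu>)"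
  shows "monomial_degree m = 2"
  using straightening_law_tail[OF assms] obstruction_degree[OF assms(1)]
  by (metis monomial_degree_var_pair)

lemma straightening_laws_in_vanishing_ideal: "straightening_laws \<subseteq> vanishing_ideal"
  using straightening_law by (auto simp: straightening_laws_def is_straightening_of_def)

lemma straightening_laws_in_carrier: "straightening_laws \<subseteq> carrier R"
  using straightening_laws_in_vanishing_ideal by (auto simp: vanishing_ideal_def)

lemma linear_extension_bracket_le:
  assumes "linear_extension k n r L" "x \<in> vars" "y \<in> vars" "bracket_le x y"
  shows "(x, y) \<in> L"
  using assms bracket_poset_iff by (auto simp: linear_extension_def)

text \<open>The smaller factor \<open>z\<close> of a tail monomial lies strictly below \<open>x\<close> and \<open>y\<close>
in every linear extension. So \<open>z\<close> is the least variable in which the two monomials differ, and it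
divides only the tail monomial.\<close>

lemma tail_revlex_less:
  assumes L: "linear_extension k n r L"
    and \<mu>: "\<mu> \<in> obstructions" and m: "m \<in> keys (straightening_law \<mu>)" "m \<noteq> \<mu>"
  shows "revlex_less L m \<mu>"
proof -
  have lin: "linear_order_on vars L" using L by (simp add: linear_extension_def)
  obtain x y where xy: "\<mu> = var_pair x y" "x \<in> vars" "y \<in> vars" "\<not> bracket_le x y" "\<not> bracket_le y x"
    using \<mu> by (auto simp: obstructions_def)
  obtain z w where zw: "m = var_pair z w" "(z, w) \<in> comparable_pairs" and z: "\<And>v. v \<in> {x, y} \<Longrightarrow> bracket_le z v"
    using straightening_law_tail[OF \<mu> m] xy(1) by auto
  have zv: "z \<in> vars" "w \<in> vars" "bracket_le z w" using zw(2) by (auto simp: comparable_pairs_def)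
  have zne: "z \<noteq> x" "z \<noteq> y" using z xy by auto
  have zL: "(z, v) \<in> L" if "v \<in> {x, y, w}" for v
    using that z zv xy linear_extension_bracket_le[OF L] by blast
  have "lookup \<mu> z < lookup m z"
    using zne by (simp add: xy(1) zw(1) var_pair_def lookup_add lookup_single when_def)
  moreover have "lookup m v = lookup \<mu> v" if v: "v \<noteq> z" "(v, z) \<in> L" for v
  proof -
    have "v \<notin> {x, y, w}" using v zL[of v] linear_orderD(3)[OF lin] by (meson antisymD)
    then show ?thesis using v by (auto simp: xy(1) zw(1) var_pair_def lookup_add lookup_single when_def)
  qed
  moreover have "z \<in> Field L" using zv linear_orderD(1)[OF lin] by simp
  ultimately show ?thesis by (auto simp: revlex_less_def xy(1) zw(1))
qed

text \<open>Rewriting an incomparable product inside a monomial by its straightening law yields smaller monomials. Only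
finitely many monomials lie below a given one, so the rewriting ends.\<close>

lemma normal_form_monomial:
  assumes L: "linear_extension k n r L" and "keys m \<subseteq> vars"
  shows "\<exists>p. poly_of_monomial m - p \<in> genideal R straightening_laws \<and>
     (\<forall>m'\<in>keys p. standard m' \<and> (m' = m \<or> revlex_less L m' m))"
  using assms(2)
proof (induction "card {m'. keys m' \<subseteq> vars \<and> monomial_degree m' \<le> monomial_degree m \<and> revlex_less L m' m}"
    arbitrary: m rule: less_induct)
  case less
  have lin: "linear_order_on vars L" using L by (simp add: linear_extension_def)
  note G = bracket_genideal[OF straightening_laws_in_carrier]
  show ?case
  proof (cases "standard m")
    case True
    then show ?thesis using bracket_ideal_closed(1)[OF G(1)]
      by (intro exI[of _ "poly_of_monomial m"]) (auto simp: poly_of_monomial_def)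
  next
    case False
    then obtain \<mu> m0 where \<mu>: "\<mu> \<in> obstructions" and m: "m = \<mu> + m0" and m0: "keys m0 \<subseteq> vars"
      using nonstandard_obtain less.prems by blast
    let ?q = "straightening_law \<mu>"
    let ?T = "keys ?q - {\<mu>}"
    have q: "?q \<in> carrier R" "lookup ?q \<mu> = 1"
      using straightening_law[OF \<mu>] by (auto simp: is_straightening_of_def vanishing_ideal_def)
    have lower: "revlex_less L (a + m0) m" "keys (a + m0) \<subseteq> vars" if "a \<in> ?T" for a
      using that tail_revlex_less[OF L \<mu>] q(1) m0
      by (auto simp: m keys_add_nat bracket_ring_carrier_iff intro: revlex_less_add)
    have "\<exists>p. poly_of_monomial (a + m0) - p \<in> genideal R straightening_laws \<and>
       (\<forall>m'\<in>keys p. standard m' \<and> (m' = a + m0 \<or> revlex_less L m' (a + m0)))" if a: "a \<in> ?T" for a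
    proof (rule less.hyps[OF _ lower(2)[OF a]])
      let ?B = "\<lambda>m. {m'. keys m' \<subseteq> vars \<and> monomial_degree m' \<le> monomial_degree m \<and> revlex_less L m' m}"
      have fin: "finite (?B m)"
        by (rule finite_subset[OF _ finite_monomials[OF finite_vars]]) auto
      have "?B (a + m0) \<subseteq> ?B m"
        using lower(1)[OF a] revlex_less_trans[OF lin] revlex_less_degree by (auto intro: order_trans)
      moreover have "a + m0 \<in> ?B m" using lower[OF a] revlex_less_degree by blast
      moreover have "a + m0 \<notin> ?B (a + m0)" using revlex_less_irrefl by blast
      ultimately show "card (?B (a + m0)) < card (?B m)"
        by (intro psubset_card_mono[OF fin]) blast
    qed
    then have "\<forall>a\<in>?T. \<exists>p. poly_of_monomial (a + m0) - p \<in> genideal R straightening_laws \<and>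
       (\<forall>m'\<in>keys p. standard m' \<and> (m' = a + m0 \<or> revlex_less L m' (a + m0)))" by blast
    from bchoice[OF this] obtain f where f:
      "\<And>a. a \<in> ?T \<Longrightarrow> poly_of_monomial (a + m0) - f a \<in> genideal R straightening_laws"
      "\<And>a m'. a \<in> ?T \<Longrightarrow> m' \<in> keys (f a) \<Longrightarrow> standard m' \<and> (m' = a + m0 \<or> revlex_less L m' (a + m0))"
      by blast
    let ?c = "\<lambda>a. single 0 (lookup ?q a) :: bracket_poly"
    define p where "p = - (\<Sum>a\<in>?T. ?c a * f a)"
    have qexp: "?q = poly_of_monomial \<mu> + (\<Sum>a\<in>?T. ?c a * poly_of_monomial a)"
    proof -
      have "\<mu> \<in> keys ?q" using q(2) by (simp add: in_keys_iff)
      then have "(\<Sum>a\<in>keys ?q. single a (lookup ?q a)) =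
        single \<mu> (lookup ?q \<mu>) + (\<Sum>a\<in>?T. single a (lookup ?q a))"
        by (rule sum.remove[OF finite_keys])
      then show ?thesis
        by (simp add: poly_mapping_sum_singles q(2) poly_of_monomial_def mult_single)
    qed
    have "poly_of_monomial m - p =
        ?q * poly_of_monomial m0 - (\<Sum>a\<in>?T. (poly_of_monomial (a + m0) - f a) * ?c a)"
    proof -
      have "?q * poly_of_monomial m0 = poly_of_monomial m + (\<Sum>a\<in>?T. ?c a * poly_of_monomial (a + m0))"
        by (subst qexp) (simp add: m poly_of_monomial_add distrib_right sum_distrib_right mult.assoc)
      then show ?thesis
        by (simp add: p_def left_diff_distrib sum_subtractf mult.commute)
    qed
    moreover have "\<dots> \<in> genideal R straightening_laws"
    proof (rule bracket_ideal_closed(5)[OF G(1)])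
      have "?q \<in> genideal R straightening_laws" using G(2) \<mu> by (auto simp: straightening_laws_def)
      then show "?q * poly_of_monomial m0 \<in> genideal R straightening_laws"
        using m0 by (intro bracket_ideal_closed(3)[OF G(1)]) (simp_all add: poly_of_monomial_def single_in_carrier)
      show "(\<Sum>a\<in>?T. (poly_of_monomial (a + m0) - f a) * ?c a) \<in> genideal R straightening_laws"
        by (intro bracket_ideal_sum_closed[OF G(1)] bracket_ideal_closed(3)[OF G(1)] f(1) single_in_carrier) auto
    qed
    moreover have "standard m' \<and> (m' = m \<or> revlex_less L m' m)" if "m' \<in> keys p" for m'
    proof -
      have "m' \<in> keys (\<Sum>a\<in>?T. ?c a * f a)" using that by (simp add: p_def in_keys_iff)
      then obtain a where a: "a \<in> ?T" "m' \<in> keys (?c a * f a)" using keys_sum_subset by blast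
      then have "m' \<in> keys (f a)" using keys_scalar_mult by blast
      then show ?thesis using f(2)[OF a(1)] lower(1)[OF a(1)] revlex_less_trans[OF lin] by blast
    qed
    ultimately show ?thesis by (intro exI[of _ p]) auto
  qed
qed

lemma genideal_subset_vanishing_ideal: "genideal R straightening_laws \<subseteq> vanishing_ideal"
  by (rule bracket_genideal(3)[OF straightening_laws_in_carrier vanishing_ideal straightening_laws_in_vanishing_ideal])

lemma standard_in_vanishing_ideal:
  assumes "p \<in> vanishing_ideal" "\<And>m. m \<in> keys p \<Longrightarrow> standard m"
  shows "p = 0"
  using assms by (intro standard_poly_eq_0) (auto simp: vanishing_ideal_def)

lemma normal_form:
  assumes L: "linear_extension k n r L" and p: "p \<in> carrier R"
  shows "\<exists>h. p - h \<in> genideal R straightening_laws \<and>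
     (\<forall>m'\<in>keys h. standard m' \<and> (\<exists>m\<in>keys p. m' = m \<or> revlex_less L m' m))"
proof -
  note G = bracket_genideal[OF straightening_laws_in_carrier]
  have "\<forall>m\<in>keys p. \<exists>q. poly_of_monomial m - q \<in> genideal R straightening_laws \<and>
     (\<forall>m'\<in>keys q. standard m' \<and> (m' = m \<or> revlex_less L m' m))"
    using normal_form_monomial[OF L] p by (simp add: bracket_ring_carrier_iff)
  from bchoice[OF this] obtain f where f:
    "\<And>m. m \<in> keys p \<Longrightarrow> poly_of_monomial m - f m \<in> genideal R straightening_laws"
    "\<And>m m'. m \<in> keys p \<Longrightarrow> m' \<in> keys (f m) \<Longrightarrow>
       standard m' \<and> (m' = m \<or> revlex_less L m' m)"
    by blast
  let ?c = "\<lambda>m. single 0 (lookup p m) :: bracket_poly"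
  define h where "h = (\<Sum>m\<in>keys p. ?c m * f m)"
  have psum: "(\<Sum>m\<in>keys p. ?c m * poly_of_monomial m) = p"
    by (simp add: poly_of_monomial_def mult_single poly_mapping_sum_singles)
  have "(\<Sum>m\<in>keys p. (poly_of_monomial m - f m) * ?c m) =
      (\<Sum>m\<in>keys p. ?c m * poly_of_monomial m) - h"
    by (simp add: h_def left_diff_distrib sum_subtractf mult.commute)
  moreover have "(\<Sum>m\<in>keys p. (poly_of_monomial m - f m) * ?c m) \<in> genideal R straightening_laws"
    by (intro bracket_ideal_sum_closed[OF G(1)] bracket_ideal_closed(3)[OF G(1)] f(1) single_in_carrier) auto
  ultimately have "p - h \<in> genideal R straightening_laws" unfolding psum by simp
  moreover have "standard m' \<and> (\<exists>m\<in>keys p. m' = m \<or> revlex_less L m' m)"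
    if m': "m' \<in> keys h" for m'
  proof -
    obtain m where m: "m \<in> keys p" "m' \<in> keys (?c m * f m)"
      using m' keys_sum_subset unfolding h_def by blast
    then have "m' \<in> keys (f m)" using keys_scalar_mult by blast
    then show ?thesis using f(2)[OF m(1)] m(1) by blast
  qed
  ultimately show ?thesis by blast
qed

text \<open>Suppose that the leading monomial is standard, and replace the other terms by their normal forms. The result is
a combination of standard monomials in the ideal, hence zero, although the leading term cannot cancel against
the normal forms of smaller monomials.\<close>

lemma leading_monomial_not_standard:
  assumes L: "linear_extension k n r L" and p: "p \<in> vanishing_ideal" "p \<noteq> 0"
  shows "leading_monomial L p \<in> keys p" "\<not> standard (leading_monomial L p)"
proof -
  have lin: "linear_order_on vars L" using L by (simp add: linear_extension_def)
  have pc: "p \<in> carrier R" using p by (simp add: vanishing_ideal_def)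
  let ?m = "leading_monomial L p"
  have pk: "\<And>m. m \<in> keys p \<Longrightarrow> keys m \<subseteq> vars"
    using pc by (simp add: bracket_ring_carrier_iff)
  note lm = leading_monomial_props[OF lin finite_vars p(2) pk]
  show lm1: "?m \<in> keys p" using lm(1) .
  show "\<not> standard ?m"
  proof
    assume std: "standard ?m"
    let ?lt = "single ?m (lookup p ?m)"
    have keys_tail: "keys (p - ?lt) = keys p - {?m}"
      by (auto simp: in_keys_iff lookup_minus lookup_single when_def split: if_splits)
    have ltc: "?lt \<in> carrier R" using pk[OF lm1] by (rule single_in_carrier)
    obtain h where h: "(p - ?lt) - h \<in> genideal R straightening_laws"
      and hk: "\<And>m'. m' \<in> keys h \<Longrightarrow>
        standard m' \<and> (\<exists>m\<in>keys p - {?m}. m' = m \<or> revlex_less L m' m)"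
      using normal_form[OF L bracket_ring_closed(6)[OF pc ltc]] unfolding keys_tail by blast
    have "p - (?lt + h) \<in> vanishing_ideal"
      using h genideal_subset_vanishing_ideal by (auto simp: diff_diff_eq)
    then have "p - (p - (?lt + h)) \<in> vanishing_ideal"
      by (rule bracket_ideal_closed(5)[OF vanishing_ideal p(1)])
    then have "?lt + h \<in> vanishing_ideal" by simp
    moreover have "standard m'" if "m' \<in> keys (?lt + h)" for m'
      using that keys_add[of ?lt h] std hk by (auto split: if_splits)
    ultimately have "?lt + h = 0" by (rule standard_in_vanishing_ideal)
    moreover have "?m \<notin> keys h"
      using hk[of ?m] lm(2) revlex_less_trans[OF lin] revlex_less_irrefl by blast
    then have "lookup (?lt + h) ?m = lookup p ?m"
      by (simp add: lookup_add in_keys_iff)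
    ultimately show False using lm1 by (simp add: in_keys_iff)
  qed
qed

lemma genideal_straightening_laws:
  assumes L: "linear_extension k n r L"
  shows "genideal R straightening_laws = vanishing_ideal"
proof
  show "genideal R straightening_laws \<subseteq> vanishing_ideal" by (rule genideal_subset_vanishing_ideal)
  show "vanishing_ideal \<subseteq> genideal R straightening_laws"
  proof
    fix p assume p: "p \<in> vanishing_ideal"
    then have "p \<in> carrier R" by (simp add: vanishing_ideal_def)
    then obtain h where h: "p - h \<in> genideal R straightening_laws"
      and hk: "\<And>m'. m' \<in> keys h \<Longrightarrow> standard m'"
      using normal_form[OF L] by blast
    have "p - h \<in> vanishing_ideal" using h genideal_subset_vanishing_ideal by blast
    then have "p - (p - h) \<in> vanishing_ideal"
      by (rule bracket_ideal_closed(5)[OF vanishing_ideal p])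
    then have "h \<in> vanishing_ideal" by simp
    then have "h = 0" using hk by (rule standard_in_vanishing_ideal)
    then show "p \<in> genideal R straightening_laws" using h by simp
  qed
qed

text \<open>Maximal elements are split off one by one and numbered from above. Since normal forms are computed with a term
order, a linear extension is needed even to see that the straightening laws generate the ideal.\<close>

lemma linear_extension_exists: "\<exists>L. linear_extension k n r L"
proof -
  have ext: "\<exists>f :: bracket \<Rightarrow> nat. inj_on f A \<and> (\<forall>x\<in>A. \<forall>y\<in>A. bracket_le x y \<longrightarrow> f x \<le> f y)"
    if "finite A" "A \<subseteq> vars" for A
    using that
  proof (induction "card A" arbitrary: A)
    case 0
    then show ?case by simp
  next
    case (Suc d)
    then have "A \<noteq> {}" by auto
    then obtain m where m: "m \<in> A" "\<And>x. x \<in> A \<Longrightarrow> bracket_le m x \<Longrightarrow> x = m"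
      using exists_maximal[OF Suc.prems(1) \<open>A \<noteq> {}\<close> Suc.prems(2)] by auto
    have "d = card (A - {m})" using Suc.hyps(2) m(1) Suc.prems(1) by simp
    moreover have "finite (A - {m})" "A - {m} \<subseteq> vars" using Suc.prems by auto
    ultimately obtain f :: "bracket \<Rightarrow> nat" where f: "inj_on f (A - {m})"
      "\<And>x y. x \<in> A - {m} \<Longrightarrow> y \<in> A - {m} \<Longrightarrow> bracket_le x y \<Longrightarrow> f x \<le> f y"
      using Suc.hyps(1)[of "A - {m}"] by blast
    define t where "t = Suc (\<Sum>x\<in>A. f x)"
    have lt: "f x < t" if "x \<in> A" for x
      using member_le_sum[of x A f] that Suc.prems(1) by (simp add: t_def)
    let ?g = "f(m := t)"
    have "inj_on ?g A"
    proof (rule inj_onI)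
      fix x y assume xy: "x \<in> A" "y \<in> A" "?g x = ?g y"
      show "x = y"
        using xy lt[of x] lt[of y] inj_onD[OF f(1), of x y] by (auto split: if_splits)
    qed
    moreover have "?g x \<le> ?g y" if "x \<in> A" "y \<in> A" "bracket_le x y" for x y
      using that f(2)[of x y] lt[of x] m(2)[of y] by (cases "x = m"; cases "y = m") auto
    ultimately show ?case by blast
  qed
  obtain f :: "bracket \<Rightarrow> nat" where f: "inj_on f vars"
    "\<And>x y. x \<in> vars \<Longrightarrow> y \<in> vars \<Longrightarrow> bracket_le x y \<Longrightarrow> f x \<le> f y"
    using ext[OF finite_vars subset_refl] by blast
  define L where "L = {(x, y). x \<in> vars \<and> y \<in> vars \<and> f x \<le> f y}"
  have "linear_order_on vars L"
    unfolding linear_order_on_def partial_order_on_def preorder_on_def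
  proof (intro conjI)
    show "antisym L" using inj_onD[OF f(1)] by (auto simp: antisym_def L_def)
    show "trans L" by (auto simp: trans_def L_def)
  qed (auto simp: refl_on_def total_on_def L_def)
  moreover have "bracket_poset k n r \<subseteq> L" using f(2) by (auto simp: bracket_poset_iff L_def)
  ultimately show ?thesis by (auto simp: linear_extension_def)
qed

text \<open>The polynomials without terms of degree below 2 and without the monomial \<open>\<mu>\<close> form an ideal. It
contains all straightening laws except the one for \<open>\<mu>\<close>, because the other terms of a law are
standard.\<close>

lemma straightening_laws_minimal:
  assumes H: "H \<subset> straightening_laws"
  shows "genideal R H \<noteq> vanishing_ideal"
proof
  assume eq: "genideal R H = vanishing_ideal"
  obtain \<mu> where \<mu>: "\<mu> \<in> obstructions" "straightening_law \<mu> \<notin> H" using H by (auto simp: straightening_laws_def)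
  \<comment> \<open>The bound on the degree makes \<open>T\<close> an ideal: a multiple can contain \<open>\<mu>\<close> only through the constant term of the cofactor.\<close>
  define T where "T = {p \<in> carrier R. (\<forall>m\<in>keys p. 2 \<le> monomial_degree m) \<and> \<mu> \<notin> keys p}"
  have "ideal T R"
  proof (rule bracket_idealI)
    show "p + q \<in> T" if "p \<in> T" "q \<in> T" for p q
      using that keys_add[of p q] by (auto simp: T_def intro: bracket_ring_closed)
    show "p * q \<in> T" if p: "p \<in> T" and q: "q \<in> carrier R" for p q
    proof -
      have "2 \<le> monomial_degree m \<and> m \<noteq> \<mu>" if mpq: "m \<in> keys (p * q)" for m
      proof -
        obtain a b where ab: "m = a + b" "a \<in> keys p" using mpq keys_mult[of p q] by blast
        have a2: "2 \<le> monomial_degree a" and a\<mu>: "a \<noteq> \<mu>" using ab p by (auto simp: T_def)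
        have "m \<noteq> \<mu>"
        proof
          assume "m = \<mu>"
          then have "monomial_degree a + monomial_degree b = 2"
            using obstruction_degree[OF \<mu>(1)] ab(1) monomial_degree_add by metis
          then have "b = 0" using a2 monomial_degree_eq_0_iff[of b] by simp
          then show False using ab(1) a\<mu> \<open>m = \<mu>\<close> by simp
        qed
        then show ?thesis using a2 ab(1) by (simp add: monomial_degree_add)
      qed
      then show ?thesis using p q by (auto simp: T_def intro: bracket_ring_closed)
    qed
  qed (auto simp: T_def intro: bracket_ring_closed)
  moreover have "H \<subseteq> T"
  proof
    fix h assume h: "h \<in> H"
    then obtain \<nu> where \<nu>: "\<nu> \<in> obstructions" "h = straightening_law \<nu>"
      using H by (auto simp: straightening_laws_def)
    have "\<mu> \<notin> keys h"
      using straightening_law_tail_standard[OF \<nu>(1), of \<mu>] obstruction_not_standard[OF \<mu>(1)] \<mu>(2) h \<nu>(2) by blast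
    moreover have "h \<in> carrier R" using h H straightening_laws_in_carrier by blast
    ultimately show "h \<in> T" using straightening_law_degree[OF \<nu>(1)] \<nu>(2) by (simp add: T_def)
  qed
  ultimately have "genideal R H \<subseteq> T"
    using bracket_genideal(3) H straightening_laws_in_carrier by blast
  moreover have "straightening_law \<mu> \<in> genideal R H"
    unfolding eq using straightening_laws_in_vanishing_ideal \<mu>(1) by (auto simp: straightening_laws_def)
  moreover have "straightening_law \<mu> \<notin> T"
    using straightening_law[OF \<mu>(1)] by (simp add: T_def is_straightening_of_def in_keys_iff)
  ultimately show False by blast
qed

lemma leading_monomial_straightening_law:
  assumes L: "linear_extension k n r L" and \<mu>: "\<mu> \<in> obstructions"
  shows "leading_monomial L (straightening_law \<mu>) = \<mu>"
proof (rule leading_monomial_eqI)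
  show "linear_order_on vars L" using L by (simp add: linear_extension_def)
  show "\<mu> \<in> keys (straightening_law \<mu>)"
    using straightening_law[OF \<mu>] by (simp add: is_straightening_of_def in_keys_iff)
qed (rule tail_revlex_less[OF L \<mu>])

lemma straightening_law_nonzero: "\<mu> \<in> obstructions \<Longrightarrow> straightening_law \<mu> \<noteq> 0"
proof
  assume "\<mu> \<in> obstructions" "straightening_law \<mu> = 0"
  then show False using straightening_law[of \<mu>] by (simp add: is_straightening_of_def)
qed

lemma initial_ideal_straightening_laws:
  assumes L: "linear_extension k n r L"
  shows "initial_ideal k n L straightening_laws = genideal R (incomparable_products k n r)"
proof -
  have "{poly_of_monomial (leading_monomial L p) | p. p \<in> straightening_laws \<and> p \<noteq> 0} = incomparable_products k n r"
  proof (intro equalityI subsetI)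
    fix q assume "q \<in> {poly_of_monomial (leading_monomial L p) | p. p \<in> straightening_laws \<and> p \<noteq> 0}"
    then obtain \<mu> where "\<mu> \<in> obstructions" "q = poly_of_monomial (leading_monomial L (straightening_law \<mu>))"
      by (auto simp: straightening_laws_def)
    then show "q \<in> incomparable_products k n r"
      using leading_monomial_straightening_law[OF L] by (simp add: incomparable_products_eq)
  next
    fix q assume "q \<in> incomparable_products k n r"
    then obtain \<mu> where \<mu>: "\<mu> \<in> obstructions" "q = poly_of_monomial \<mu>" by (auto simp: incomparable_products_eq)
    then have "q = poly_of_monomial (leading_monomial L (straightening_law \<mu>))"
      using leading_monomial_straightening_law[OF L] by simp
    then show "q \<in> {poly_of_monomial (leading_monomial L p) | p. p \<in> straightening_laws \<and> p \<noteq> 0}"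
      using \<mu>(1) straightening_law_nonzero unfolding straightening_laws_def by blast
  qed
  then show ?thesis by (simp add: initial_ideal_def)
qed

lemma initial_ideal_vanishing_ideal:
  assumes L: "linear_extension k n r L"
  shows "initial_ideal k n L vanishing_ideal = genideal R (incomparable_products k n r)"
proof
  let ?A = "{poly_of_monomial (leading_monomial L p) | p. p \<in> vanishing_ideal \<and> p \<noteq> 0}"
  have pc: "incomparable_products k n r \<subseteq> carrier R"
    unfolding incomparable_products_eq using obstruction_keys by (auto simp: poly_of_monomial_def single_in_carrier)
  note G = bracket_genideal[OF pc]
  have keys: "keys (leading_monomial L p) \<subseteq> vars" if "p \<in> vanishing_ideal" "p \<noteq> 0" for p
    using leading_monomial_not_standard(1)[OF L that] that by (auto simp: vanishing_ideal_def bracket_ring_carrier_iff)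
  have Ac: "?A \<subseteq> carrier R" using keys by (auto simp: poly_of_monomial_def intro!: single_in_carrier)
  show "initial_ideal k n L vanishing_ideal \<subseteq> genideal R (incomparable_products k n r)"
    unfolding initial_ideal_def
  proof (rule bracket_genideal(3)[OF Ac G(1)], safe)
    fix p assume p: "p \<in> vanishing_ideal" "p \<noteq> 0"
    obtain \<mu> m where \<mu>: "\<mu> \<in> obstructions" "leading_monomial L p = \<mu> + m" "keys m \<subseteq> vars"
      using nonstandard_obtain[OF keys[OF p] leading_monomial_not_standard(2)[OF L p]] by blast
    have "poly_of_monomial \<mu> \<in> genideal R (incomparable_products k n r)"
      using G(2) \<mu>(1) by (auto simp: incomparable_products_eq)
    then show "poly_of_monomial (leading_monomial L p) \<in> genideal R (incomparable_products k n r)"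
      unfolding \<mu>(2) poly_of_monomial_add
      using \<mu>(3) by (intro bracket_ideal_closed(3)[OF G(1)]) (simp_all add: poly_of_monomial_def single_in_carrier)
  qed
  show "genideal R (incomparable_products k n r) \<subseteq> initial_ideal k n L vanishing_ideal"
  proof (rule G(3))
    show "ideal (initial_ideal k n L vanishing_ideal) R"
      unfolding initial_ideal_def by (rule bracket_genideal(1)[OF Ac])
    have "incomparable_products k n r \<subseteq> ?A"
    proof
      fix q assume "q \<in> incomparable_products k n r"
      then obtain \<mu> where \<mu>: "\<mu> \<in> obstructions" "q = poly_of_monomial \<mu>" by (auto simp: incomparable_products_eq)
      have "straightening_law \<mu> \<in> vanishing_ideal"
        using straightening_laws_in_vanishing_ideal \<mu>(1) by (auto simp: straightening_laws_def)
      then show "q \<in> ?A"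
        using leading_monomial_straightening_law[OF L \<mu>(1)] straightening_law_nonzero[OF \<mu>(1)] \<mu>(2)
        by (intro CollectI exI[of _ "straightening_law \<mu>"]) auto
    qed
    then show "incomparable_products k n r \<subseteq> initial_ideal k n L vanishing_ideal"
      unfolding initial_ideal_def using bracket_genideal(2)[OF Ac] by blast
  qed
qed

theorem vanishing_ideal_structure:
  "primeideal vanishing_ideal R
    \<and> (\<exists>G. minimally_generates R G vanishing_ideal
          \<and> (\<forall>g \<in> G. quadratic_form k n g)
          \<and> (\<forall>L. linear_extension k n r L \<longrightarrow> groebner_basis k n L G vanishing_ideal))
    \<and> (\<forall>L. linear_extension k n r L \<longrightarrow>
          initial_ideal k n L vanishing_ideal = genideal R (incomparable_products k n r))"
proof (intro conjI allI impI exI[of _ straightening_laws])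
  show "primeideal vanishing_ideal R" by (rule vanishing_ideal_prime)
  show "minimally_generates R straightening_laws vanishing_ideal"
    unfolding minimally_generates_def
    using straightening_laws_in_carrier genideal_straightening_laws linear_extension_exists
      straightening_laws_minimal by blast
  show "\<forall>g\<in>straightening_laws. quadratic_form k n g"
    using straightening_laws_in_carrier straightening_law_degree
    by (auto simp: quadratic_form_def straightening_laws_def)
  fix L assume L: "linear_extension k n r L"
  show "groebner_basis k n L straightening_laws vanishing_ideal"
    unfolding groebner_basis_def
    using initial_ideal_straightening_laws[OF L] initial_ideal_vanishing_ideal[OF L]
      straightening_laws_in_vanishing_ideal finite_obstructions by (simp add: straightening_laws_def)
  show "initial_ideal k n L vanishing_ideal = genideal R (incomparable_products k n r)"
    by (rule initial_ideal_vanishing_ideal[OF L])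
qed

end

section \<open>Subspaces and matrices of full rank\<close>

text \<open>Linear independence of the rows as a family, in a form suited to computing with matrices. It also excludes
repeated rows, which independence of the set of rows does not.\<close>

definition independent_rows :: "complex mat \<Rightarrow> bool" where
  "independent_rows A \<longleftrightarrow>
     (\<forall>y\<in>carrier_vec (dim_row A). transpose_mat A *\<^sub>v y = 0\<^sub>v (dim_col A) \<longrightarrow> y = 0\<^sub>v (dim_row A))"

lemma independent_rows_square:
  assumes "X \<in> carrier_mat n n"
  shows "independent_rows X \<longleftrightarrow> det X \<noteq> 0"
proof -
  have "det X = det (transpose_mat X)" using det_transpose[OF assms] by simp
  then show ?thesis
    using det_0_iff_vec_prod_zero_field[of "transpose_mat X" n] assms
    by (auto simp: independent_rows_def)
qed

lemma invertible_obtain: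
  assumes X: "X \<in> carrier_mat n n" and "det X \<noteq> (0 :: complex)"
  obtains Y where "Y \<in> carrier_mat n n" "X * Y = 1\<^sub>m n" "Y * X = 1\<^sub>m n"
  using det_non_zero_imp_unit[OF assms, of "()"] that
  by (auto simp: Units_def ring_mat_simps)

lemma independent_rows_imp_dim:
  assumes A: "A \<in> carrier_mat m n" and ind: "independent_rows A"
  shows "distinct (rows A)" "vec_space.rank n (transpose_mat A) = m"
    "LinearCombinations.module.lin_indpt class_ring (module_vec TYPE(complex) n) (set (rows A))"
proof -
  interpret vec_space "TYPE(complex)" n .
  let ?T = "transpose_mat A"
  have T: "?T \<in> carrier_mat n m" using A by simp
  have inj: "y = 0\<^sub>v m" if "y \<in> carrier_vec m" "?T *\<^sub>v y = 0\<^sub>v n" for y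
    using ind that A by (auto simp: independent_rows_def)
  have dist: "distinct (cols ?T)"
  proof (rule ccontr)
    assume "\<not> distinct (cols ?T)"
    then obtain i j where ij: "i < m" "j < m" "i \<noteq> j" "col ?T i = col ?T j"
      using T by (auto simp: distinct_conv_nth)
    let ?y = "unit_vec m i - unit_vec m j :: complex vec"
    have unit: "?T *\<^sub>v unit_vec m a = col ?T a" if "a < m" for a
      using that T by (intro eq_vecI) auto
    have "?T *\<^sub>v ?y = ?T *\<^sub>v unit_vec m i - ?T *\<^sub>v unit_vec m j"
      by (rule mult_minus_distrib_mat_vec[OF T]) auto
    also have "\<dots> = 0\<^sub>v n"
      unfolding unit[OF ij(1)] unit[OF ij(2)] ij(4) using A by (intro eq_vecI) auto
    finally have "?y = 0\<^sub>v m" by (intro inj) auto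
    then have "?y $ i = 0" using ij by simp
    then show False using ij by simp
  qed
  then show "distinct (rows A)" by simp
  have li: "lin_indpt (set (cols ?T))"
    using lin_depE[OF T _ dist] inj by blast
  then show "lin_indpt (set (rows A))" by simp
  show "rank ?T = m" by (rule lin_indpt_full_rank[OF T dist li])
qed

lemma lin_indpt_imp_independent_rows:
  assumes vs: "set vs \<subseteq> carrier_vec n" and d: "distinct vs"
    and li: "LinearCombinations.module.lin_indpt class_ring (module_vec TYPE(complex) n) (set vs)"
  shows "independent_rows (mat_of_rows n vs)"
proof -
  interpret vec_space "TYPE(complex)" n .
  let ?A = "mat_of_rows n vs"
  have T: "transpose_mat ?A \<in> carrier_mat n (length vs)" by simp
  have cols: "cols (transpose_mat ?A) = vs" using vs by simp
  show ?thesis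
    unfolding independent_rows_def
  proof (intro ballI impI, rule ccontr)
    fix y assume "y \<in> carrier_vec (dim_row ?A)" "transpose_mat ?A *\<^sub>v y = 0\<^sub>v (dim_col ?A)"
      "y \<noteq> 0\<^sub>v (dim_row ?A)"
    then have "lin_dep (set (cols (transpose_mat ?A)))"
      by (intro lin_depI[OF T, of y]) (use d cols in auto)
    then show False using li cols by simp
  qed
qed

lemma row_space_subspace:
  assumes A: "A \<in> carrier_mat m n"
  shows "subspace class_ring (vec_space.row_space n A) (complex_space n)"
proof -
  interpret vec_space "TYPE(complex)" n .
  have "set (rows A) \<subseteq> carrier_vec n" using A by (auto simp: rows_def)
  then show ?thesis unfolding row_space_def by (intro span_is_subspace) simp
qed

lemma subspace_dim_row_space:
  assumes A: "A \<in> carrier_mat m n" and ind: "independent_rows A"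
  shows "subspace_dim n (vec_space.row_space n A) = m"
proof -
  interpret vec_space "TYPE(complex)" n .
  show ?thesis
    using independent_rows_imp_dim(2)[OF A ind]
    unfolding subspace_dim_def rank_def row_space_def by simp
qed

text \<open>A maximal independent subset of \<open>S\<close> that contains \<open>E\<close> is a basis of
\<open>S\<close>.\<close>

lemma extend_in_subspace:
  assumes S: "subspace class_ring S (complex_space n)" and E: "E \<subseteq> S"
    and li: "LinearCombinations.module.lin_indpt class_ring (complex_space n) E"
  shows "\<exists>F. E \<subseteq> F \<and> F \<subseteq> S \<and> finite F \<and> LinearCombinations.module.lin_indpt class_ring (complex_space n) F \<and>
     LinearCombinations.module.span class_ring (complex_space n) F = S \<and> card F = subspace_dim n S"
proof -
  interpret vec_space "TYPE(complex)" n .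
  have sub: "submodule class_ring S V" using S by (simp add: subspace_def)
  have SV: "S \<subseteq> carrier_vec n" using sub by (auto simp: submodule_def)
  let ?P = "\<lambda>T. E \<subseteq> T \<and> T \<subseteq> S \<and> lin_indpt T"
  have "\<exists>F. finite F \<and> maximal F ?P"
    by (rule maximal_exists[where N = dim and B = E]) (use li_le_dim SV E li in auto)
  then obtain F where F: "finite F" "maximal F ?P" by blast
  then have F': "E \<subseteq> F" "F \<subseteq> S" "lin_indpt F" by (simp_all add: maximal_def)
  interpret W: vectorspace class_ring "vs S" using S by (rule subspace_is_vs)
  note nd = span_li_not_depend[OF _ sub]
  have "maximal F (\<lambda>T. T \<subseteq> carrier (vs S) \<and> W.lin_indpt T)"
    unfolding maximal_def
  proof (intro conjI allI impI)
    show "F \<subseteq> carrier (vs S)" "W.lin_indpt F" using F' nd(2)[OF F'(2)] by simp_all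
    fix T assume T: "F \<subseteq> T \<and> T \<subseteq> carrier (vs S) \<and> W.lin_indpt T"
    then have "T \<subseteq> S" by simp
    then have "?P T" using T F'(1) nd(2)[of T] by auto
    then show "T = F" using F(2) T by (auto simp: maximal_def)
  qed
  then have b: "W.basis F" by (rule W.max_li_is_basis)
  then have "W.span F = S" by (simp add: W.basis_def)
  then have "span F = S" using nd(1)[OF F'(2)] by simp
  moreover have "card F = W.dim" using W.dim_basis[OF F(1) b] by simp
  ultimately show ?thesis using F F' by (auto simp: subspace_dim_def)
qed

lemma subspace_dim_ge:
  assumes S: "subspace class_ring S (complex_space n)" and E: "E \<subseteq> S"
    and li: "LinearCombinations.module.lin_indpt class_ring (complex_space n) E"
  shows "card E \<le> subspace_dim n S"
  using extend_in_subspace[OF assms] card_mono by metis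

lemma whole_subspace:
  "subspace class_ring (carrier_vec n) (complex_space n)" "subspace_dim n (carrier_vec n) = n"
proof -
  interpret vec_space "TYPE(complex)" n .
  show "subspace class_ring (carrier_vec n) (complex_space n)"
    using span_is_subspace[of "carrier_vec n"] span_unit_vecs_is_carrier
    by (metis span_is_subspace unit_vecs_carrier cV)
  have eq: "complex_space n\<lparr>carrier := carrier_vec n\<rparr> = complex_space n" by (simp add: module_vec_def)
  show "subspace_dim n (carrier_vec n) = n" unfolding subspace_dim_def eq by (rule dim_is_n)
qed

lemma complete_to_invertible:
  assumes vs: "set vs \<subseteq> carrier_vec n" and d: "distinct vs"
    and li: "LinearCombinations.module.lin_indpt class_ring (complex_space n) (set vs)"
  obtains X where "X \<in> carrier_mat n n" "det X \<noteq> 0" "\<And>i. i < length vs \<Longrightarrow> row X i = vs ! i" "length vs \<le> n"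
proof -
  obtain F where F: "set vs \<subseteq> F" "F \<subseteq> carrier_vec n" "finite F"
    "LinearCombinations.module.lin_indpt class_ring (complex_space n) F" "card F = n"
    using extend_in_subspace[OF whole_subspace(1) vs li] whole_subspace(2) by metis
  obtain us where us: "set us = F - set vs" "distinct us" using F(3) finite_distinct_list finite_Diff by metis
  let ?ws = "vs @ us"
  have ws: "set ?ws = F" "distinct ?ws" using us F(1) d by auto
  then have len: "length ?ws = n" using F(5) distinct_card by metis
  have "independent_rows (mat_of_rows n ?ws)"
    by (rule lin_indpt_imp_independent_rows) (use ws F in auto)
  moreover have X: "mat_of_rows n ?ws \<in> carrier_mat n n" using len by (metis mat_of_rows_carrier(1))
  ultimately have "det (mat_of_rows n ?ws) \<noteq> 0" using independent_rows_square by blast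
  moreover have "row (mat_of_rows n ?ws) i = vs ! i" if "i < length vs" for i
    using that vs by (subst mat_of_rows_row) (auto simp: nth_append)
  moreover have "length vs \<le> n" using len by simp
  ultimately show ?thesis using that X by blast
qed

lemma orthogonal_complement_subspace:
  assumes "W \<subseteq> carrier_vec n"
  shows "subspace class_ring (vec_module.orthogonal_complement n W) (complex_space n)"
proof -
  interpret vec_space "TYPE(complex)" n .
  show ?thesis
    unfolding subspace_def submodule_def orthogonal_complement_def
    using assms module_axioms vectorspace_axioms
    by (auto simp: add_scalar_prod_distrib[of _ n] subset_iff)
qed

lemma subspace_Int:
  assumes "subspace class_ring S (complex_space n)" "subspace class_ring T (complex_space n)"
  shows "subspace class_ring (S \<inter> T) (complex_space n)"
  using assms unfolding subspace_def submodule_def by auto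

text \<open>Complete a basis of \<open>W\<close> to an invertible matrix. The last columns of its inverse are orthogonal to
\<open>W\<close>.\<close>

lemma dim_orthogonal_complement_ge:
  assumes W: "subspace class_ring W (complex_space n)"
  shows "n - subspace_dim n W \<le> subspace_dim n (vec_module.orthogonal_complement n W)"
proof -
  interpret vec_space "TYPE(complex)" n .
  have WV: "W \<subseteq> carrier_vec n" using W by (auto simp: subspace_def submodule_def)
  have "lin_indpt {}" by (simp add: lin_dep_def)
  then obtain F where F: "F \<subseteq> W" "finite F" "lin_indpt F" "span F = W" "card F = subspace_dim n W"
    using extend_in_subspace[OF W, of "{}"] by auto
  obtain vs where vs: "set vs = F" "distinct vs" using F(2) finite_distinct_list by blast
  have len: "length vs = subspace_dim n W" using vs F(5) distinct_card by metis
  have FV: "F \<subseteq> carrier_vec n" using F(1) WV by blast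
  obtain X where X: "X \<in> carrier_mat n n" "det X \<noteq> 0" "\<And>i. i < length vs \<Longrightarrow> row X i = vs ! i" "length vs \<le> n"
    using complete_to_invertible[of vs n] vs F(3) FV by metis
  obtain Y where Y: "Y \<in> carrier_mat n n" "X * Y = 1\<^sub>m n" "Y * X = 1\<^sub>m n" using invertible_obtain[OF X(1,2)] .
  have dY: "det Y \<noteq> 0" using det_mult[OF X(1) Y(1)] Y(2) by auto
  have Yt: "transpose_mat Y \<in> carrier_mat n n" using Y(1) by simp
  have indY: "independent_rows (transpose_mat Y)"
    using independent_rows_square[OF Yt] dY det_transpose[OF Y(1)] by simp
  note dim = independent_rows_imp_dim[OF Yt indY]
  let ?m = "length vs"
  let ?E = "set (drop ?m (cols Y))"
  have liE: "lin_indpt ?E" using subset_li_is_li[OF dim(3)[unfolded rows_transpose] set_drop_subset] .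
  have cardE: "card ?E = n - ?m"
    using dim(1) Y(1) by (simp add: distinct_card)
  have "?E \<subseteq> orthogonal_complement W"
  proof
    fix v assume "v \<in> ?E"
    then obtain j where j: "?m \<le> j" "j < n" "v = col Y j"
    proof -
      obtain i where i: "i < length (drop ?m (cols Y))" "v = drop ?m (cols Y) ! i"
        using \<open>v \<in> ?E\<close> by (metis in_set_conv_nth)
      then show ?thesis using that[of "?m + i"] Y(1) by auto
    qed
    have vV: "v \<in> carrier_vec n" using j Y(1) by auto
    have "v \<bullet> x = 0" if xF: "x \<in> F" for x
    proof -
      have "x \<in> set vs" using xF vs(1) by simp
      then obtain i where i: "i < ?m" "x = vs ! i" by (auto simp: in_set_conv_nth)
      have xV: "x \<in> carrier_vec n" using xF FV by blast
      have "x \<bullet> v = (X * Y) $$ (i, j)" using i j X(1,3,4) Y(1) by simp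
      also have "\<dots> = 0" using Y(2) i j X(4) by simp
      finally show ?thesis using xV vV comm_scalar_prod by metis
    qed
    then have "v \<in> orthogonal_complement F" using vV by (simp add: orthogonal_complement_def)
    then show "v \<in> orthogonal_complement W" using in_orthogonal_complement_span[OF FV] F(4) by simp
  qed
  then have "card ?E \<le> subspace_dim n (orthogonal_complement W)"
    by (rule subspace_dim_ge[OF orthogonal_complement_subspace[OF WV] _ liE])
  then show ?thesis using cardE len by simp
qed

section \<open>The ideal of the spinor-helicity variety\<close>

lemma sum_delta_Suc:
  fixes f :: "nat \<Rightarrow> 'a::comm_ring_1"
  assumes "c \<in> {1..n}"
  shows "(\<Sum>a\<in>{0..<n}. f a * (if Suc a = c then 1 else 0)) = f (c - 1)"
proof -
  have "(\<Sum>a\<in>{0..<n}. f a * (if Suc a = c then 1 else 0)) = (\<Sum>a\<in>{0..<n}. if a = c - 1 then f a else 0)"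
    by (rule sum.cong) (use assms in auto)
  also have "\<dots> = f (c - 1)" using assms by (subst sum.delta) auto
  finally show ?thesis .
qed

lemma plucker_nth_range:
  assumes "I \<in> plucker_indices m n" "b < m"
  shows "I ! b \<in> {1..n}"
  using assms nth_mem[of b I] unfolding plucker_indices_def by blast

lemma minor_from_matrix:
  assumes I: "I \<in> plucker_indices (e - s) n"
    and A: "\<And>a j. a < e - s \<Longrightarrow> j < n \<Longrightarrow> A $$ (a, j) = M (s + a) (Suc j)"
  shows "det (mat (e - s) (e - s) (\<lambda>(a, b). A $$ (a, I ! b - 1))) = minor M s e I"
  unfolding minor_def
proof (rule arg_cong[where f = det], rule cong_mat[OF refl refl])
  fix a b assume ab: "a < e - s" "b < e - s"
  have "I ! b \<in> {1..n}" by (rule plucker_nth_range[OF I ab(2)])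
  then show "(case (a, b) of (a, b) \<Rightarrow> A $$ (a, I ! b - 1)) = (case (a, b) of (i, j) \<Rightarrow> M (s + i) (I ! j))"
    using A[OF ab(1), of "I ! b - 1"] by auto
qed

lemma nonzero_minor_independent:
  assumes A: "A \<in> carrier_mat m n" and I: "I \<in> plucker_indices m n" and nz: "plucker_coord m A I \<noteq> 0"
  shows "independent_rows A"
  unfolding independent_rows_def
proof (intro ballI impI)
  fix y assume y: "y \<in> carrier_vec (dim_row A)" and zero: "transpose_mat A *\<^sub>v y = 0\<^sub>v (dim_col A)"
  let ?S = "mat m m (\<lambda>(a, b). A $$ (a, I ! b - 1))"
  have ym: "y \<in> carrier_vec m" using y A by simp
  have "transpose_mat ?S *\<^sub>v y = 0\<^sub>v m"
  proof (rule eq_vecI)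
    fix b assume b: "b < dim_vec (0\<^sub>v m :: complex vec)"
    have ib: "I ! b - 1 < n" using plucker_nth_range[OF I, of b] b by auto
    have "(transpose_mat ?S *\<^sub>v y) $ b = (\<Sum>a\<in>{0..<m}. A $$ (a, I ! b - 1) * y $ a)"
      using b ym by (simp add: scalar_prod_def)
    also have "\<dots> = (transpose_mat A *\<^sub>v y) $ (I ! b - 1)"
      using ib ym A by (simp add: scalar_prod_def)
    also have "\<dots> = 0" using zero ib A by simp
    finally show "(transpose_mat ?S *\<^sub>v y) $ b = 0\<^sub>v m $ b" using b by simp
  qed simp
  moreover have "det (transpose_mat ?S) \<noteq> 0"
    using nz det_transpose[of ?S m] by (simp add: plucker_coord_def)
  ultimately show "y = 0\<^sub>v (dim_row A)"
    using det_0_iff_vec_prod_zero_field[of "transpose_mat ?S" m] ym A by auto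
qed

text \<open>This is Jacobi's identity between complementary minors. Let \<open>K\<close> be the complement of
\<open>J\<close>, let \<open>Z\<close> be the square matrix with the unit columns of index in \<open>K\<close>
followed by the transpose of \<open>B\<close>, and evaluate \<open>det Z\<close> in two ways. Multiplying by
\<open>X\<close> makes it block triangular with the \<open>K\<close>-minor of the first rows of \<open>X\<close>
and \<open>H\<close> on the diagonal. Permuting its rows makes it block triangular with the identity and the
\<open>J\<close>-minor of \<open>B\<close> on the diagonal.\<close>

lemma complementary_minors:
  fixes X :: "complex mat"
  assumes X: "X \<in> carrier_mat n n" and B: "B \<in> carrier_mat k n" and kn: "k \<le> n"
    and J: "J \<in> plucker_indices k n" and H: "H \<in> carrier_mat k k"
    and XB: "X * transpose_mat B = mat n k (\<lambda>(i, j). if i < n - k then 0 else H $$ (i - (n - k), j))"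
  shows "det X * (complement_sign n J * plucker_coord k B J) =
    det H * det (mat (n - k) (n - k) (\<lambda>(i, b). X $$ (i, complement_list n J ! b - 1)))"
proof -
  define K where "K = complement_list n J"
  define p where "p = n - k"
  have np: "n = p + k" using kn by (simp add: p_def)
  let ?l = "K @ J"
  have K: "K \<in> plucker_indices p n" unfolding K_def p_def by (rule complement_list_in_plucker[OF J])
  have lenK: "length K = p" using K by (simp add: plucker_indices_def)
  have setK: "set K = {1..n} - set J" by (simp add: K_def)
  have lenJ: "length J = k" using J by (simp add: plucker_indices_def)
  define Z where "Z = mat n n (\<lambda>(i, j). if j < p then (if Suc i = K ! j then 1 else 0) else B $$ (j - p, i))"
  have Z: "Z \<in> carrier_mat n n" by (simp add: Z_def)
  have Kin: "K ! j \<in> {1..n}" if "j < p" for j using plucker_nth_range[OF K that] .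
  have lin: "?l ! i \<in> {1..n}" if "i < n" for i
    using that plucker_nth_range[OF K, of i] plucker_nth_range[OF J, of "i - p"] np
    by (cases "i < p") (auto simp: nth_append lenK)
  let ?C = "mat p p (\<lambda>(i, b). X $$ (i, K ! b - 1))"
  let ?L = "mat k p (\<lambda>(i, b). X $$ (i + p, K ! b - 1))"
  have XZ: "X * Z = four_block_mat ?C (0\<^sub>m p k) ?L H"
  proof (rule eq_matI)
    fix i j
    assume "i < dim_row (four_block_mat ?C (0\<^sub>m p k) ?L H)" "j < dim_col (four_block_mat ?C (0\<^sub>m p k) ?L H)"
    then have ij: "i < n" "j < n" using H np by auto
    have e: "(X * Z) $$ (i, j) = (\<Sum>a\<in>{0..<n}. X $$ (i, a) * Z $$ (a, j))"
      using ij X Z by (simp add: scalar_prod_def)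
    show "(X * Z) $$ (i, j) = four_block_mat ?C (0\<^sub>m p k) ?L H $$ (i, j)"
    proof (cases "j < p")
      case True
      have "(X * Z) $$ (i, j) = (\<Sum>a\<in>{0..<n}. X $$ (i, a) * (if Suc a = K ! j then 1 else 0))"
        unfolding e by (rule sum.cong) (use ij True in \<open>auto simp: Z_def\<close>)
      also have "\<dots> = X $$ (i, K ! j - 1)" by (rule sum_delta_Suc[OF Kin[OF True]])
      finally show ?thesis using ij True H np by simp
    next
      case False
      have jk: "j - p < k" using ij(2) False np by simp
      have "(X * Z) $$ (i, j) = (\<Sum>a\<in>{0..<n}. X $$ (i, a) * B $$ (j - p, a))"
        unfolding e by (rule sum.cong) (use ij False in \<open>auto simp: Z_def\<close>)
      also have "\<dots> = (X * transpose_mat B) $$ (i, j - p)"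
        using ij(1) jk X B by (simp add: scalar_prod_def)
      also have "\<dots> = (if i < p then 0 else H $$ (i - p, j - p))"
        unfolding XB[folded p_def] using ij(1) jk by simp
      finally show ?thesis using ij False H np by simp
    qed
  qed (use X Z H np in auto)
  have 1: "det X * det Z = det ?C * det H"
    using det_mult[OF X Z] unfolding XZ
    by (subst (asm) det_four_block_mat_upper_right_zero[of _ p _ k]) (use H in auto)
  define Q where "Q = complement_matrix n J"
  have Q: "Q \<in> carrier_mat n n" by (simp add: Q_def complement_matrix_def)
  let ?U = "mat p k (\<lambda>(i, j). B $$ (j, K ! i - 1))"
  let ?BJ = "mat k k (\<lambda>(a, b). B $$ (a, J ! b - 1))"
  have QZ: "transpose_mat Q * Z = four_block_mat (1\<^sub>m p) ?U (0\<^sub>m k p) (transpose_mat ?BJ)"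
  proof (rule eq_matI)
    fix i j
    assume "i < dim_row (four_block_mat (1\<^sub>m p) ?U (0\<^sub>m k p) (transpose_mat ?BJ))"
      "j < dim_col (four_block_mat (1\<^sub>m p) ?U (0\<^sub>m k p) (transpose_mat ?BJ))"
    then have ij: "i < n" "j < n" using np by auto
    have "(transpose_mat Q * Z) $$ (i, j) = (\<Sum>a\<in>{0..<n}. Q $$ (a, i) * Z $$ (a, j))"
      using ij Q Z by (simp add: scalar_prod_def)
    also have "\<dots> = (\<Sum>a\<in>{0..<n}. Z $$ (a, j) * (if Suc a = ?l ! i then 1 else 0))"
      by (rule sum.cong) (use ij in \<open>auto simp: Q_def complement_matrix_def K_def\<close>)
    also have "\<dots> = Z $$ (?l ! i - 1, j)" by (rule sum_delta_Suc[OF lin[OF ij(1)]])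
    also have "\<dots> = (if j < p then (if ?l ! i = K ! j then 1 else 0) else B $$ (j - p, ?l ! i - 1))"
      using lin[OF ij(1)] ij by (auto simp: Z_def)
    also have "\<dots> = four_block_mat (1\<^sub>m p) ?U (0\<^sub>m k p) (transpose_mat ?BJ) $$ (i, j)"
    proof (cases "j < p")
      case True
      have "?l ! i = K ! j \<longleftrightarrow> i = j"
        using complement_append[OF J kn] True ij lenK
        by (metis K_def nth_append nth_eq_iff_index_eq)
      then show ?thesis using True ij np by auto
    next
      case False
      then show ?thesis using ij np by (auto simp: nth_append lenK)
    qed
    finally show "(transpose_mat Q * Z) $$ (i, j) = four_block_mat (1\<^sub>m p) ?U (0\<^sub>m k p) (transpose_mat ?BJ) $$ (i, j)" .
  qed (use Q Z np in auto)
  have "det (transpose_mat Q) * det Z = det (1\<^sub>m p :: complex mat) * det (transpose_mat ?BJ)"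
    using det_mult[of "transpose_mat Q" n Z] Q Z unfolding QZ
    by (subst (asm) det_four_block_mat_lower_left_zero[of _ p _ k]) auto
  then have "complement_sign n J * det Z = plucker_coord k B J"
    using det_transpose[OF Q] det_transpose[of ?BJ k] by (simp add: complement_sign_def Q_def plucker_coord_def)
  then have "complement_sign n J * plucker_coord k B J = det Z"
    using complement_sign_square[OF J kn] by (metis mult.assoc mult_1)
  then show ?thesis using 1 by (simp add: K_def p_def mult.commute)
qed

context spinor_helicity_parameters
begin

lemma coords_agree:
  assumes "\<And>I. I \<in> plucker_indices k n \<Longrightarrow> c' * plucker_coord k A I = c * minor M 0 k I"
    and "\<And>J. J \<in> plucker_indices k n \<Longrightarrow>
      d' * plucker_coord k B J = d * complement_sign n J * minor M r N (complement_list n J)"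
    and "x \<in> vars"
  shows "case_bracket (\<lambda>I. c' * plucker_coord k A I) (\<lambda>J. d' * plucker_coord k B J) x = coords (M, c, d) x"
  using assms by (cases x) (auto simp: bracket_vars_def bracket_value_def top_row_def end_row_def)

lemma overlap_le: "k - r \<le> n - k"
  using r_le_k dim_bound by simp

lemma angle_coordinate:
  assumes I: "I \<in> plucker_indices k n"
    and A: "\<And>a j. a < k \<Longrightarrow> j < n \<Longrightarrow> A $$ (a, j) = M a (Suc j)"
  shows "plucker_coord k A I = minor M 0 k I"
  using minor_from_matrix[of I k 0 n A M] I A by (simp add: plucker_coord_def)

text \<open>Here the first \<open>n - k\<close> rows of \<open>X\<close> are the last \<open>n - k\<close> rows of the
parameter matrix, and the rows of \<open>B\<close> are orthogonal to them. The sign may be moved to the other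
side because its square is 1.\<close>

lemma square_coordinate:
  fixes X :: "complex mat"
  assumes X: "X \<in> carrier_mat n n" and B: "B \<in> carrier_mat k n" and H: "H \<in> carrier_mat k k"
    and XB: "X * transpose_mat B = mat n k (\<lambda>(i, j). if i < n - k then 0 else H $$ (i - (n - k), j))"
    and M: "\<And>a j. a < n - k \<Longrightarrow> j < n \<Longrightarrow> X $$ (a, j) = M (r + a) (Suc j)"
    and J: "J \<in> plucker_indices k n"
  shows "det X * plucker_coord k B J = det H * (complement_sign n J * minor M r N (complement_list n J))"
proof -
  have K: "complement_list n J \<in> plucker_indices (N - r) n"
    unfolding bounds(5) by (rule complement_list_in_plucker[OF J])
  have "det X * (complement_sign n J * plucker_coord k B J) = det H * minor M r N (complement_list n J)"
    using complementary_minors[OF X B bounds(1) J H XB] minor_from_matrix[OF K, of X M] M bounds(5) by simp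
  moreover have "det X * plucker_coord k B J =
      (complement_sign n J * complement_sign n J) * (det X * plucker_coord k B J)"
    using complement_sign_square[OF J bounds(1)] by simp
  then have "det X * plucker_coord k B J =
      complement_sign n J * (det X * (complement_sign n J * plucker_coord k B J))"
    by (simp only: mult_ac)
  ultimately show ?thesis by (simp only: mult_ac)
qed

text \<open>Complete the last \<open>n - k\<close> rows of the parameter matrix to an invertible matrix \<open>X\<close>.
The last \<open>k\<close> columns of its inverse are a basis of \<open>W\<close>, and
\<open>complementary_minors\<close> applies with \<open>H = 1\<close>.\<close>

lemma generic_point_in_cone:
  assumes I0: "I0 \<in> plucker_indices k n" and mI: "minor M 0 k I0 \<noteq> 0"
    and K0: "K0 \<in> plucker_indices (n - k) n" and mK: "minor M r N K0 \<noteq> 0"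
  shows "\<exists>f\<in>spinor_helicity_cone k n r. \<forall>x\<in>vars. f x = coords (M, c, d) x"
proof -
  interpret vec_space "TYPE(complex)" n .
  let ?q = "n - k"
  define A where "A = mat k n (\<lambda>(a, j). M a (Suc j))"
  define C where "C = mat ?q n (\<lambda>(a, j). M (r + a) (Suc j))"
  have A: "A \<in> carrier_mat k n" and C: "C \<in> carrier_mat ?q n" by (simp_all add: A_def C_def)
  have pA: "plucker_coord k A I = minor M 0 k I" if I: "I \<in> plucker_indices k n" for I
    using I by (rule angle_coordinate) (simp add: A_def)
  have pC: "det (mat ?q ?q (\<lambda>(i, b). C $$ (i, K ! b - 1))) = minor M r N K" if K: "K \<in> plucker_indices ?q n" for K
    using minor_from_matrix[of K N r n C M] K by (simp add: bounds(5) C_def)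
  have indA: "independent_rows A" using nonzero_minor_independent[OF A I0] pA[OF I0] mI by simp
  have indC: "independent_rows C"
    using nonzero_minor_independent[OF C K0] pC[OF K0] mK by (simp add: plucker_coord_def)
  note dA = independent_rows_imp_dim[OF A indA] and dC = independent_rows_imp_dim[OF C indC]
  have rC: "set (rows C) \<subseteq> carrier_vec n" and rA: "set (rows A) \<subseteq> carrier_vec n"
    using A C by (auto simp: rows_def)
  obtain X where X: "X \<in> carrier_mat n n" "det X \<noteq> 0" "\<And>i. i < length (rows C) \<Longrightarrow> row X i = rows C ! i"
    using complete_to_invertible[OF rC dC(1,3)] by metis
  have rowX: "row X i = row C i" if "i < ?q" for i using X(3)[of i] that C by simp
  obtain Y where Y: "Y \<in> carrier_mat n n" "X * Y = 1\<^sub>m n" "Y * X = 1\<^sub>m n" using invertible_obtain[OF X(1,2)] .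
  define B where "B = mat k n (\<lambda>(a, j). Y $$ (j, ?q + a))"
  have B: "B \<in> carrier_mat k n" by (simp add: B_def)
  have Bt: "transpose_mat B \<in> carrier_mat n k" using B by simp
  have XB: "X * transpose_mat B = mat n k (\<lambda>(i, j). if i < ?q then 0 else 1\<^sub>m k $$ (i - ?q, j))"
  proof (rule eq_matI)
    fix i j assume "i < dim_row (mat n k (\<lambda>(i, j). if i < ?q then 0 else 1\<^sub>m k $$ (i - ?q, j) :: complex))"
      "j < dim_col (mat n k (\<lambda>(i, j). if i < ?q then 0 else 1\<^sub>m k $$ (i - ?q, j) :: complex))"
    then have ij: "i < n" "j < k" by auto
    have "(X * transpose_mat B) $$ (i, j) = (X * Y) $$ (i, ?q + j)"
      using ij X(1) Y(1) bounds(1) by (simp add: scalar_prod_def B_def)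
    also have "\<dots> = (if i = ?q + j then 1 else 0)" unfolding Y(2) using ij bounds(1) by simp
    finally show "(X * transpose_mat B) $$ (i, j) = mat n k (\<lambda>(i, j). if i < ?q then 0 else 1\<^sub>m k $$ (i - ?q, j)) $$ (i, j)"
      using ij bounds(1) by auto
  qed (use X B in auto)
  have indB: "independent_rows B"
    unfolding independent_rows_def
  proof (intro ballI impI)
    fix y assume "y \<in> carrier_vec (dim_row B)" and z: "transpose_mat B *\<^sub>v y = 0\<^sub>v (dim_col B)"
    then have y: "y \<in> carrier_vec k" using B by simp
    have "(X * transpose_mat B) *\<^sub>v y = X *\<^sub>v (transpose_mat B *\<^sub>v y)"
      by (rule assoc_mult_mat_vec[OF X(1) Bt y])
    also have "\<dots> = 0\<^sub>v n" using z B X(1) by (intro eq_vecI) auto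
    finally have zero: "(X * transpose_mat B) *\<^sub>v y = 0\<^sub>v n" .
    have "y $ a = 0" if a: "a < k" for a
    proof -
      have "((X * transpose_mat B) *\<^sub>v y) $ (?q + a) = (\<Sum>j\<in>{0..<k}. (if a = j then 1 else 0) * y $ j)"
        unfolding XB using a y bounds(1) by (auto simp: scalar_prod_def intro!: sum.cong)
      also have "\<dots> = (\<Sum>j\<in>{0..<k}. if j = a then y $ j else 0)" by (rule sum.cong) auto
      also have "\<dots> = y $ a" using a by simp
      finally show ?thesis using zero a bounds(1) by simp
    qed
    then show "y = 0\<^sub>v (dim_row B)" using y B by (intro eq_vecI) auto
  qed
  let ?V = "row_space A" and ?W = "row_space B"
  let ?S = "?V \<inter> orthogonal_complement ?W"
  have sV: "subspace class_ring ?V V" and sW: "subspace class_ring ?W V"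
    using row_space_subspace A B by blast+
  have WV: "?W \<subseteq> carrier_vec n" using sW by (auto simp: subspace_def submodule_def)
  have rB: "set (rows B) \<subseteq> carrier_vec n" using B by (auto simp: rows_def)
  let ?E = "set (drop r (rows A))"
  have "?E \<subseteq> ?S"
  proof
    fix v assume "v \<in> ?E"
    then obtain i where i: "i < length (drop r (rows A))" "v = drop r (rows A) ! i" by (metis in_set_conv_nth)
    then have ik: "r + i < k" "v = row A (r + i)" using A by auto
    have vA: "v \<in> set (rows A)" using i(1) i(2) in_set_dropD nth_mem by metis
    then have "v \<in> ?V" unfolding row_space_def using in_own_span[OF rA] by blast
    moreover have "v \<in> orthogonal_complement ?W"
      unfolding row_space_def in_orthogonal_complement_span[OF rB]
    proof -
      have vV: "v \<in> carrier_vec n" using vA rA by blast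
      have iq: "i < ?q" using ik(1) overlap_le by simp
      have vX: "v = row X i"
        unfolding ik(2) rowX[OF iq] using ik(1) iq by (intro eq_vecI) (auto simp: A_def C_def)
      have "v \<bullet> w = 0" if w: "w \<in> set (rows B)" for w
      proof -
        obtain j where j: "j < k" "w = row B j" using w B by (auto simp: in_set_conv_nth)
        have "v \<bullet> w = (X * transpose_mat B) $$ (i, j)" using j iq vX X(1) B by simp
        also have "\<dots> = 0" unfolding XB using iq j(1) by simp
        finally show ?thesis .
      qed
      then show "v \<in> orthogonal_complement (set (rows B))" using vV by (simp add: orthogonal_complement_def)
    qed
    ultimately show "v \<in> ?S" by blast
  qed
  moreover have "lin_indpt ?E" using subset_li_is_li[OF dA(3) set_drop_subset] .
  ultimately have "card ?E \<le> subspace_dim n ?S"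
    by (intro subspace_dim_ge subspace_Int sV orthogonal_complement_subspace WV)
  moreover have "card ?E = k - r" using dA(1) A by (simp add: distinct_card)
  ultimately have dimS: "k - r \<le> subspace_dim n ?S" by simp
  have "(?V, ?W) \<in> spinor_helicity k n r"
    using dimS sV sW subspace_dim_row_space[OF A indA] subspace_dim_row_space[OF B indB]
    by (simp add: spinor_helicity_def Grassmannian_def)
  then have mem: "case_bracket (\<lambda>I. c * plucker_coord k A I) (\<lambda>J. d * det X * plucker_coord k B J) \<in> spinor_helicity_cone k n r"
    unfolding spinor_helicity_cone_def using A B by blast
  have agree: "case_bracket (\<lambda>I. c * plucker_coord k A I) (\<lambda>J. d * det X * plucker_coord k B J) x = coords (M, c, d) x"
    if "x \<in> vars" for x
  proof (rule coords_agree[OF _ _ that])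
    show "c * plucker_coord k A I = c * minor M 0 k I" if "I \<in> plucker_indices k n" for I
      using pA[OF that] by simp
    fix J assume J: "J \<in> plucker_indices k n"
    have "X $$ (a, j) = M (r + a) (Suc j)" if "a < ?q" "j < n" for a j
    proof -
      have "X $$ (a, j) = row X a $ j" using that X(1) by simp
      then show ?thesis using that by (simp add: rowX C_def)
    qed
    from square_coordinate[OF X(1) B _ XB this J]
    show "d * det X * plucker_coord k B J = d * complement_sign n J * minor M r N (complement_list n J)"
      by simp
  qed
  show ?thesis using mem agree by blast
qed

text \<open>Choose \<open>k - r\<close> independent vectors \<open>E\<close> in the intersection of \<open>V\<close> with
the orthogonal complement of \<open>W\<close>. Extend them to a basis of \<open>V\<close>, placing the new
vectors before \<open>E\<close>, and to \<open>n - k\<close> independent vectors of the orthogonal complement,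
placing the new vectors after \<open>E\<close>. The base change from this basis of \<open>V\<close> to the rows
of \<open>A\<close> contributes only a scalar.\<close>

lemma cone_point_parametrized:
  assumes "f \<in> spinor_helicity_cone k n r"
  shows "\<exists>P. \<forall>x\<in>vars. f x = coords P x"
proof -
  interpret vec_space "TYPE(complex)" n .
  let ?q = "n - k"
  obtain c d A B where f: "f = case_bracket (\<lambda>I. c * plucker_coord k A I) (\<lambda>J. d * plucker_coord k B J)"
    and A: "A \<in> carrier_mat k n" and B: "B \<in> carrier_mat k n"
    and sh: "(row_space A, row_space B) \<in> spinor_helicity k n r"
    using assms unfolding spinor_helicity_cone_def by blast
  let ?V = "row_space A" and ?W = "row_space B"
  let ?P = "orthogonal_complement ?W"
  have sV: "subspace class_ring ?V V" and sW: "subspace class_ring ?W V"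
    and dV: "subspace_dim n ?V = k" and dW: "subspace_dim n ?W = k"
    and dS: "k - r \<le> subspace_dim n (?V \<inter> ?P)"
    using sh by (auto simp: spinor_helicity_def Grassmannian_def)
  have WV: "?W \<subseteq> carrier_vec n" and VV: "?V \<subseteq> carrier_vec n"
    using sW sV by (auto simp: subspace_def submodule_def)
  have sP: "subspace class_ring ?P V" by (rule orthogonal_complement_subspace[OF WV])
  have PV: "?P \<subseteq> carrier_vec n" by (auto simp: orthogonal_complement_def)
  have li0: "lin_indpt {}" by (simp add: lin_dep_def)
  obtain E0 where E0: "E0 \<subseteq> ?V \<inter> ?P" "finite E0" "lin_indpt E0" "card E0 = subspace_dim n (?V \<inter> ?P)"
    using extend_in_subspace[OF subspace_Int[OF sV sP] _ li0] by auto
  obtain E where E: "E \<subseteq> E0" "card E = k - r" "finite E"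
    using obtain_subset_with_card_n[of "k - r" E0] dS E0(4) by auto
  have liE: "lin_indpt E" by (rule subset_li_is_li[OF E0(3) E(1)])
  obtain FA where FA: "E \<subseteq> FA" "FA \<subseteq> ?V" "finite FA" "lin_indpt FA" "span FA = ?V" "card FA = k"
    using extend_in_subspace[OF sV _ liE] E(1) E0(1) dV by auto
  obtain G where G: "E \<subseteq> G" "G \<subseteq> ?P" "finite G" "lin_indpt G" "card G = subspace_dim n ?P"
    using extend_in_subspace[OF sP _ liE] E(1) E0(1) by auto
  have "?q \<le> card G" using dim_orthogonal_complement_ge[OF sW] dW G(5) by simp
  then obtain FC where FC: "E \<subseteq> FC" "FC \<subseteq> G" "card FC = ?q"
    using exists_subset_between[of E ?q G] E(2) overlap_le G(1,3) by auto
  have finFC: "finite FC" using FC(2) G(3) finite_subset by blast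
  have liFC: "lin_indpt FC" by (rule subset_li_is_li[OF G(4) FC(2)])
  obtain es where es: "set es = E" "distinct es" using E(3) finite_distinct_list by blast
  obtain us where us: "set us = FA - E" "distinct us" using FA(3) finite_distinct_list[of "FA - E"] by blast
  obtain ws where ws: "set ws = FC - E" "distinct ws" using finFC finite_distinct_list[of "FC - E"] by blast
  have les: "length es = k - r" using es E(2) distinct_card by metis
  have "length us = card (FA - E)" using us distinct_card by metis
  then have lus: "length us = r" using FA(1,3,6) E(2,3) r_le_k by (simp add: card_Diff_subset)
  let ?as = "us @ es" and ?cs = "es @ ws"
  have as: "set ?as = FA" "length ?as = k" using us es FA(1) lus les r_le_k by auto
  have cs: "set ?cs = FC" "distinct ?cs" using ws es FC(1) by auto
  have lcs: "length ?cs = ?q" using cs FC(3) distinct_card by metis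
  have asV: "set ?as \<subseteq> carrier_vec n" using as FA(2) VV by blast
  have csV: "set ?cs \<subseteq> carrier_vec n" using cs FC(2) G(2) PV by blast
  define M where "M a j = (us @ es @ ws) ! a $ (j - 1)" for a j
  define A0 where "A0 = mat_of_rows n ?as"
  have A0: "A0 \<in> carrier_mat k n" unfolding A0_def using as(2) by (metis mat_of_rows_carrier(1))
  have A0e: "A0 $$ (a, j) = ?as ! a $ j" if "a < k" "j < n" for a j
    using that as(2) by (simp add: A0_def mat_of_rows_index)
  have rowsA0: "rows A0 = ?as" unfolding A0_def by (rule rows_mat_of_rows[OF asV])
  have rsA0: "row_space A0 = ?V" unfolding row_space_def[of A0] rowsA0 as(1) by (rule FA(5))
  have "\<exists>y. y \<in> carrier_vec k \<and> transpose_mat A0 *\<^sub>v y = row A i" if i: "i < k" for i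
  proof -
    have "set (rows A) \<subseteq> carrier_vec n" using A by (auto simp: rows_def)
    moreover have "row A i \<in> set (rows A)" using i A by (metis carrier_matD(1) length_rows nth_mem nth_rows)
    ultimately have "row A i \<in> row_space A0" unfolding rsA0 row_space_def[of A] using in_own_span by blast
    then show ?thesis unfolding row_space_eq[OF A0] using A0 by auto
  qed
  then obtain y where y: "\<And>i. i < k \<Longrightarrow> y i \<in> carrier_vec k" "\<And>i. i < k \<Longrightarrow> transpose_mat A0 *\<^sub>v y i = row A i"
    by metis
  define T where "T = mat k k (\<lambda>(i, j). y i $ j)"
  have T: "T \<in> carrier_mat k k" by (simp add: T_def)
  have TA: "A $$ (i, j) = (\<Sum>a\<in>{0..<k}. T $$ (i, a) * A0 $$ (a, j))" if ij: "i < k" "j < n" for i j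
  proof -
    have "A $$ (i, j) = (transpose_mat A0 *\<^sub>v y i) $ j" using y(2)[OF ij(1)] ij A by simp
    also have "\<dots> = (\<Sum>a\<in>{0..<k}. A0 $$ (a, j) * y i $ a)"
      using y(1)[OF ij(1)] ij A0 by (simp add: scalar_prod_def)
    also have "\<dots> = (\<Sum>a\<in>{0..<k}. T $$ (i, a) * A0 $$ (a, j))"
      by (rule sum.cong) (use ij in \<open>auto simp: T_def mult.commute\<close>)
    finally show ?thesis .
  qed
  have pA: "plucker_coord k A I = det T * minor M 0 k I" if I: "I \<in> plucker_indices k n" for I
  proof -
    let ?A0I = "mat k k (\<lambda>(a, b). A0 $$ (a, I ! b - 1))"
    have rng: "I ! b - 1 < n" if "b < k" for b using plucker_nth_range[OF I that] by auto
    have "mat k k (\<lambda>(a, b). A $$ (a, I ! b - 1)) = T * ?A0I"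
      by (rule eq_matI) (use T rng in \<open>auto simp: TA scalar_prod_def\<close>)
    then have "plucker_coord k A I = det T * det ?A0I"
      unfolding plucker_coord_def using det_mult[OF T, of ?A0I] by simp
    also have "det ?A0I = plucker_coord k A0 I" by (simp add: plucker_coord_def)
    also have "\<dots> = minor M 0 k I"
    proof (rule angle_coordinate[OF I])
      fix a j assume a: "a < k" and j: "j < n"
      have "(us @ es @ ws) ! a = ?as ! a"
        using a as(2) by (simp only: append_assoc[symmetric] nth_append) simp
      then show "A0 $$ (a, j) = M a (Suc j)" using A0e[OF a j] by (simp add: M_def)
    qed
    finally show ?thesis .
  qed
  obtain X where X: "X \<in> carrier_mat n n" "det X \<noteq> 0" "\<And>i. i < length ?cs \<Longrightarrow> row X i = ?cs ! i"
    using complete_to_invertible[OF csV cs(2)] liFC cs(1) by metis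
  define H where "H = mat k k (\<lambda>(i, j). (X * transpose_mat B) $$ (i + ?q, j))"
  have H: "H \<in> carrier_mat k k" by (simp add: H_def)
  have XB: "X * transpose_mat B = mat n k (\<lambda>(i, j). if i < ?q then 0 else H $$ (i - ?q, j))"
  proof (rule eq_matI)
    fix i j assume "i < dim_row (mat n k (\<lambda>(i, j). if i < ?q then 0 else H $$ (i - ?q, j)))"
      "j < dim_col (mat n k (\<lambda>(i, j). if i < ?q then 0 else H $$ (i - ?q, j)))"
    then have ij: "i < n" "j < k" by auto
    show "(X * transpose_mat B) $$ (i, j) = mat n k (\<lambda>(i, j). if i < ?q then 0 else H $$ (i - ?q, j)) $$ (i, j)"
    proof (cases "i < ?q")
      case True
      then have "row X i \<in> ?P" using X(3)[of i] lcs cs(1) FC(2) G(2) nth_mem[of i ?cs] by auto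
      moreover have "row B j \<in> ?W"
      proof -
        have "set (rows B) \<subseteq> carrier_vec n" using B by (auto simp: rows_def)
        moreover have "row B j \<in> set (rows B)" using ij B by (metis carrier_matD(1) length_rows nth_mem nth_rows)
        ultimately show ?thesis unfolding row_space_def using in_own_span by blast
      qed
      ultimately have "row X i \<bullet> row B j = 0" by (simp add: orthogonal_complement_def)
      then show ?thesis using True ij X(1) B by simp
    next
      case False
      then show ?thesis using ij by (auto simp: H_def)
    qed
  qed (use X B in auto)
  have pB: "d * plucker_coord k B J = d * det H / det X * complement_sign n J * minor M r N (complement_list n J)"
    if J: "J \<in> plucker_indices k n" for J
  proof -
    have "X $$ (a, j) = M (r + a) (Suc j)" if "a < ?q" "j < n" for a j
    proof -
      have "X $$ (a, j) = row X a $ j" using that X(1) by simp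
      moreover have "row X a = (us @ ?cs) ! (r + a)" using X(3)[of a] that lcs lus by (simp add: nth_append)
      ultimately show ?thesis by (simp add: M_def)
    qed
    from square_coordinate[OF X(1) B H XB this J] show ?thesis
      using X(2) by (simp add: field_simps)
  qed
  have "f x = coords (M, c * det T, d * det H / det X) x" if "x \<in> vars" for x
    unfolding f by (rule coords_agree[OF _ pB that]) (simp add: pA)
  then show ?thesis by blast
qed

lemma eval_cong_vars:
  assumes "p \<in> carrier (bracket_ring k n)" "\<And>x. x \<in> vars \<Longrightarrow> f x = g x"
  shows "eval_bracket_poly f p = eval_bracket_poly g p"
  unfolding eval_bracket_poly_alt
proof (intro sum.cong refl arg_cong2[where f = "(*)"] monomial_value_cong assms(2))
  fix m x assume "m \<in> keys p" "x \<in> keys m"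
  then show "x \<in> vars" using assms(1) by (auto simp: bracket_ring_carrier_iff)
qed

text \<open>Only a parameter matrix with independent first \<open>k\<close> rows and independent last \<open>n - k\<close>
rows defines a point of the cone. This suffices: multiplied by one bracket of each kind, a polynomial of the
ideal vanishes for all parameters, and these brackets do not vanish identically.\<close>

theorem spinor_helicity_ideal_eq:
  "spinor_helicity_ideal k n r = {p \<in> carrier (bracket_ring k n). \<forall>P. eval_bracket_poly (coords P) p = 0}"
proof (intro equalityI subsetI)
  fix p assume p: "p \<in> {p \<in> carrier (bracket_ring k n). \<forall>P. eval_bracket_poly (coords P) p = 0}"
  show "p \<in> spinor_helicity_ideal k n r"
    unfolding spinor_helicity_ideal_def
  proof (intro CollectI conjI ballI)
    show "p \<in> carrier (bracket_ring k n)" using p by simp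
    fix f assume "f \<in> spinor_helicity_cone k n r"
    then obtain P where "\<forall>x\<in>vars. f x = coords P x" using cone_point_parametrized by blast
    then have "eval_bracket_poly f p = eval_bracket_poly (coords P) p"
      using p by (intro eval_cong_vars) auto
    moreover have "eval_bracket_poly (coords P) p = 0" using p by blast
    ultimately show "eval_bracket_poly f p = 0" by simp
  qed
next
  fix p assume p: "p \<in> spinor_helicity_ideal k n r"
  have pc: "p \<in> carrier (bracket_ring k n)" using p by (simp add: spinor_helicity_ideal_def)
  define I0 where "I0 = [1..<k + 1]"
  have I0: "I0 \<in> plucker_indices k n"
    using bounds(1) by (auto simp: I0_def plucker_indices_def simp del: upt_Suc)
  let ?x = "Angle I0" and ?y = "Square I0"
  have xy: "?x \<in> vars" "?y \<in> vars" using I0 by (auto simp: bracket_vars_def)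
  let ?ev = "\<lambda>x. eval_bracket_poly x"
  let ?u = "poly_of_var ?x" and ?v = "poly_of_var ?y"
  have ev: "?ev (coords P) ?u = coords P ?x" "?ev (coords P) ?v = coords P ?y" for P
    by (simp_all only: poly_of_var_def poly_of_monomial_def eval_single monomial_value_single power_one_right mult_1)
  have generic: "?ev (coords P) (?u * ?v) * ?ev (coords P) p = 0" for P
  proof (cases "coords P ?x = 0 \<or> coords P ?y = 0")
    case True
    then show ?thesis by (auto simp: eval_mult ev)
  next
    case False
    obtain M c d where P: "P = (M, c, d)" by (cases P)
    have "minor M 0 k I0 \<noteq> 0" "minor M r N (complement_list n I0) \<noteq> 0"
      using False by (auto simp: P bracket_value_def top_row_def end_row_def)
    then obtain f where f: "f \<in> spinor_helicity_cone k n r" "\<forall>x\<in>vars. f x = coords P x"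
      using generic_point_in_cone[OF I0 _ complement_list_in_plucker[OF I0]] P by blast
    then have "?ev (coords P) p = ?ev f p" using pc by (intro eval_cong_vars) auto
    then show ?thesis using p f(1) by (simp add: spinor_helicity_ideal_def)
  qed
  obtain P1 where P1: "coords P1 ?x \<noteq> 0" using schubert_nonzero[OF xy(1)] by blast
  obtain P2 where P2: "coords P2 ?y \<noteq> 0" using schubert_nonzero[OF xy(2)] by blast
  have "\<exists>P. ?ev (coords P) ?u * ?ev (coords P) ?v \<noteq> 0"
  proof (rule ccontr)
    assume "\<not> ?thesis"
    then have "?ev (coords P2) ?v = 0"
      by (intro product_vanishes_on_linear_set[of UNIV ?u ?v P1]) (use P1 ev in auto)
    then show False using P2 ev by simp
  qed
  then obtain P0 where P0: "?ev (coords P0) (?u * ?v) \<noteq> 0" by (auto simp: eval_mult)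
  have "?ev (coords P) p = 0" for P
    by (rule product_vanishes_on_linear_set[of UNIV "?u * ?v" p P0]) (use generic P0 in auto)
  then show "p \<in> {p \<in> carrier (bracket_ring k n). \<forall>P. eval_bracket_poly (coords P) p = 0}" using pc by blast
qed

end

section \<open>The theorem\<close>

theorem theorem2p7:
  fixes k n r :: nat
  assumes "k \<ge> 1" and "r \<le> k" and "2 * k \<le> r + n"
  shows "primeideal (spinor_helicity_ideal k n r) (bracket_ring k n)
    \<and> (\<exists>G. minimally_generates (bracket_ring k n) G (spinor_helicity_ideal k n r)
          \<and> (\<forall>g \<in> G. quadratic_form k n g)
          \<and> (\<forall>L. linear_extension k n r L \<longrightarrow>
                groebner_basis k n L G (spinor_helicity_ideal k n r)))
    \<and> (\<forall>L. linear_extension k n r L \<longrightarrow>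
          initial_ideal k n L (spinor_helicity_ideal k n r)
            = genideal (bracket_ring k n) (incomparable_products k n r))"
proof -
  interpret spinor_helicity_parameters k n r using assms by unfold_locales
  have "spinor_helicity_ideal k n r = vanishing_ideal"
    by (simp only: spinor_helicity_ideal_eq vanishing_ideal_def)
  then show ?thesis using vanishing_ideal_structure by simp
qed

end
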